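(* Let $\mathbb{H}$ be a field with $\mathbb{Q}\subset\mathbb{H}\subset\mathbb{C}$, let $A\in\mathbb{H}^{n\times n}$ be nonderogatory, and let $p_A(\lambda)=g_1(\lambda)^{d_1}g_2(\lambda)^{d_2}\cdots g_r(\lambda)^{d_r}$ be the factorization of the characteristic polynomial of $A$ with $g_1,\dots,g_r\in\mathbb{H}[\lambda]$ pairwise coprime, monic and irreducible over $\mathbb{H}$, $k_j=\deg g_j$. Let $T\in\mathbb{H}^{n\times n}$ be invertible with $$A=T^{-1}(C_1\oplus C_2\oplus\cdots\oplus C_r)T$$ the companion-Jordan form of $A$, i.e. each $C_j$ is the $d_jk_j\times d_jk_j$ block upper triangular matrix having $d_j$ diagonal blocks equal to the companion matrix $C_{g_j}$, blocks $I_{k_j}$ on the first block superdiagonal, and zero blocks elsewhere. Let $p(\lambda)=p_0+p_1\lambda+\cdots+p_\ell\lambda^\ell\in\mathbb{H}[\lambda]$. Then the following hold, where conditions (D), (D$'$) and equations (E$_2$), (E$_s$) are those defined in the context. (i) If $p(X)=A$ has a solution $X\in\mathbb{H}^{n\times n}$, then for each root $\lambda_0$ of each $g_j(\lambda)$ there is $\mu\in\mathbb{H}(\lambda_0)$ with $p(\mu)=\lambda_0$. For (ii)–(v), conversely assume that for each eigenvalue $\lambda_0$ of $A$ the equation $p(\mu)=\lambda_0$ has a solution $\mu\in\mathbb{H}(\lambda_0)$. For $j=1,\dots,r$ let $\lambda_j$ be a root of $g_j(\lambda)$ and let $m_j$ denote the number of solutions $\mu\in\mathbb{H}(\lambda_j)$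 of $p(\mu)=\lambda_j$. (ii) For each $j=1,\dots,r$ there are $m_j$ solutions $X_{1,j}\in\mathbb{H}^{k_j\times k_j}$ of $p(X_{1,j})=C_{g_j}$. (iii) If for each $j$ with $d_j>1$ there is at least one solution $X_{1,j}\in\mathbb{H}^{k_j\times k_j}$ of $p(X_{1,j})=C_{g_j}$ which satisfies condition (D), or equivalently condition (D$'$), then there is a solution $X\in\mathbb{H}^{n\times n}$ of $p(X)=A$, and such a solution can be constructed explicitly via the solution of a set of linear equations, as follows. It is of the form $$X=T^{-1}(Y_1\oplus Y_2\oplus\cdots\oplus Y_r)T,$$ where each $Y_j$ is the block upper triangular Toeplitz matrix $$Y_j=\begin{bmatrix} X_{1,j}&X_{2,j}&\cdots&X_{d_j,j}\\0&X_{1,j}&\ddots&\vdots\\ \vdots&\ddots&\ddots&X_{2,j}\\0&\cdots&0&X_{1,j}\end{bmatrix}$$ with blocks in $\mathbb{H}^{k_j\times k_j}$. Here $X_{1,j}$ is a solution of $p(X_{1,j})=C_{g_j}$, for which (D) holds when $d_j>1$; if $d_j\ge 2$, $X_{2,j}$ is the unique solution of (E$_2$); and for $s=3,\dots,d_j$, $X_{s,j}$ is the unique solution of (E$_s$). (iv) If condition (D), or equivalently (D$'$), is satisfied for each $j$ with $d_j>1$ and for every solution $X_{1,j}\in\mathbb{H}^{k_j\times k_j}$ of $p(X_{1,j})=C_{g_j}$, then there are precisely $m_1m_2\cdots m_r$ solutions $X\in\mathbb{H}^{n\times n}$ of $p(X)=A$. (v) If $d_j>1$ and (D) is not satisfied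 for some solution $X_{1,j}\in\mathbb{H}^{k_j\times k_j}$ of $p(X_{1,j})=C_{g_j}$, but the equations (E$_2$) and (E$_s$), $s=3,\dots,d_j$, are (successively) solvable with this choice of $X_{1,j}$, then a solution $X\in\mathbb{H}^{n\times n}$ of $p(X)=A$ can still be constructed as indicated in (iii). In fact, there are infinitely many solutions in that case.
   Context: A square matrix is nonderogatory if each of its (complex) eigenvalues has geometric multiplicity one. $\mathbb{H}(\lambda_0)\subset\mathbb{C}$ is the field generated by $\lambda_0$ over $\mathbb{H}$. The companion matrix of a monic polynomial $g(\lambda)=\lambda^k+a_{k-1}\lambda^{k-1}+\cdots+a_0$ is the $k\times k$ matrix $C_g$ with ones on the first superdiagonal, last row $(-a_0,-a_1,\dots,-a_{k-1})$, and zeros elsewhere (so $C_g=[-a_0]$ if $k=1$). $\oplus$ denotes block diagonal direct sum, $\otimes$ the Kronecker product ($A\otimes B=[a_{ij}B]$), $\mathrm{vec}(M)$ the column vector obtained by stacking the columns of $M$, and $\sigma(M)$ the set of complex eigenvalues of $M$. Fix $j$ and write $k=k_j$, $X_s=X_{s,j}$. Condition (D) for $X_1$: $$\det\left(\sum_{m=1}^\ell p_m\sum_{i=0}^{m-1}(X_1^T)^i\otimes X_1^{m-1-i}\right)\neq 0.$$ Condition (D$'$) for $X_1$: $$\sum_{m=1}^\ell p_m\sum_{i=0}^{m-1}\mu_1^i\mu_2^{m-1-i}\neq 0\quad\text{for each pair } \mu_1,\mu_2\in\sigma(X_1).$$ Equation (E$_2$), with unknown $X_2\in\mathbb{H}^{k\times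 k}$: $$\sum_{m=1}^\ell p_m\sum_{i=0}^{m-1}X_1^{m-1-i}X_2X_1^i=I_k.$$ Equation (E$_s$) for $s\ge 3$, with unknown $X_s\in\mathbb{H}^{k\times k}$ and with $X_1,\dots,X_{s-1}$ already determined: $$\left(\sum_{m=1}^\ell p_m\sum_{i=0}^{m-1}(X_1^T)^i\otimes X_1^{m-1-i}\right)\mathrm{vec}(X_s)=-\mathrm{vec}\left(\sum_{m=2}^\ell p_m\sum_{i=0}^{m-2}\sum_{\nu=0}^{m-i-2}X_1^{m-i-2-\nu}\begin{bmatrix}X_2&\cdots&X_{s-1}\end{bmatrix}\widetilde X_1^{\,\nu}\begin{bmatrix}X_{s-1}\\ \vdots\\ X_2\end{bmatrix}X_1^i\right),$$ where $\widetilde X_1$ is the $(s-2)\times(s-2)$ block upper triangular block Toeplitz matrix with first block row $\begin{bmatrix}X_1&X_2&\cdots&X_{s-2}\end{bmatrix}$. *)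

theory Defs
  imports
    "Jordan_Normal_Form.Spectral_Radius"
    "Jordan_Normal_Form.Matrix_Kernel"
    "HOL-Algebra.Generated_Fields"
    "HOL-Library.Extended_Nat"
begin

hide_const (open) up_ring.coeff up_ring.monom

text \<open>
  A field between the rationals and the complex numbers is a set \<open>H :: complex set\<close> with
  \<open>subfield H class_ring\<close>, where \<^const>\<open>class_ring\<close> is the field of all complex numbers viewed
  as a \<open>HOL-Algebra\<close> ring (such an \<open>H\<close> contains the rationals automatically).  Matrices and
  polynomials over \<open>H\<close> are complex ones with entries, resp. coefficients, in \<open>H\<close>.
  Matrix and block positions are counted from 0; the Toeplitz blocks \<open>X 1, X 2, ...\<close> are
  counted from 1.
\<close>

definition mats_over :: "complex set \<Rightarrow> nat \<Rightarrow> complex mat set" where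
  "mats_over H n = {M \<in> carrier_mat n n. elements_mat M \<subseteq> H}"

definition polys_over :: "complex set \<Rightarrow> complex poly set" where
  "polys_over H = {q. \<forall>i. coeff q i \<in> H}"

definition irreducible_over :: "complex set \<Rightarrow> complex poly \<Rightarrow> bool" where
  "irreducible_over H g \<longleftrightarrow> g \<in> polys_over H \<and> degree g > 0 \<and>
     (\<forall>a \<in> polys_over H. \<forall>b \<in> polys_over H. g = a * b \<longrightarrow> degree a = 0 \<or> degree b = 0)"

definition adjoin :: "complex set \<Rightarrow> complex \<Rightarrow> complex set" where
  "adjoin H z = generate_field class_ring (insert z H)"

definition nonderogatory :: "complex mat \<Rightarrow> bool" where
  "nonderogatory A \<longleftrightarrow> square_mat A \<and> (\<forall>e \<in> spectrum A. kernel_dim (char_matrix A e) = 1)"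

text \<open>Number of elements, with value \<open>\<infinity>\<close> on infinite sets (\<^const>\<open>card\<close> is 0 there).\<close>

definition ecard :: "'a set \<Rightarrow> enat" where
  "ecard S = (if finite S then enat (card S) else \<infinity>)"

text \<open>Matrices of unspecified dimension do not form an additive monoid, so \<^const>\<open>sum\<close> is not
  available for them; \<open>mat_sum nr nc f S\<close> is the sum of the \<open>nr \<times> nc\<close> matrices \<open>f x\<close>, \<open>x \<in> S\<close>.\<close>

definition mat_sum :: "nat \<Rightarrow> nat \<Rightarrow> ('b \<Rightarrow> complex mat) \<Rightarrow> 'b set \<Rightarrow> complex mat" where
  "mat_sum nr nc f S = mat nr nc (\<lambda>ij. \<Sum>x\<in>S. f x $$ ij)"

definition poly_mat :: "complex poly \<Rightarrow> complex mat \<Rightarrow> complex mat" where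
  "poly_mat p X = mat_sum (dim_row X) (dim_row X) (\<lambda>m. coeff p m \<cdot>\<^sub>m (X ^\<^sub>m m)) {0..degree p}"

definition poly_sols :: "complex set \<Rightarrow> nat \<Rightarrow> complex poly \<Rightarrow> complex mat \<Rightarrow> complex mat set" where
  "poly_sols H n p B = {X \<in> mats_over H n. poly_mat p X = B}"

text \<open>The \<open>d \<times> e\<close> block matrix whose block in position \<open>(a, b)\<close> is the \<open>k \<times> l\<close> matrix \<open>F a b\<close>.\<close>

definition block_mat :: "nat \<Rightarrow> nat \<Rightarrow> nat \<Rightarrow> nat \<Rightarrow> (nat \<Rightarrow> nat \<Rightarrow> complex mat) \<Rightarrow> complex mat" where
  "block_mat d e k l F =
     mat (d * k) (e * l) (\<lambda>(i, j). F (i div k) (j div l) $$ (i mod k, j mod l))"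

definition companion :: "complex poly \<Rightarrow> complex mat" where
  "companion g = mat (degree g) (degree g)
     (\<lambda>(i, j). if Suc i = degree g then - coeff g j else if j = Suc i then 1 else 0)"

definition companion_jordan :: "complex poly \<Rightarrow> nat \<Rightarrow> complex mat" where
  "companion_jordan g d = (let k = degree g in
     block_mat d d k k
       (\<lambda>a b. if a = b then companion g else if b = Suc a then 1\<^sub>m k else 0\<^sub>m k k))"

definition block_toeplitz :: "nat \<Rightarrow> nat \<Rightarrow> (nat \<Rightarrow> complex mat) \<Rightarrow> complex mat" where
  "block_toeplitz k d X =
     block_mat d d k k (\<lambda>a b. if a \<le> b then X (b - a + 1) else 0\<^sub>m k k)"

definition kronecker :: "complex mat \<Rightarrow> complex mat \<Rightarrow> complex mat" where
  "kronecker A B = block_mat (dim_row A) (dim_col A) (dim_row B) (dim_col B)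
     (\<lambda>i j. (A $$ (i, j)) \<cdot>\<^sub>m B)"

text \<open>Column stacking: entry \<open>(i, j)\<close> of \<open>M\<close> goes to position \<open>j * dim_row M + i\<close>.\<close>

definition vectorize :: "complex mat \<Rightarrow> complex vec" where
  "vectorize M =
     vec (dim_row M * dim_col M) (\<lambda>t. M $$ (t mod dim_row M, t div dim_row M))"

text \<open>The matrix of the linear map
  \<open>vec Z \<mapsto> vec (\<Sum>m. p\<^sub>m * (\<Sum>i<m. X ^ (m - 1 - i) * Z * X ^ i))\<close>.\<close>

definition diff_matrix :: "complex poly \<Rightarrow> complex mat \<Rightarrow> complex mat" where
  "diff_matrix p X = (let N = dim_row X * dim_row X in
     mat_sum N N
       (\<lambda>m. coeff p m \<cdot>\<^sub>m
          mat_sum N N (\<lambda>i. kronecker (transpose_mat X ^\<^sub>m i) (X ^\<^sub>m (m - 1 - i))) {0..m - 1})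
       {1..degree p})"

definition cond_D :: "complex poly \<Rightarrow> complex mat \<Rightarrow> bool" where
  "cond_D p X \<longleftrightarrow> det (diff_matrix p X) \<noteq> 0"

definition cond_D' :: "complex poly \<Rightarrow> complex mat \<Rightarrow> bool" where
  "cond_D' p X \<longleftrightarrow> (\<forall>\<mu>\<^sub>1 \<in> spectrum X. \<forall>\<mu>\<^sub>2 \<in> spectrum X.
     (\<Sum>m = 1..degree p. coeff p m * (\<Sum>i = 0..m - 1. \<mu>\<^sub>1 ^ i * \<mu>\<^sub>2 ^ (m - 1 - i))) \<noteq> 0)"

text \<open>Equating the blocks in position \<open>(0, s - 1)\<close> of \<open>poly_mat p Y\<close> and of
  \<open>companion_jordan g d\<close>, where \<open>Y\<close> is the block Toeplitz matrix of \<open>X 1, ..., X d\<close>, gives a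
  linear equation for \<open>X s\<close> in terms of \<open>X 1, ..., X (s - 1)\<close>.  \<open>E2_sols\<close> is the set of
  solutions over \<open>H\<close> for \<open>s = 2\<close> and \<open>Es_sols\<close> the one for \<open>s \<ge> 3\<close>, where the equation is
  written in vectorized form; \<open>Es_sols H k p X s\<close> depends only on \<open>X 1, ..., X (s - 1)\<close>.
  \<open>Es_rhs\<close> collects the words in \<open>X 1, ..., X (s - 1)\<close> with at least two letters other than
  \<open>X 1\<close>: \<open>R\<close> and \<open>L\<close> are the block row \<open>[X 2, ..., X (s - 1)]\<close> and the block column
  \<open>[X (s - 1), ..., X 2]\<close>.\<close>

definition E2_sols :: "complex set \<Rightarrow> nat \<Rightarrow> complex poly \<Rightarrow> complex mat \<Rightarrow> complex mat set" where
  "E2_sols H k p X1 = {X2 \<in> mats_over H k.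
     mat_sum k k
       (\<lambda>m. coeff p m \<cdot>\<^sub>m mat_sum k k (\<lambda>i. X1 ^\<^sub>m (m - 1 - i) * X2 * X1 ^\<^sub>m i) {0..m - 1})
       {1..degree p}
     = 1\<^sub>m k}"

definition Es_rhs :: "nat \<Rightarrow> complex poly \<Rightarrow> (nat \<Rightarrow> complex mat) \<Rightarrow> nat \<Rightarrow> complex mat" where
  "Es_rhs k p X s =
     (let R = block_mat 1 (s - 2) k k (\<lambda>a b. X (b + 2));
          L = block_mat (s - 2) 1 k k (\<lambda>a b. X (s - 1 - a));
          X1t = block_toeplitz k (s - 2) X
      in mat_sum k k
           (\<lambda>m. coeff p m \<cdot>\<^sub>m
              mat_sum k k
                (\<lambda>i. mat_sum k k
                       (\<lambda>\<nu>. X 1 ^\<^sub>m (m - i - 2 - \<nu>) * R * X1t ^\<^sub>m \<nu> * L * X 1 ^\<^sub>m i)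
                       {0..m - i - 2})
                {0..m - 2})
           {2..degree p})"

definition Es_sols ::
  "complex set \<Rightarrow> nat \<Rightarrow> complex poly \<Rightarrow> (nat \<Rightarrow> complex mat) \<Rightarrow> nat \<Rightarrow> complex mat set" where
  "Es_sols H k p X s = {Z \<in> mats_over H k.
     diff_matrix p (X 1) *\<^sub>v vectorize Z = - vectorize (Es_rhs k p X s)}"

definition successive_sols ::
  "complex set \<Rightarrow> complex poly \<Rightarrow> complex poly \<Rightarrow> nat \<Rightarrow> (nat \<Rightarrow> complex mat) \<Rightarrow> bool" where
  "successive_sols H p g d X \<longleftrightarrow>
     X 1 \<in> poly_sols H (degree g) p (companion g) \<and>
     (2 \<le> d \<longrightarrow> X 2 \<in> E2_sols H (degree g) p (X 1)) \<and>
     (\<forall>s \<in> {3..d}. X s \<in> Es_sols H (degree g) p X s)"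

definition unique_successive_sols ::
  "complex set \<Rightarrow> complex poly \<Rightarrow> complex poly \<Rightarrow> nat \<Rightarrow> (nat \<Rightarrow> complex mat) \<Rightarrow> bool" where
  "unique_successive_sols H p g d X \<longleftrightarrow>
     X 1 \<in> poly_sols H (degree g) p (companion g) \<and>
     (2 \<le> d \<longrightarrow> E2_sols H (degree g) p (X 1) = {X 2}) \<and>
     (\<forall>s \<in> {3..d}. Es_sols H (degree g) p X s = {X s})"

text \<open>\<open>T\<inverse> (Y\<^sub>1 \<oplus> ... \<oplus> Y\<^sub>r) T\<close> with \<open>Y\<^sub>j\<close> the block Toeplitz matrix of \<open>X j 1, ..., X j (d j)\<close>;
  \<open>T'\<close> stands for the inverse of \<open>T\<close>.\<close>

definition assembled ::
  "complex mat \<Rightarrow> complex mat \<Rightarrow> nat \<Rightarrow> (nat \<Rightarrow> complex poly) \<Rightarrow> (nat \<Rightarrow> nat) \<Rightarrow>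
   (nat \<Rightarrow> nat \<Rightarrow> complex mat) \<Rightarrow> complex mat" where
  "assembled T T' r g d X =
     T' * diag_block_mat (map (\<lambda>j. block_toeplitz (degree (g j)) (d j) (X j)) [0..<r]) * T"

end

theory Submission
  imports
    Defs
    "HOL-Computational_Algebra.Formal_Power_Series"
    "HOL-Computational_Algebra.Polynomial_Factorial"
    "HOL-Computational_Algebra.Field_as_Ring"
begin

text \<open>
  A solution \<open>X\<close> of \<open>p(X) = A\<close> commutes with \<open>A\<close>, hence \<open>T X T\<inverse>\<close> commutes with the sum \<open>B\<close> of the
  companion-Jordan blocks.  The row vector with a 1 at the start of each block and zeros elsewhere
  is cyclic for \<open>B\<close>: a polynomial that annihilates it is divisible by each \<open>g\<^sub>j ^ d\<^sub>j\<close>, hence by the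
  characteristic polynomial.  Therefore every matrix commuting with \<open>B\<close> is a polynomial in \<open>B\<close>
  (\<open>commutant_eq_polys\<close>).  A polynomial in \<open>B\<close> is a direct sum of block Toeplitz matrices, because a
  companion-Jordan block is one and these matrices are closed under sums and products.  So the solutions
  are exactly the matrices \<open>T\<inverse> (Y\<^sub>1 \<oplus> \<dots> \<oplus> Y\<^sub>r) T\<close> with \<open>Y\<^sub>j\<close> block Toeplitz over \<open>H\<close> and
  \<open>p(Y\<^sub>j) = C\<^sub>j\<close> (\<open>solutions_eq_assembled\<close>).

  A block Toeplitz matrix is a truncated power series \<open>x = x\<^sub>0 + x\<^sub>1 t + \<dots>\<close> with matrix coefficients.
  Expanding \<open>x ^ m\<close> around the constant series \<open>c = x\<^sub>0\<close>, first from the right and then from the left,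
  separates the words with exactly one letter other than \<open>c\<close> from those with at least two
  (\<open>power_second_order_expansion\<close>).  In the coefficient of \<open>t ^ (s - 1)\<close> the former give the operator of
  condition (D), applied to the unknown \<open>X\<^sub>s\<close>, and the latter give the right-hand side of
  (E\<open>\<^sub>s\<close>) with its sign changed.  Thus \<open>p(Y) = C\<^sub>j\<close> says precisely that \<open>p(X\<^sub>1)\<close> is the companion
  matrix and that the successive linear equations hold (\<open>successive_sols_iff\<close>).  Under (D) these have
  unique solutions, with entries in \<open>H\<close> by Cramer's rule, which proves (iii).  For (iv), a solution
  is then determined by its diagonal blocks \<open>X\<^sub>1\<^sub>,\<^sub>j\<close>, and these can be prescribed independently.

  For a single companion matrix \<open>C\<close> of \<open>g\<close>, the solutions of \<open>p(X) = C\<close> are the matrices \<open>q(C)\<close> with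
  \<open>deg q < deg g\<close> for which \<open>g\<close> divides \<open>p(q(\<lambda>)) - \<lambda>\<close>.  As \<open>g\<close> is irreducible, this means that
  \<open>\<mu> = q(\<lambda>\<^sub>0)\<close> satisfies \<open>p(\<mu>) = \<lambda>\<^sub>0\<close> for a root \<open>\<lambda>\<^sub>0\<close> of \<open>g\<close> (\<open>companion_solutions\<close>).  This gives (ii), and
  also (i), since the leading block of \<open>Y\<^sub>j\<close> is such a solution.

  The conditions (D) and (D') agree because left and right multiplication by \<open>X\<close> commute, so a
  nonzero kernel of the operator contains a common eigenvector (\<open>cond_D_iff_cond_D'\<close>).

  In (v) the two hypotheses on the chosen \<open>X\<^sub>1\<close> exclude each other: if (E\<open>\<^sub>2\<close>) has a solution at a
  solution \<open>X\<^sub>1\<close> of \<open>p(X\<^sub>1) = C\<close>, then (D) holds for \<open>X\<^sub>1\<close> (\<open>E2_solvable_imp_cond_D\<close>).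
\<close>

section \<open>Subfields of the complex numbers and polynomials over them\<close>

locale number_field =
  fixes H :: "complex set"
  assumes subfield: "subfield H class_ring"
begin

lemma zero_mem [simp]: "0 \<in> H" and one_mem [simp]: "1 \<in> H"
  and uminus_mem: "x \<in> H \<Longrightarrow> - x \<in> H"
  and add_mem: "x \<in> H \<Longrightarrow> y \<in> H \<Longrightarrow> x + y \<in> H"
  and mult_mem: "x \<in> H \<Longrightarrow> y \<in> H \<Longrightarrow> x * y \<in> H"
  and inverse_mem: "x \<in> H \<Longrightarrow> inverse x \<in> H"
proof -
  note rg = class_ring.ring_axioms
  have sr: "subring H (class_ring :: complex ring)"
    using subfield by (simp add: subfield_def subdomain_def subcring_def)
  have D: "0 \<in> H \<and> 1 \<in> H \<and> (\<forall>x\<in>H. \<forall>y\<in>H. x + y \<in> H \<and> x * y \<in> H)"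
    using subringE(2,3,6,7)[OF sr] by (auto simp: class_ring_simps)
  have m: "- x \<in> H" if "x \<in> H" for x
  proof -
    show ?thesis using subringE(5)[OF sr that] by (simp add: class_ring_simps)
  qed
  have i: "inverse x \<in> H" if "x \<in> H" for x
  proof (cases "x = 0")
    case False
    then have "inv\<^bsub>class_ring\<^esub> x \<in> H"
      using ring.subfield_m_inv(1)[OF rg subfield, of x] that by (simp add: class_ring_simps)
    then show ?thesis using False by (simp add: class_ring_simps)
  qed (use D in auto)
  show "0 \<in> H" "1 \<in> H" "x \<in> H \<Longrightarrow> - x \<in> H" "x \<in> H \<Longrightarrow> y \<in> H \<Longrightarrow> x + y \<in> H"
    "x \<in> H \<Longrightarrow> y \<in> H \<Longrightarrow> x * y \<in> H" "x \<in> H \<Longrightarrow> inverse x \<in> H"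
    using D m i by auto
qed

lemma diff_mem: "x \<in> H \<Longrightarrow> y \<in> H \<Longrightarrow> x - y \<in> H"
  using add_mem[of x "- y"] uminus_mem by simp

lemma divide_mem: "x \<in> H \<Longrightarrow> y \<in> H \<Longrightarrow> x / y \<in> H"
  using mult_mem inverse_mem by (simp add: divide_inverse)

lemma sum_mem: "(\<And>i. i \<in> S \<Longrightarrow> f i \<in> H) \<Longrightarrow> sum f S \<in> H"
  by (induction S rule: infinite_finite_induct) (auto intro: add_mem)

lemma prod_mem: "(\<And>i. i \<in> S \<Longrightarrow> f i \<in> H) \<Longrightarrow> prod f S \<in> H"
  by (induction S rule: infinite_finite_induct) (auto intro: mult_mem)

lemma of_nat_mem: "of_nat m \<in> H"
  by (induction m) (auto intro: add_mem)

lemma power_mem: "x \<in> H \<Longrightarrow> x ^ m \<in> H"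
  by (induction m) (auto intro: mult_mem)

lemma polys_over_0 [simp]: "0 \<in> polys_over H"
  and polys_over_1 [simp]: "1 \<in> polys_over H"
  and polys_over_pCons: "pCons c q \<in> polys_over H \<longleftrightarrow> c \<in> H \<and> q \<in> polys_over H"
  by (auto simp: polys_over_def coeff_pCons one_pCons split: nat.splits)

lemma polys_over_monom: "c \<in> H \<Longrightarrow> monom c i \<in> polys_over H"
  by (auto simp: polys_over_def coeff_monom)

lemma polys_over_add: "q \<in> polys_over H \<Longrightarrow> u \<in> polys_over H \<Longrightarrow> q + u \<in> polys_over H"
  by (auto simp: polys_over_def intro: add_mem)

lemma polys_over_diff: "q \<in> polys_over H \<Longrightarrow> u \<in> polys_over H \<Longrightarrow> q - u \<in> polys_over H"
  by (auto simp: polys_over_def intro: diff_mem)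

lemma polys_over_mult: "q \<in> polys_over H \<Longrightarrow> u \<in> polys_over H \<Longrightarrow> q * u \<in> polys_over H"
  by (auto simp: polys_over_def coeff_mult intro!: sum_mem mult_mem)

lemma polys_over_smult: "c \<in> H \<Longrightarrow> u \<in> polys_over H \<Longrightarrow> Polynomial.smult c u \<in> polys_over H"
  by (auto simp: polys_over_def intro!: mult_mem)

lemma polys_over_pderiv: "q \<in> polys_over H \<Longrightarrow> pderiv q \<in> polys_over H"
  unfolding polys_over_def using of_nat_mem mult_mem by (simp add: coeff_pderiv del: of_nat_Suc)

lemma polys_over_pcompose:
  assumes "q \<in> polys_over H" "u \<in> polys_over H"
  shows "pcompose q u \<in> polys_over H"
  using assms(1)
  by (induction q) (auto simp: pcompose_pCons polys_over_pCons intro!: polys_over_add polys_over_mult assms(2))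

lemma polys_over_division:
  assumes f: "f \<in> polys_over H" "f \<noteq> 0" and e: "e \<in> polys_over H"
  shows "\<exists>q\<in>polys_over H. \<exists>r\<in>polys_over H. e = f * q + r \<and> (r = 0 \<or> degree r < degree f)"
  using e
proof (induction "degree e" arbitrary: e rule: less_induct)
  case less
  show ?case
  proof (cases "degree e < degree f \<or> e = 0")
    case True
    then show ?thesis using less.prems by (intro bexI[of _ 0] bexI[of _ e]) auto
  next
    case False
    define c where "c = monom (lead_coeff e / lead_coeff f) (degree e - degree f)"
    have c: "c \<in> polys_over H"
      using f less.prems unfolding c_def
      by (intro polys_over_monom divide_mem) (auto simp: polys_over_def)
    define e' where "e' = e - c * f"
    have e': "e' \<in> polys_over H"
      unfolding e'_def using c f less.prems by (intro polys_over_diff polys_over_mult)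
    have "degree c \<le> degree e - degree f" unfolding c_def by (rule degree_monom_le)
    then have "degree (c * f) \<le> degree e"
      using degree_mult_le[of c f] False by linarith
    then have deg: "degree e' \<le> degree e" unfolding e'_def by (intro degree_diff_le) auto
    have "coeff (c * f) (degree e) = lead_coeff e"
      using False f(2) unfolding c_def by (simp add: coeff_monom_mult not_less)
    then have "coeff e' (degree e) = 0" unfolding e'_def by simp
    then have "e' = 0 \<or> degree e' < degree e" using deg eq_zero_or_degree_less by blast
    then obtain q r where qr: "q \<in> polys_over H" "r \<in> polys_over H" "e' = f * q + r"
      "r = 0 \<or> degree r < degree f"
    proof
      assume "e' = 0" then show ?thesis by (intro that[of 0 0]) auto
    next
      assume "degree e' < degree e"
      then show ?thesis using less.hyps[OF _ e'] that by blast
    qed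
    show ?thesis
      using qr c by (intro bexI[of _ "c + q"] bexI[of _ r]) (auto simp: e'_def algebra_simps intro: polys_over_add)
  qed
qed

text \<open>
  The ideal generated by \<open>g\<close> and \<open>h\<close> in \<open>H[\<lambda>]\<close> is principal, and its generator divides the
  irreducible \<open>g\<close>, so it is a unit or an associate of \<open>g\<close>.
\<close>

lemma irreducible_dvd_or_bezout:
  assumes g: "irreducible_over H g" and h: "h \<in> polys_over H"
  shows "(\<exists>u\<in>polys_over H. h = g * u) \<or>
    (\<exists>a\<in>polys_over H. \<exists>b\<in>polys_over H. a * h + b * g = 1)"
proof -
  have gH: "g \<in> polys_over H" and g0: "g \<noteq> 0" using g by (auto simp: irreducible_over_def)
  define I where "I = {a * h + b * g | a b. a \<in> polys_over H \<and> b \<in> polys_over H}"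
  have IH: "I \<subseteq> polys_over H" unfolding I_def using gH h by (auto intro: polys_over_add polys_over_mult)
  have gI: "g \<in> I" unfolding I_def by (intro CollectI exI[of _ 0] exI[of _ 1]) simp
  have hI: "h \<in> I" unfolding I_def by (intro CollectI exI[of _ 1] exI[of _ 0]) simp
  have "\<exists>f. (f \<in> I \<and> f \<noteq> 0) \<and> (\<forall>e. e \<in> I \<and> e \<noteq> 0 \<longrightarrow> degree f \<le> degree e)"
    by (rule ex_has_least_nat[of _ g]) (use gI g0 in auto)
  then obtain f where f: "f \<in> I" "f \<noteq> 0" and least: "\<And>e. e \<in> I \<Longrightarrow> e \<noteq> 0 \<Longrightarrow> degree f \<le> degree e"
    by blast
  obtain a b where ab: "f = a * h + b * g" "a \<in> polys_over H" "b \<in> polys_over H"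
    using f(1) unfolding I_def by blast
  have fH: "f \<in> polys_over H" using f IH by blast
  have dvd: "\<exists>u\<in>polys_over H. e = f * u" if e: "e \<in> I" for e
  proof -
    obtain q r where qr: "q \<in> polys_over H" "r \<in> polys_over H" "e = f * q + r"
      "r = 0 \<or> degree r < degree f"
      using polys_over_division[OF fH f(2)] e IH by blast
    obtain a' b' where ab': "e = a' * h + b' * g" "a' \<in> polys_over H" "b' \<in> polys_over H"
      using e unfolding I_def by blast
    have "r = (a' - a * q) * h + (b' - b * q) * g"
      using qr(3) ab'(1) ab(1) by (simp add: algebra_simps)
    moreover have "a' - a * q \<in> polys_over H" "b' - b * q \<in> polys_over H"
      using ab ab' qr(1) by (auto intro: polys_over_diff polys_over_mult)
    ultimately have "r \<in> I" unfolding I_def by blast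
    then have "r = 0" using least qr(4) by fastforce
    then show ?thesis using qr by auto
  qed
  obtain u where u: "u \<in> polys_over H" "h = f * u" using dvd[OF hI] by blast
  obtain v where v: "v \<in> polys_over H" "g = f * v" using dvd[OF gI] by blast
  have "degree f = 0 \<or> degree v = 0" using g fH v unfolding irreducible_over_def by simp
  then show ?thesis
  proof
    assume "degree f = 0"
    then obtain c where c: "f = [:c:]" by (auto elim: degree_eq_zeroE)
    then have c0: "c \<noteq> 0" "c \<in> H" using f(2) fH by (auto simp: polys_over_pCons)
    have "Polynomial.smult (inverse c) a * h + Polynomial.smult (inverse c) b * g = Polynomial.smult (inverse c) f"
      by (simp add: ab(1) smult_add_right)
    also have "\<dots> = 1" using c c0 by simp
    finally show ?thesis using c0 ab
      by (intro disjI2 bexI[of _ "Polynomial.smult (inverse c) a"] bexI[of _ "Polynomial.smult (inverse c) b"])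
        (auto intro: polys_over_smult inverse_mem)
  next
    assume "degree v = 0"
    then obtain c where c: "v = [:c:]" by (auto elim: degree_eq_zeroE)
    then have c0: "c \<noteq> 0" "c \<in> H" using g0 v by (auto simp: polys_over_pCons)
    have "h = g * Polynomial.smult (inverse c) u" using u v c c0 by simp
    then show ?thesis using c0 u by (auto intro!: disjI1 bexI[of _ "Polynomial.smult (inverse c) u"] polys_over_smult inverse_mem)
  qed
qed

lemma irreducible_dvd_of_common_root:
  assumes "irreducible_over H g" "h \<in> polys_over H" "poly g z = 0" "poly h z = 0"
  shows "g dvd h"
proof -
  have False if "a * h + b * g = 1" for a b
  proof -
    have "poly (a * h + b * g) z = 0" using assms by simp
    then show False using that by simp
  qed
  then show ?thesis using irreducible_dvd_or_bezout[OF assms(1,2)] by auto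
qed

text \<open>In characteristic 0 the derivative is nonzero, and its degree is too small for \<open>g\<close> to divide it.\<close>

lemma irreducible_coprime_pderiv:
  assumes "irreducible_over H g"
  shows "coprime g (pderiv g)"
proof -
  have gH: "g \<in> polys_over H" and dg: "degree g > 0" using assms by (auto simp: irreducible_over_def)
  have "\<not> g dvd pderiv g"
  proof
    assume "g dvd pderiv g"
    moreover have "pderiv g \<noteq> 0" using dg by (simp add: pderiv_eq_0_iff)
    ultimately have "degree g \<le> degree (pderiv g)" by (rule dvd_imp_degree_le)
    then show False using dg by (simp add: degree_pderiv)
  qed
  then obtain a b where "a * pderiv g + b * g = 1"
    using irreducible_dvd_or_bezout[OF assms polys_over_pderiv[OF gH]] by (metis dvd_triv_left)
  then show ?thesis
    by (intro coprimeI) (metis dvd_add dvd_mult)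
qed

lemma adjoin_mem:
  shows "z \<in> adjoin H z" "c \<in> H \<Longrightarrow> c \<in> adjoin H z"
    "x \<in> adjoin H z \<Longrightarrow> y \<in> adjoin H z \<Longrightarrow> x + y \<in> adjoin H z"
    "x \<in> adjoin H z \<Longrightarrow> y \<in> adjoin H z \<Longrightarrow> x * y \<in> adjoin H z"
  unfolding adjoin_def
  using generate_field.eng_add[of x class_ring "insert z H" y]
    generate_field.eng_mult[of x class_ring "insert z H" y]
  by (auto intro: generate_field.incl simp: class_ring_simps)

lemma poly_mem_adjoin:
  assumes "q \<in> polys_over H"
  shows "poly q z \<in> adjoin H z"
  using assms
  by (induction q) (simp_all add: polys_over_pCons adjoin_mem(1,2) adjoin_mem(3)[OF adjoin_mem(2) adjoin_mem(4)[OF adjoin_mem(1)]])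

text \<open>
  Adjoining a root of an irreducible polynomial by ring operations alone already gives a field:
  an inverse comes from the Bezout identity.  Division with remainder bounds the degree.
\<close>

lemma adjoin_root:
  assumes g: "irreducible_over H g" and z: "poly g z = 0"
  shows "adjoin H z = (\<lambda>q. poly q z) ` {q \<in> polys_over H. degree q < degree g}"
proof -
  have gH: "g \<in> polys_over H" and dg: "degree g > 0" using g by (auto simp: irreducible_over_def)
  have 1: "\<exists>q\<in>polys_over H. x = poly q z" if "x \<in> generate_field class_ring (insert z H)" for x
    using that
  proof (induction rule: generate_field.induct)
    case one
    then show ?case by (intro bexI[of _ 1]) (auto simp: class_ring_simps)
  next
    case (incl h)
    have "z = poly [:0, 1:] z" "h = poly [:h:] z" by simp_all
    with incl show ?case by (metis insertE polys_over_0 polys_over_pCons zero_mem one_mem)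
  next
    case (a_inv h)
    then obtain q where "q \<in> polys_over H" "h = poly q z" by blast
    then show ?case using polys_over_diff[OF polys_over_0, of q]
      by (intro bexI[of _ "- q"]) (auto simp: class_ring_simps)
  next
    case (m_inv h)
    then obtain q where q: "q \<in> polys_over H" "h = poly q z" by blast
    have h0: "h \<noteq> 0" using m_inv by (simp add: class_ring_simps)
    have "\<not> g dvd q" using q h0 z by (auto simp: dvd_def)
    then obtain a b where ab: "a \<in> polys_over H" "a * q + b * g = 1"
      using irreducible_dvd_or_bezout[OF g q(1)] by auto
    have "poly (a * q + b * g) z = poly a z * h" using z q by simp
    then have "poly a z = inverse h" using ab h0 by (simp add: field_simps)
    then have "inv\<^bsub>class_ring\<^esub> h = poly a z" using h0 by (simp add: class_ring_simps)
    then show ?case using ab(1) by blast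
  next
    case (eng_add h1 h2)
    then show ?case using polys_over_add by (force simp: class_ring_simps simp flip: poly_add)
  next
    case (eng_mult h1 h2)
    then show ?case using polys_over_mult by (force simp: class_ring_simps simp flip: poly_mult)
  qed
  have 2: "\<exists>r\<in>polys_over H. degree r < degree g \<and> poly q z = poly r z" if q: "q \<in> polys_over H" for q
  proof -
    obtain u r where "r \<in> polys_over H" "q = g * u + r" "r = 0 \<or> degree r < degree g"
      using polys_over_division[OF gH _ q] dg by fastforce
    then show ?thesis using z dg by (intro bexI[of _ r]) auto
  qed
  show ?thesis
    using 1 2 poly_mem_adjoin unfolding adjoin_def by (fastforce simp: image_iff)
qed

end

section \<open>Sums and polynomials of matrices\<close>

lemma mult_index:
  assumes "A \<in> carrier_mat a b" "B \<in> carrier_mat b c" "i < a" "j < c"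
  shows "(A * B) $$ (i, j) = (\<Sum>l<b. A $$ (i, l) * B $$ (l, j))"
  using assms by (auto simp: scalar_prod_def atLeast0LessThan)
lemma square_mult_carrier [simp]:
  "A \<in> carrier_mat k k \<Longrightarrow> B \<in> carrier_mat k k \<Longrightarrow> A * B \<in> carrier_mat k k"
  by simp

lemma square_mult_assoc:
  fixes A :: "complex mat"
  shows "A \<in> carrier_mat k k \<Longrightarrow> B \<in> carrier_mat k k \<Longrightarrow> C \<in> carrier_mat k k \<Longrightarrow>
    A * B * C = A * (B * C)"
  by (rule assoc_mult_mat)

lemma mat_sum_carrier [simp]: "mat_sum a b f S \<in> carrier_mat a b"
  and dim_mat_sum [simp]: "dim_row (mat_sum a b f S) = a" "dim_col (mat_sum a b f S) = b"
  and mat_sum_index [simp]: "i < a \<Longrightarrow> j < b \<Longrightarrow> mat_sum a b f S $$ (i, j) = (\<Sum>x\<in>S. f x $$ (i, j))"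
  by (simp_all add: mat_sum_def)
lemma mat_sum_cong:
  assumes "\<And>x. x \<in> S \<Longrightarrow> f x = g x"
  shows "mat_sum a b f S = mat_sum a b g S"
  using assms by (intro eq_matI) (auto intro: sum.cong)

lemma mult_mat_sum:
  assumes "A \<in> carrier_mat a b" "\<And>x. x \<in> S \<Longrightarrow> f x \<in> carrier_mat b c"
  shows "A * mat_sum b c f S = mat_sum a c (\<lambda>x. A * f x) S"
proof (rule eq_matI)
  fix i j assume "i < dim_row (mat_sum a c (\<lambda>x. A * f x) S)" "j < dim_col (mat_sum a c (\<lambda>x. A * f x) S)"
  then have ij: "i < a" "j < c" by auto
  have "(A * mat_sum b c f S) $$ (i, j) = (\<Sum>l<b. A $$ (i, l) * (\<Sum>x\<in>S. f x $$ (l, j)))"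
    using ij assms by (subst mult_index[where a=a and b=b and c=c]) auto
  also have "\<dots> = (\<Sum>x\<in>S. \<Sum>l<b. A $$ (i, l) * f x $$ (l, j))"
    by (subst sum.swap) (simp add: sum_distrib_left)
  also have "\<dots> = (\<Sum>x\<in>S. (A * f x) $$ (i, j))"
    using ij assms by (intro sum.cong refl mult_index[symmetric]) auto
  finally show "(A * mat_sum b c f S) $$ (i, j) = mat_sum a c (\<lambda>x. A * f x) S $$ (i, j)"
    using ij by simp
qed (use assms in auto)

lemma mat_sum_mult:
  assumes "A \<in> carrier_mat b c" "\<And>x. x \<in> S \<Longrightarrow> f x \<in> carrier_mat a b"
  shows "mat_sum a b f S * A = mat_sum a c (\<lambda>x. f x * A) S"
proof (rule eq_matI)
  fix i j assume "i < dim_row (mat_sum a c (\<lambda>x. f x * A) S)" "j < dim_col (mat_sum a c (\<lambda>x. f x * A) S)"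
  then have ij: "i < a" "j < c" by auto
  have "(mat_sum a b f S * A) $$ (i, j) = (\<Sum>l<b. (\<Sum>x\<in>S. f x $$ (i, l)) * A $$ (l, j))"
    using ij assms by (subst mult_index[where a=a and b=b and c=c]) auto
  also have "\<dots> = (\<Sum>x\<in>S. \<Sum>l<b. f x $$ (i, l) * A $$ (l, j))"
    by (subst sum.swap) (simp add: sum_distrib_right)
  also have "\<dots> = (\<Sum>x\<in>S. (f x * A) $$ (i, j))"
    using ij assms by (intro sum.cong refl mult_index[symmetric]) auto
  finally show "(mat_sum a b f S * A) $$ (i, j) = mat_sum a c (\<lambda>x. f x * A) S $$ (i, j)"
    using ij by simp
qed (use assms in auto)

lemma pow_mat_commute_gen:
  fixes X Y :: "complex mat"
  assumes "X \<in> carrier_mat k k" "Y \<in> carrier_mat k k" "X * Y = Y * X"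
  shows "X ^\<^sub>m m * Y = Y * X ^\<^sub>m m"
proof (induction m)
  case (Suc m)
  have "X ^\<^sub>m Suc m * Y = X ^\<^sub>m m * (X * Y)"
    using assms(1,2) by (simp add: square_mult_assoc[of _ k])
  also have "\<dots> = (X ^\<^sub>m m * Y) * X" unfolding assms(3)
    using assms(1,2) by (simp add: square_mult_assoc[of _ k])
  also have "\<dots> = Y * X ^\<^sub>m Suc m" unfolding Suc
    using assms by (simp add: square_mult_assoc[of _ k])
  finally show ?case .
qed (use assms in auto)

lemma pow_mat_Suc_left:
  fixes X :: "complex mat"
  assumes "X \<in> carrier_mat k k"
  shows "X ^\<^sub>m Suc m = X * X ^\<^sub>m m"
  using pow_mat_commute_gen[OF assms assms refl, of m] by simp

lemma poly_mat_carrier [simp]: "X \<in> carrier_mat k k \<Longrightarrow> poly_mat q X \<in> carrier_mat k k"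
  and dim_poly_mat [simp]: "dim_row (poly_mat q X) = dim_row X" "dim_col (poly_mat q X) = dim_row X"
  by (auto simp: poly_mat_def)
lemma poly_mat_index:
  assumes X: "X \<in> carrier_mat k k" and ij: "i < k" "j < k" and N: "degree q \<le> N"
  shows "poly_mat q X $$ (i, j) = (\<Sum>m\<le>N. coeff q m * (X ^\<^sub>m m) $$ (i, j))"
proof -
  have "poly_mat q X $$ (i, j) = (\<Sum>m\<in>{0..degree q}. coeff q m * (X ^\<^sub>m m) $$ (i, j))"
    using X ij unfolding poly_mat_def by (auto intro!: sum.cong)
  also have "\<dots> = (\<Sum>m\<le>N. coeff q m * (X ^\<^sub>m m) $$ (i, j))"
    using N by (intro sum.mono_neutral_left) (auto simp: not_le coeff_eq_0)
  finally show ?thesis .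
qed

lemma poly_mat_0 [simp]: "X \<in> carrier_mat k k \<Longrightarrow> poly_mat 0 X = 0\<^sub>m k k"
  by (intro eq_matI) (auto simp: poly_mat_index[of X k _ _ 0 0])

lemma poly_mat_pCons:
  assumes X: "X \<in> carrier_mat k k"
  shows "poly_mat (pCons a q) X = a \<cdot>\<^sub>m 1\<^sub>m k + X * poly_mat q X"
proof (rule eq_matI)
  fix i j assume "i < dim_row (a \<cdot>\<^sub>m 1\<^sub>m k + X * poly_mat q X)" "j < dim_col (a \<cdot>\<^sub>m 1\<^sub>m k + X * poly_mat q X)"
  then have ij: "i < k" "j < k" using X by auto
  have "poly_mat (pCons a q) X $$ (i, j) =
      (\<Sum>m\<le>Suc (degree q). coeff (pCons a q) m * (X ^\<^sub>m m) $$ (i, j))"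
    using ij X by (intro poly_mat_index) (auto simp: degree_pCons_le)
  also have "\<dots> = a * (1\<^sub>m k) $$ (i, j) + (\<Sum>m\<le>degree q. coeff q m * (X ^\<^sub>m Suc m) $$ (i, j))"
    using X by (subst sum.atMost_Suc_shift) (simp del: sum.atMost_Suc)
  also have "(\<Sum>m\<le>degree q. coeff q m * (X ^\<^sub>m Suc m) $$ (i, j)) =
      (\<Sum>m\<le>degree q. \<Sum>l<k. X $$ (i, l) * (coeff q m * (X ^\<^sub>m m) $$ (l, j)))"
    unfolding pow_mat_Suc_left[OF X] using X ij
    by (subst mult_index[OF X pow_carrier_mat[OF X]]) (auto simp: sum_distrib_left mult_ac)
  also have "\<dots> = (\<Sum>l<k. X $$ (i, l) * poly_mat q X $$ (l, j))"
    using X ij by (subst sum.swap) (auto intro!: sum.cong simp: sum_distrib_left poly_mat_index[OF X _ _ order.refl])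
  also have "\<dots> = (X * poly_mat q X) $$ (i, j)"
    using X ij by (intro mult_index[symmetric]) auto
  finally show "poly_mat (pCons a q) X $$ (i, j) = (a \<cdot>\<^sub>m 1\<^sub>m k + X * poly_mat q X) $$ (i, j)"
    using ij X by simp
qed (use X in auto)

lemma poly_mat_const:
  assumes "X \<in> carrier_mat k k" shows "poly_mat [:c:] X = c \<cdot>\<^sub>m 1\<^sub>m k"
  using poly_mat_pCons[OF assms, of c 0] assms by (simp add: right_mult_zero_mat)
lemma poly_mat_X:
  assumes "X \<in> carrier_mat k k" shows "poly_mat [:0, 1:] X = X"
proof -
  have "poly_mat [:0, 1:] X = 0 \<cdot>\<^sub>m 1\<^sub>m k + X * (1 \<cdot>\<^sub>m 1\<^sub>m k)"
    using poly_mat_pCons[OF assms, of 0 "[:1:]"] poly_mat_const[OF assms, of 1] by simp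
  also have "1 \<cdot>\<^sub>m 1\<^sub>m k = (1\<^sub>m k :: complex mat)" by auto
  also have "0 \<cdot>\<^sub>m 1\<^sub>m k = (0\<^sub>m k k :: complex mat)" by auto
  finally show ?thesis using assms by simp
qed

lemma poly_mat_add:
  assumes X: "X \<in> carrier_mat k k"
  shows "poly_mat (q + u) X = poly_mat q X + poly_mat u X"
proof (rule eq_matI)
  fix i j assume "i < dim_row (poly_mat q X + poly_mat u X)" "j < dim_col (poly_mat q X + poly_mat u X)"
  then have ij: "i < k" "j < k" using X by auto
  let ?N = "max (degree q) (degree u)"
  show "poly_mat (q + u) X $$ (i, j) = (poly_mat q X + poly_mat u X) $$ (i, j)"
    using X ij degree_add_le_max[of q u]
    by (simp add: poly_mat_index[OF X, of _ _ _ ?N] sum.distrib distrib_right)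
qed (use X in auto)

lemma poly_mat_smult:
  assumes X: "X \<in> carrier_mat k k"
  shows "poly_mat (Polynomial.smult c q) X = c \<cdot>\<^sub>m poly_mat q X"
proof (rule eq_matI)
  fix i j assume "i < dim_row (c \<cdot>\<^sub>m poly_mat q X)" "j < dim_col (c \<cdot>\<^sub>m poly_mat q X)"
  then have ij: "i < k" "j < k" using X by auto
  then show "poly_mat (Polynomial.smult c q) X $$ (i, j) = (c \<cdot>\<^sub>m poly_mat q X) $$ (i, j)"
    using X degree_smult_le[of c q]
    by (simp add: poly_mat_index[OF X, of _ _ _ "degree q"] sum_distrib_left mult_ac)
qed (use X in auto)

lemma poly_mat_diff:
  assumes X: "X \<in> carrier_mat k k"
  shows "poly_mat (q - u) X = poly_mat q X - poly_mat u X"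
proof -
  have "q - u = q + Polynomial.smult (-1) u" by simp
  then have "poly_mat (q - u) X = poly_mat q X + (-1) \<cdot>\<^sub>m poly_mat u X"
    by (simp only: poly_mat_add[OF X] poly_mat_smult[OF X])
  then show ?thesis using X by (intro eq_matI) auto
qed

lemma poly_mat_mult:
  assumes X: "X \<in> carrier_mat k k"
  shows "poly_mat (q * u) X = poly_mat q X * poly_mat u X"
proof (induction q)
  case 0
  then show ?case using X by (simp add: left_mult_zero_mat[of _ k k])
next
  case (pCons a q)
  let ?q = "poly_mat q X" and ?u = "poly_mat u X"
  have c: "?q \<in> carrier_mat k k" "?u \<in> carrier_mat k k" using X by auto
  have "poly_mat (pCons a q * u) X = a \<cdot>\<^sub>m ?u + (0 \<cdot>\<^sub>m 1\<^sub>m k + X * (?q * ?u))"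
    unfolding mult_pCons_left poly_mat_add[OF X] poly_mat_smult[OF X] poly_mat_pCons[OF X] pCons(2) ..
  also have "0 \<cdot>\<^sub>m 1\<^sub>m k = (0\<^sub>m k k :: complex mat)" by auto
  also have "0\<^sub>m k k + X * (?q * ?u) = X * ?q * ?u" using X c by (simp add: square_mult_assoc[of _ k])
  also have "a \<cdot>\<^sub>m ?u = a \<cdot>\<^sub>m 1\<^sub>m k * ?u"
    using c X by (simp add: mult_smult_assoc_mat[of _ k k _ k])
  also have "a \<cdot>\<^sub>m 1\<^sub>m k * ?u + X * ?q * ?u = poly_mat (pCons a q) X * ?u"
    unfolding poly_mat_pCons[OF X]
    by (rule add_mult_distrib_mat[symmetric]) (use X c in auto)
  finally show ?case .
qed

lemma poly_mat_commute:
  assumes X: "X \<in> carrier_mat k k" and Y: "Y \<in> carrier_mat k k" and XY: "X * Y = Y * X"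
  shows "poly_mat q X * Y = Y * poly_mat q X"
proof (induction q)
  case 0
  then show ?case using X Y by simp
next
  case (pCons a q)
  let ?q = "poly_mat q X"
  have c: "?q \<in> carrier_mat k k" using X by auto
  have "X * ?q * Y = X * (Y * ?q)" using X Y c pCons(2) by (simp add: square_mult_assoc[of _ k])
  also have "\<dots> = X * Y * ?q" using X Y c by (simp add: square_mult_assoc[of _ k])
  also have "\<dots> = Y * (X * ?q)" unfolding XY using X Y c by (simp add: square_mult_assoc[of _ k])
  finally have 1: "X * ?q * Y = Y * (X * ?q)" .
  have 2: "a \<cdot>\<^sub>m 1\<^sub>m k * Y = Y * (a \<cdot>\<^sub>m 1\<^sub>m k)"
    using Y by (simp add: mult_smult_assoc_mat[of _ k k _ k] mult_smult_distrib[of _ k k _ k])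
  show ?case unfolding poly_mat_pCons[OF X]
    using 1 2 X Y c
    by (simp add: add_mult_distrib_mat[of _ k k _ _ k] mult_add_distrib_mat[of _ k k _ k] square_mult_assoc[of _ k])
qed

lemma poly_mat_pcompose:
  assumes X: "X \<in> carrier_mat k k"
  shows "poly_mat (pcompose q u) X = poly_mat q (poly_mat u X)"
proof (induction q)
  case 0
  show ?case unfolding pcompose_0 poly_mat_0[OF X] poly_mat_0[OF poly_mat_carrier[OF X]] ..
next
  case (pCons a q)
  have "poly_mat u X \<in> carrier_mat k k" using X by auto
  then show ?case
    unfolding pcompose_pCons poly_mat_add[OF X] poly_mat_mult[OF X] poly_mat_const[OF X] pCons(2)
    by (simp add: poly_mat_pCons)
qed

lemma poly_mat_similar:
  assumes X: "X \<in> carrier_mat n n" and P: "P \<in> carrier_mat n n" and Q: "Q \<in> carrier_mat n n"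
    and PQ: "P * Q = 1\<^sub>m n" "Q * P = 1\<^sub>m n"
  shows "poly_mat q (P * X * Q) = P * poly_mat q X * Q"
proof (induction q)
  case 0
  then show ?case using X P Q by simp
next
  case (pCons a q)
  let ?q = "poly_mat q X"
  have c: "?q \<in> carrier_mat n n" and c': "P * X * Q \<in> carrier_mat n n" using X P Q by auto
  have "P * X * Q * (P * ?q * Q) = P * X * (Q * P) * (?q * Q)"
    using X P Q c by (simp add: square_mult_assoc[of _ n])
  also have "\<dots> = P * (X * ?q) * Q"
    unfolding PQ using X P Q c by (simp add: square_mult_assoc[of _ n])
  finally have 1: "P * X * Q * (P * ?q * Q) = P * (X * ?q) * Q" .
  have 2: "P * (a \<cdot>\<^sub>m 1\<^sub>m n) * Q = a \<cdot>\<^sub>m 1\<^sub>m n"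
    using P Q PQ by (simp add: mult_smult_assoc_mat[of _ n n _ n] mult_smult_distrib[of _ n n _ n])
  have "P * (a \<cdot>\<^sub>m 1\<^sub>m n + X * ?q) * Q = P * (a \<cdot>\<^sub>m 1\<^sub>m n) * Q + P * (X * ?q) * Q"
    using X P Q c by (simp add: add_mult_distrib_mat[of _ n n _ _ n] mult_add_distrib_mat[of _ n n _ n])
  then show ?case
    unfolding poly_mat_pCons[OF X] poly_mat_pCons[OF c'] pCons(2) 1 2 by simp
qed

text \<open>The powers \<open>1, X, X\<^sup>2, \<dots>\<close> cannot all be independent in a space of dimension \<open>k\<^sup>2\<close>.\<close>

lemma ex_annihilating_poly:
  assumes X: "X \<in> carrier_mat k k"
  shows "\<exists>q. q \<noteq> 0 \<and> poly_mat q X = 0\<^sub>m k k"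
proof -
  define N where "N = k * k"
  \<comment> \<open>the columns are the stacked powers, completed to a square matrix by a zero row\<close>
  define M where "M = mat (Suc N) (Suc N) (\<lambda>(t, m). if t = N then 0 else (X ^\<^sub>m m) $$ (t mod k, t div k))"
  have M: "M \<in> carrier_mat (Suc N) (Suc N)" by (simp add: M_def)
  have "M = mat\<^sub>r (Suc N) (Suc N) (\<lambda>i. if i = N then 0\<^sub>v (Suc N) else row M i)"
    by (rule eq_rowI) (auto simp: M_def)
  also have "det \<dots> = 0" using M by (intro det_row_0) auto
  finally have "det M = 0" .
  then obtain v where v: "v \<in> carrier_vec (Suc N)" "v \<noteq> 0\<^sub>v (Suc N)" "M *\<^sub>v v = 0\<^sub>v (Suc N)"
    using det_0_iff_vec_prod_zero[OF M] by blast
  define q where "q = (\<Sum>m\<le>N. monom (v $ m) m)"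
  have coeff_q: "coeff q m = (if m \<le> N then v $ m else 0)" for m
    unfolding q_def coeff_sum by (simp add: coeff_monom)
  have "degree q \<le> N" by (rule degree_le) (simp add: coeff_q)
  have "q \<noteq> 0"
  proof
    assume "q = 0"
    then have "v $ m = 0" if "m \<le> N" for m using coeff_q[of m] that by simp
    then have "v = 0\<^sub>v (Suc N)" using v(1) by (intro eq_vecI) auto
    then show False using v by simp
  qed
  moreover have "poly_mat q X $$ (i, j) = 0" if ij: "i < k" "j < k" for i j
  proof -
    have "j * k + i < Suc j * k" using ij by simp
    also have "\<dots> \<le> k * k" using ij by (intro mult_right_mono) auto
    finally have t: "j * k + i < N" unfolding N_def .
    have "0 = (M *\<^sub>v v) $ (j * k + i)" using t v by simp
    also have "\<dots> = (\<Sum>m\<le>N. (X ^\<^sub>m m) $$ (i, j) * v $ m)"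
      using t ij v(1) by (auto simp: M_def scalar_prod_def lessThan_Suc_atMost atLeast0LessThan intro!: sum.cong)
    also have "\<dots> = poly_mat q X $$ (i, j)"
      using poly_mat_index[OF X ij \<open>degree q \<le> N\<close>] by (auto simp: coeff_q mult_ac intro!: sum.cong)
    finally show ?thesis by simp
  qed
  ultimately show ?thesis using X by (intro exI[of _ q] conjI eq_matI) auto
qed

section \<open>Matrices over a subfield\<close>

lemma elements_mat_subset_iff:
  "elements_mat M \<subseteq> S \<longleftrightarrow> (\<forall>i<dim_row M. \<forall>j<dim_col M. M $$ (i, j) \<in> S)"
  unfolding elements_mat_def by fastforce

lemma mats_over_iff:
  "M \<in> mats_over H n \<longleftrightarrow> M \<in> carrier_mat n n \<and> (\<forall>i<n. \<forall>j<n. M $$ (i, j) \<in> H)"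
  unfolding mats_over_def elements_mat_subset_iff by auto

lemma mats_over_carrier: "M \<in> mats_over H n \<Longrightarrow> M \<in> carrier_mat n n"
  by (simp add: mats_over_def)
context number_field
begin

lemma elements_mult:
  assumes "A \<in> carrier_mat a b" "B \<in> carrier_mat b c" "elements_mat A \<subseteq> H" "elements_mat B \<subseteq> H"
  shows "elements_mat (A * B) \<subseteq> H"
  unfolding elements_mat_subset_iff
proof (intro allI impI)
  fix i j assume "i < dim_row (A * B)" "j < dim_col (A * B)"
  then have ij: "i < a" "j < c" using assms by auto
  show "(A * B) $$ (i, j) \<in> H"
    unfolding mult_index[OF assms(1,2) ij]
    using assms ij by (intro sum_mem mult_mem) (auto simp: elements_mat_subset_iff)
qed

lemma elements_smult: "c \<in> H \<Longrightarrow> elements_mat A \<subseteq> H \<Longrightarrow> elements_mat (c \<cdot>\<^sub>m A) \<subseteq> H"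
  by (auto simp: elements_mat_subset_iff intro!: mult_mem)
lemma elements_mat_sum:
  assumes "\<And>x. x \<in> S \<Longrightarrow> f x \<in> carrier_mat a b" "\<And>x. x \<in> S \<Longrightarrow> elements_mat (f x) \<subseteq> H"
  shows "elements_mat (mat_sum a b f S) \<subseteq> H"
  using assms by (fastforce simp: elements_mat_subset_iff intro!: sum_mem)
lemma mats_over_one: "1\<^sub>m n \<in> mats_over H n"
  by (auto simp: mats_over_iff)
lemma mats_over_mult: "A \<in> mats_over H n \<Longrightarrow> B \<in> mats_over H n \<Longrightarrow> A * B \<in> mats_over H n"
  unfolding mats_over_def using elements_mult[of A n n B n] by simp

lemma mats_over_pow: "A \<in> mats_over H n \<Longrightarrow> A ^\<^sub>m m \<in> mats_over H n"
  by (induction m) (auto simp: mats_over_mult mats_over_one dest: mats_over_carrier)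

lemma mats_over_smult: "c \<in> H \<Longrightarrow> A \<in> mats_over H n \<Longrightarrow> c \<cdot>\<^sub>m A \<in> mats_over H n"
  using elements_smult by (auto simp: mats_over_def)
lemma mats_over_mat_sum:
  "(\<And>x. x \<in> S \<Longrightarrow> f x \<in> mats_over H n) \<Longrightarrow> mat_sum n n f S \<in> mats_over H n"
  using elements_mat_sum[of S f n n] by (auto simp: mats_over_def)
lemma mats_over_poly_mat:
  assumes "q \<in> polys_over H" "X \<in> mats_over H n"
  shows "poly_mat q X \<in> mats_over H n"
  using assms mats_over_carrier[OF assms(2)] unfolding poly_mat_def
  by (auto intro!: mats_over_mat_sum mats_over_smult mats_over_pow simp: polys_over_def)
lemma det_mem:
  assumes A: "A \<in> mats_over H n"
  shows "det A \<in> H"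
proof -
  have "signof \<pi> \<in> H" for \<pi> :: "nat \<Rightarrow> nat"
    by (simp add: sign_def uminus_mem)
  then show ?thesis
    unfolding det_def'[OF mats_over_carrier[OF A]]
    using A by (intro sum_mem mult_mem prod_mem) (auto simp: mats_over_iff permutes_in_image)
qed

lemma adj_mat_over:
  assumes A: "A \<in> mats_over H n"
  shows "adj_mat A \<in> mats_over H n"
proof -
  have "cofactor A j i \<in> H" if "i < n" "j < n" for i j
  proof -
    have "mat_delete A j i \<in> mats_over H (n - 1)"
      using A that by (auto simp: mats_over_iff mat_delete_def)
    then show ?thesis unfolding cofactor_def
      by (intro mult_mem det_mem power_mem uminus_mem) auto
  qed
  then show ?thesis using A by (auto simp: mats_over_iff adj_mat_def)
qed

text \<open>Cramer's rule keeps the solution of a regular linear system in the coefficient field.\<close>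

lemma linear_system_over:
  assumes A: "A \<in> mats_over H n" and d: "det A \<noteq> 0"
    and b: "b \<in> carrier_vec n" "\<And>i. i < n \<Longrightarrow> b $ i \<in> H"
  shows "\<exists>x\<in>carrier_vec n. (\<forall>i<n. x $ i \<in> H) \<and> A *\<^sub>v x = b \<and>
    (\<forall>y\<in>carrier_vec n. A *\<^sub>v y = b \<longrightarrow> y = x)"
proof -
  define B where "B = inverse (det A) \<cdot>\<^sub>m adj_mat A"
  note Ac = mats_over_carrier[OF A]
  have B: "B \<in> mats_over H n"
    unfolding B_def using A by (intro mats_over_smult adj_mat_over inverse_mem det_mem)
  note Bc = mats_over_carrier[OF B]
  have AB: "A * B = 1\<^sub>m n" "B * A = 1\<^sub>m n"
    unfolding B_def using adj_mat[OF Ac] Ac d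
    by (auto simp: mult_smult_distrib[of _ n n _ n] mult_smult_assoc_mat[of _ n n _ n])
  define x where "x = B *\<^sub>v b"
  have x: "x \<in> carrier_vec n" unfolding x_def using Bc b by auto
  have "x $ i \<in> H" if "i < n" for i
    unfolding x_def using that B Bc b
    by (auto simp: scalar_prod_def mats_over_iff intro!: sum_mem mult_mem)
  moreover have "A *\<^sub>v x = b"
    unfolding x_def using Ac Bc b AB by (simp flip: assoc_mult_mat_vec)
  moreover have "y = x" if y: "y \<in> carrier_vec n" "A *\<^sub>v y = b" for y
  proof -
    have "y = B * A *\<^sub>v y" using AB y by simp
    also have "\<dots> = x" unfolding x_def using assoc_mult_mat_vec[OF Bc Ac y(1)] y(2) by simp
    finally show ?thesis .
  qed
  ultimately show ?thesis using x by blast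
qed

lemma inverse_over:
  assumes A: "A \<in> mats_over H n" and B: "B \<in> carrier_mat n n" and AB: "A * B = 1\<^sub>m n"
  shows "B \<in> mats_over H n"
proof -
  note Ac = mats_over_carrier[OF A]
  have "det A * det B = 1" using det_mult[OF Ac B] AB by simp
  then have d: "det A \<noteq> 0" by auto
  have "det A \<cdot>\<^sub>m B = adj_mat A * A * B"
    using adj_mat[OF Ac] B by (simp add: mult_smult_assoc_mat[of _ n n _ n])
  also have "\<dots> = adj_mat A" using adj_mat(1)[OF Ac] Ac B AB by simp
  finally have "det A \<cdot>\<^sub>m B = adj_mat A" .
  then have "inverse (det A) \<cdot>\<^sub>m (det A \<cdot>\<^sub>m B) \<in> mats_over H n"
    using A by (auto intro!: mats_over_smult adj_mat_over inverse_mem det_mem)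
  moreover have "inverse (det A) \<cdot>\<^sub>m (det A \<cdot>\<^sub>m B) = B" using d by (intro eq_matI) auto
  ultimately show ?thesis by simp
qed

end

section \<open>Matrices commuting with a companion matrix\<close>

lemma companion_carrier [simp]: "companion g \<in> carrier_mat (degree g) (degree g)"
  and dim_companion [simp]: "dim_row (companion g) = degree g" "dim_col (companion g) = degree g"
  by (simp_all add: companion_def)

lemma companion_mult_row:
  assumes M: "M \<in> carrier_mat (degree g) (degree g)" and i: "Suc i < degree g" and j: "j < degree g"
  shows "(companion g * M) $$ (i, j) = M $$ (Suc i, j)"
proof -
  have "(companion g * M) $$ (i, j) = (\<Sum>l<degree g. companion g $$ (i, l) * M $$ (l, j))"
    using i j by (intro mult_index[OF companion_carrier M]) auto
  also have "\<dots> = (\<Sum>l<degree g. (if l = Suc i then M $$ (l, j) else 0))"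
    using i by (intro sum.cong) (auto simp: companion_def)
  finally have "(companion g * M) $$ (i, j) = (\<Sum>l<degree g. (if l = Suc i then M $$ (l, j) else 0))" .
  then show ?thesis using i by simp
qed

text \<open>
  Multiplication by the companion matrix shifts rows upwards, so a matrix that commutes with it
  is determined by its first row.
\<close>

lemma companion_commute_eqI:
  assumes M: "M \<in> carrier_mat (degree g) (degree g)" "M * companion g = companion g * M"
    and N: "N \<in> carrier_mat (degree g) (degree g)" "N * companion g = companion g * N"
    and row0: "\<And>j. j < degree g \<Longrightarrow> M $$ (0, j) = N $$ (0, j)"
  shows "M = N"
proof -
  have "\<forall>j<degree g. M $$ (i, j) = N $$ (i, j)" if "i < degree g" for i
    using that
  proof (induction i)
    case (Suc i)
    show ?case
    proof (intro allI impI)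
      fix j assume j: "j < degree g"
      have "M $$ (Suc i, j) = (M * companion g) $$ (i, j)"
        using companion_mult_row[OF M(1) Suc.prems j] M(2) by simp
      also have "\<dots> = (N * companion g) $$ (i, j)"
        using Suc j by (simp add: mult_index[OF M(1) companion_carrier] mult_index[OF N(1) companion_carrier])
      also have "\<dots> = N $$ (Suc i, j)"
        using companion_mult_row[OF N(1) Suc.prems j] N(2) by simp
      finally show "M $$ (Suc i, j) = N $$ (Suc i, j)" .
    qed
  qed (use row0 in auto)
  then show ?thesis using M N by (intro eq_matI) auto
qed

lemma companion_pow_row0:
  assumes "m < degree g" "j < degree g"
  shows "(companion g ^\<^sub>m m) $$ (0, j) = (if j = m then 1 else 0)"
  using assms
proof (induction m arbitrary: j)
  case (Suc m)
  have "(companion g ^\<^sub>m Suc m) $$ (0, j) =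
      (\<Sum>l<degree g. (companion g ^\<^sub>m m) $$ (0, l) * companion g $$ (l, j))"
    unfolding pow_mat.simps using Suc.prems
    by (intro mult_index[OF pow_carrier_mat]) auto
  also have "\<dots> = (\<Sum>l<degree g. if l = m then companion g $$ (l, j) else 0)"
    using Suc by (intro sum.cong) auto
  also have "\<dots> = companion g $$ (m, j)" using Suc.prems by simp
  also have "\<dots> = (if j = Suc m then 1 else 0)" using Suc.prems by (auto simp: companion_def)
  finally show ?case .
qed (use companion_carrier[of g] in \<open>auto simp del: companion_carrier\<close>)

lemma poly_mat_companion_row0:
  assumes "degree q < degree g" "j < degree g"
  shows "poly_mat q (companion g) $$ (0, j) = coeff q j"
proof -
  have "poly_mat q (companion g) $$ (0, j) =
      (\<Sum>m\<le>degree g - 1. coeff q m * (companion g ^\<^sub>m m) $$ (0, j))"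
    using assms by (intro poly_mat_index[OF companion_carrier]) auto
  also have "\<dots> = (\<Sum>m\<le>degree g - 1. if m = j then coeff q m else 0)"
    using assms by (intro sum.cong) (auto simp: companion_pow_row0)
  also have "\<dots> = coeff q j" using assms by auto
  finally show ?thesis .
qed

lemma poly_mat_companion_commute:
  "poly_mat q (companion g) * companion g = companion g * poly_mat q (companion g)"
  by (rule poly_mat_commute[OF companion_carrier companion_carrier refl])

lemma poly_mat_companion_self:
  assumes g: "monic g" "degree g > 0"
  shows "poly_mat g (companion g) = 0\<^sub>m (degree g) (degree g)"
proof (rule companion_commute_eqI[of _ g])
  fix j assume j: "j < degree g"
  let ?k = "degree g" and ?C = "companion g"
  have k: "?k = Suc (?k - 1)" using g by simp
  have "(?C ^\<^sub>m ?k) $$ (0, j) = (?C ^\<^sub>m (?k - 1) * ?C) $$ (0, j)"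
    by (subst k) simp
  also have "\<dots> = (\<Sum>l<?k. (?C ^\<^sub>m (?k - 1)) $$ (0, l) * ?C $$ (l, j))"
    using g j by (intro mult_index[OF pow_carrier_mat]) auto
  also have "\<dots> = (\<Sum>l<?k. if l = ?k - 1 then ?C $$ (l, j) else 0)"
    using g by (intro sum.cong) (auto simp: companion_pow_row0)
  also have "\<dots> = - coeff g j" using g j by (auto simp: companion_def)
  finally have last: "(?C ^\<^sub>m ?k) $$ (0, j) = - coeff g j" .
  have "poly_mat g ?C $$ (0, j) = (\<Sum>m\<le>?k. coeff g m * (?C ^\<^sub>m m) $$ (0, j))"
    using g j by (intro poly_mat_index[OF companion_carrier]) auto
  also have "\<dots> = (\<Sum>m<?k. coeff g m * (?C ^\<^sub>m m) $$ (0, j)) + (?C ^\<^sub>m ?k) $$ (0, j)"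
    using g by (simp flip: lessThan_Suc_atMost)
  also have "(\<Sum>m<?k. coeff g m * (?C ^\<^sub>m m) $$ (0, j)) = (\<Sum>m<?k. if m = j then coeff g m else 0)"
    using j by (intro sum.cong) (auto simp: companion_pow_row0)
  also have "\<dots> = coeff g j" using j by simp
  finally show "poly_mat g ?C $$ (0, j) = 0\<^sub>m ?k ?k $$ (0, j)" using last j g by simp
qed (simp_all add: poly_mat_companion_commute left_mult_zero_mat[of _ "degree g"] right_mult_zero_mat[of _ _ "degree g"])

lemma poly_mat_companion_row0_eq_0_imp_dvd:
  assumes g: "monic g" "degree g > 0"
    and row0: "\<And>j. j < degree g \<Longrightarrow> poly_mat q (companion g) $$ (0, j) = 0"
  shows "g dvd q"
proof -
  let ?C = "companion g" and ?r = "q mod g"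
  have g0: "g \<noteq> 0" using g by auto
  have deg: "degree ?r < degree g" using degree_mod_less[OF g0, of q] g by auto
  have "poly_mat q ?C = poly_mat (q div g * g + ?r) ?C" by simp
  also have "\<dots> = poly_mat (q div g) ?C * 0\<^sub>m (degree g) (degree g) + poly_mat ?r ?C"
    by (simp only: poly_mat_add[OF companion_carrier] poly_mat_mult[OF companion_carrier] poly_mat_companion_self[OF g])
  also have "\<dots> = poly_mat ?r ?C"
    using poly_mat_carrier[OF companion_carrier, of _ g] by (simp add: right_mult_zero_mat[of _ "degree g"])
  finally have eq: "poly_mat q ?C = poly_mat ?r ?C" .
  have "coeff ?r j = 0" for j
    using row0[of j] poly_mat_companion_row0[OF deg, of j] eq deg
    by (cases "j < degree g") (auto intro: coeff_eq_0)
  then have "?r = 0" by (intro poly_eqI) simp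
  then show ?thesis by (simp add: dvd_eq_mod_eq_0)
qed

lemma poly_mat_companion_eq_0_iff:
  assumes g: "monic g" "degree g > 0"
  shows "poly_mat q (companion g) = 0\<^sub>m (degree g) (degree g) \<longleftrightarrow> g dvd q"
proof
  assume "g dvd q"
  then obtain u where "q = g * u" by (auto elim: dvdE)
  then show "poly_mat q (companion g) = 0\<^sub>m (degree g) (degree g)"
    using poly_mat_carrier[OF companion_carrier]
    by (simp add: poly_mat_mult[OF companion_carrier] poly_mat_companion_self[OF g] left_mult_zero_mat[of _ "degree g"])
qed (use g in \<open>auto intro!: poly_mat_companion_row0_eq_0_imp_dvd\<close>)

definition row0_poly :: "complex mat \<Rightarrow> complex poly" where
  "row0_poly M = (\<Sum>j<dim_col M. monom (M $$ (0, j)) j)"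

lemma coeff_row0_poly: "coeff (row0_poly M) j = (if j < dim_col M then M $$ (0, j) else 0)"
  unfolding row0_poly_def coeff_sum by simp

lemma degree_row0_poly:
  assumes "dim_col M > 0" shows "degree (row0_poly M) < dim_col M"
proof -
  have "degree (row0_poly M) \<le> dim_col M - 1"
    by (rule degree_le) (auto simp: coeff_row0_poly)
  then show ?thesis using assms by simp
qed

lemma companion_commute_imp_poly:
  assumes M: "M \<in> carrier_mat (degree g) (degree g)" "M * companion g = companion g * M"
  shows "M = poly_mat (row0_poly M) (companion g)"
proof (rule companion_commute_eqI[OF M])
  fix j assume "j < degree g"
  then show "M $$ (0, j) = poly_mat (row0_poly M) (companion g) $$ (0, j)"
    using M degree_row0_poly[of M] by (simp add: poly_mat_companion_row0 coeff_row0_poly)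
qed (simp_all add: poly_mat_companion_commute)

section \<open>Solutions for a single companion block\<close>

lemma ecard_bij_betw:
  assumes "bij_betw f A B" shows "ecard A = ecard B"
  using bij_betw_finite[OF assms] bij_betw_same_card[OF assms] by (simp add: ecard_def)

lemma poly_sol_commute:
  assumes X: "X \<in> carrier_mat n n" and B: "poly_mat p X = B"
  shows "X * B = B * X"
  using poly_mat_commute[OF X X refl, of p] B by simp

context number_field
begin

text \<open>
  Both sides are in bijection with the polynomials \<open>q\<close> over \<open>H\<close> of degree less than \<open>deg g\<close> for
  which \<open>g\<close> divides \<open>p(q(\<lambda>)) - \<lambda>\<close>, by evaluation at the companion matrix and at the root.
\<close>

lemma companion_solutions:
  assumes g: "monic g" "irreducible_over H g" and p: "p \<in> polys_over H" and z: "poly g z = 0"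
  shows "ecard (poly_sols H (degree g) p (companion g)) = ecard {\<mu> \<in> adjoin H z. poly p \<mu> = z}"
    and "poly_sols H (degree g) p (companion g) = {} \<longleftrightarrow> {\<mu> \<in> adjoin H z. poly p \<mu> = z} = {}"
proof -
  have k: "degree g > 0" and gH: "g \<in> polys_over H" using g by (auto simp: irreducible_over_def)
  let ?C = "companion g"
  define Q where "Q = {q \<in> polys_over H. degree q < degree g \<and> poly p (poly q z) = z}"
  have CH: "?C \<in> mats_over H (degree g)"
    using gH by (auto simp: mats_over_iff companion_def polys_over_def intro: uminus_mem)
  have iff: "poly_mat p (poly_mat q ?C) = ?C \<longleftrightarrow> poly p (poly q z) = z" if q: "q \<in> polys_over H" for q
  proof -
    let ?h = "pcompose p q - [:0, 1:]"
    have h: "?h \<in> polys_over H" using p q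
      by (auto intro!: polys_over_diff polys_over_pcompose simp: polys_over_pCons)
    have "poly_mat ?h ?C = poly_mat p (poly_mat q ?C) - ?C"
      by (simp only: poly_mat_diff[OF companion_carrier] poly_mat_pcompose[OF companion_carrier] poly_mat_X[OF companion_carrier])
    then have "poly_mat p (poly_mat q ?C) = ?C \<longleftrightarrow> poly_mat ?h ?C = 0\<^sub>m (degree g) (degree g)"
      by (simp add: mat_eq_iff)
    also have "\<dots> \<longleftrightarrow> g dvd ?h" by (rule poly_mat_companion_eq_0_iff[OF g(1) k])
    also have "\<dots> \<longleftrightarrow> poly ?h z = 0"
      using irreducible_dvd_of_common_root[OF g(2) h z] z by (metis dvd_def mult_eq_0_iff poly_mult)
    finally show ?thesis by (simp add: poly_pcompose)
  qed
  have inj1: "inj_on (\<lambda>q. poly_mat q ?C) Q"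
  proof (rule inj_onI)
    fix q u assume q: "q \<in> Q" and u: "u \<in> Q" and eq: "poly_mat q ?C = poly_mat u ?C"
    show "q = u"
    proof (rule poly_eqI)
      fix j
      show "coeff q j = coeff u j"
        using poly_mat_companion_row0[of q g j] poly_mat_companion_row0[of u g j] eq q u
        by (cases "j < degree g") (auto simp: Q_def coeff_eq_0)
    qed
  qed
  have im1: "(\<lambda>q. poly_mat q ?C) ` Q = poly_sols H (degree g) p ?C"
  proof (intro equalityI subsetI)
    fix X assume "X \<in> (\<lambda>q. poly_mat q ?C) ` Q"
    then show "X \<in> poly_sols H (degree g) p ?C"
      using iff CH by (auto simp: Q_def poly_sols_def intro: mats_over_poly_mat)
  next
    fix X assume X: "X \<in> poly_sols H (degree g) p ?C"
    then have Xc: "X \<in> carrier_mat (degree g) (degree g)" by (auto simp: poly_sols_def mats_over_def)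
    have pX: "poly_mat p X = ?C" using X by (simp add: poly_sols_def)
    have eq: "X = poly_mat (row0_poly X) ?C"
      by (rule companion_commute_imp_poly[OF Xc poly_sol_commute[OF Xc pX]])
    have q: "row0_poly X \<in> polys_over H"
      using X k by (auto simp: polys_over_def coeff_row0_poly poly_sols_def mats_over_iff)
    have "row0_poly X \<in> Q"
      using q iff[OF q] eq pX degree_row0_poly[of X] Xc k by (auto simp: Q_def)
    then show "X \<in> (\<lambda>q. poly_mat q ?C) ` Q" using eq by blast
  qed
  have inj2: "inj_on (\<lambda>q. poly q z) Q"
  proof (rule inj_onI)
    fix q u assume q: "q \<in> Q" and u: "u \<in> Q" and eq: "poly q z = poly u z"
    have "g dvd q - u"
      using q u eq by (intro irreducible_dvd_of_common_root[OF g(2) _ z]) (auto simp: Q_def intro: polys_over_diff)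
    moreover have "degree (q - u) < degree g" using q u by (auto simp: Q_def intro: degree_diff_less)
    ultimately show "q = u" using dvd_imp_degree_le[of g "q - u"] by fastforce
  qed
  have im2: "(\<lambda>q. poly q z) ` Q = {\<mu> \<in> adjoin H z. poly p \<mu> = z}"
    unfolding adjoin_root[OF g(2) z] by (auto simp: Q_def)
  have "ecard Q = ecard (poly_sols H (degree g) p ?C)" "ecard Q = ecard {\<mu> \<in> adjoin H z. poly p \<mu> = z}"
    by (rule ecard_bij_betw, rule bij_betw_imageI[OF inj1 im1], rule ecard_bij_betw, rule bij_betw_imageI[OF inj2 im2])
  then show "ecard (poly_sols H (degree g) p ?C) = ecard {\<mu> \<in> adjoin H z. poly p \<mu> = z}" by simp
  show "poly_sols H (degree g) p ?C = {} \<longleftrightarrow> {\<mu> \<in> adjoin H z. poly p \<mu> = z} = {}"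
    unfolding im1[symmetric] im2[symmetric] by simp
qed

end

section \<open>The derivative of a matrix polynomial and its eigenvalues\<close>

text \<open>
  The derivative of the matrix function \<open>p\<close> at \<open>X\<close> in direction \<open>Z\<close>; \<^const>\<open>diff_matrix\<close> is its matrix
  in vectorized form.
\<close>

definition diff_op :: "complex poly \<Rightarrow> complex mat \<Rightarrow> complex mat \<Rightarrow> complex mat" where
  "diff_op p X Z = (let k = dim_row X in
     mat_sum k k (\<lambda>m. coeff p m \<cdot>\<^sub>m mat_sum k k (\<lambda>i. X ^\<^sub>m (m - 1 - i) * Z * X ^\<^sub>m i) {0..m - 1})
       {1..degree p})"

lemma diff_op_carrier [simp]: "X \<in> carrier_mat k k \<Longrightarrow> diff_op p X Z \<in> carrier_mat k k"
  and dim_diff_op [simp]: "dim_row (diff_op p X Z) = dim_row X" "dim_col (diff_op p X Z) = dim_row X"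
  by (simp_all add: diff_op_def Let_def)

lemma diff_op_index:
  assumes "X \<in> carrier_mat k k" "i < k" "j < k"
  shows "diff_op p X Z $$ (i, j) =
    (\<Sum>m = 1..degree p. coeff p m * (\<Sum>l = 0..m - 1. (X ^\<^sub>m (m - 1 - l) * Z * X ^\<^sub>m l) $$ (i, j)))"
  using assms by (simp add: diff_op_def Let_def)

lemma mult_vec_index:
  assumes "A \<in> carrier_mat a b" "v \<in> carrier_vec b" "i < a"
  shows "(A *\<^sub>v v) $ i = (\<Sum>l<b. A $$ (i, l) * v $ l)"
  using assms by (auto simp: scalar_prod_def atLeast0LessThan)

lemma block_index_less:
  assumes "a < d" "i < k" shows "a * k + i < d * (k::nat)"
proof -
  have "a * k + i < Suc a * k" using assms by simp
  also have "\<dots> \<le> d * k" using assms by (intro mult_right_mono) auto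
  finally show ?thesis .
qed

lemma sum_blocks: "(\<Sum>u<d * k. f u) = (\<Sum>a<d. \<Sum>i<k. f (a * k + i))" for k :: nat
proof -
  have "(\<Sum>u<d * k. f u) = (\<Sum>a<d. sum f {a * k..<a * k + k})"
    by (rule sum.nat_group[symmetric])
  also have "\<dots> = (\<Sum>a<d. \<Sum>i<k. f (a * k + i))"
    by (rule sum.cong[OF refl], subst sum.atLeastLessThan_shift_0) (simp add: atLeast0LessThan comp_def)
  finally show ?thesis .
qed

lemma vectorize_carrier [simp]: "Z \<in> carrier_mat k k \<Longrightarrow> vectorize Z \<in> carrier_vec (k * k)"
  by (simp add: vectorize_def carrier_matD)

lemma vectorize_index:
  "Z \<in> carrier_mat k k \<Longrightarrow> t < k * k \<Longrightarrow> vectorize Z $ t = Z $$ (t mod k, t div k)"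
  by (simp add: vectorize_def carrier_matD)

lemma div_mod_less_square:
  assumes "t < d * (k::nat)" shows "t div k < d" "t mod k < k"
proof -
  have "k > 0" using assms by (cases k) auto
  then show "t mod k < k" "t div k < d" using assms by (auto simp: less_mult_imp_div_less)
qed

lemma vectorize_inject:
  assumes "Y \<in> carrier_mat k k" "Z \<in> carrier_mat k k"
  shows "vectorize Y = vectorize Z \<longleftrightarrow> Y = Z"
proof
  assume eq: "vectorize Y = vectorize Z"
  show "Y = Z"
  proof (rule eq_matI)
    fix i j assume "i < dim_row Z" "j < dim_col Z"
    then have ij: "i < k" "j < k" using assms by auto
    then show "Y $$ (i, j) = Z $$ (i, j)"
      using vectorize_index[OF assms(1) block_index_less[OF ij(2,1)]]
        vectorize_index[OF assms(2) block_index_less[OF ij(2,1)]] eq by simp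
  qed (use assms in auto)
qed auto

definition unvectorize :: "nat \<Rightarrow> complex vec \<Rightarrow> complex mat" where
  "unvectorize k v = mat k k (\<lambda>(i, j). v $ (j * k + i))"

lemma unvectorize_carrier [simp]: "unvectorize k v \<in> carrier_mat k k"
  by (simp add: unvectorize_def)

lemma vectorize_unvectorize:
  assumes "v \<in> carrier_vec (k * k)"
  shows "vectorize (unvectorize k v) = v"
proof (rule eq_vecI)
  fix t assume "t < dim_vec v"
  then have t: "t < k * k" using assms by simp
  then show "vectorize (unvectorize k v) $ t = v $ t"
    using div_mod_less_square[OF t] unfolding vectorize_index[OF unvectorize_carrier t]
    by (simp add: unvectorize_def)
qed (use assms in \<open>simp add: vectorize_def unvectorize_def\<close>)

text \<open>The vectorisation identity \<open>(A\<^sup>T \<otimes> B) vec Z = vec (B Z A)\<close>, entry by entry.\<close>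

lemma kronecker_vectorize:
  assumes A: "A \<in> carrier_mat k k" and B: "B \<in> carrier_mat k k" and Z: "Z \<in> carrier_mat k k"
    and t: "t < k * k"
  shows "(\<Sum>u<k * k. kronecker (transpose_mat A) B $$ (t, u) * vectorize Z $ u) =
    (B * Z * A) $$ (t mod k, t div k)"
proof -
  note tt = div_mod_less_square[OF t]
  have "(\<Sum>u<k * k. kronecker (transpose_mat A) B $$ (t, u) * vectorize Z $ u) =
      (\<Sum>b<k. \<Sum>a<k. kronecker (transpose_mat A) B $$ (t, b * k + a) * vectorize Z $ (b * k + a))"
    by (rule sum_blocks)
  also have "\<dots> = (\<Sum>b<k. \<Sum>a<k. B $$ (t mod k, a) * Z $$ (a, b) * A $$ (b, t div k))"
    using A B Z t tt
    by (intro sum.cong refl)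
      (auto simp: kronecker_def block_mat_def vectorize_index[OF Z] block_index_less mult_ac)
  also have "\<dots> = (\<Sum>b<k. (B * Z) $$ (t mod k, b) * A $$ (b, t div k))"
    using tt by (intro sum.cong refl) (simp add: mult_index[OF B Z] sum_distrib_right)
  also have "\<dots> = (B * Z * A) $$ (t mod k, t div k)"
    using tt B Z A by (intro mult_index[symmetric]) auto
  finally show ?thesis .
qed

lemma transpose_pow:
  fixes A :: "complex mat"
  assumes A: "A \<in> carrier_mat k k"
  shows "transpose_mat A ^\<^sub>m m = transpose_mat (A ^\<^sub>m m)"
proof (induction m)
  case (Suc m)
  have "transpose_mat A ^\<^sub>m Suc m = transpose_mat (A * A ^\<^sub>m m)"
    using Suc A by (simp add: transpose_mult[of _ k k _ k])
  then show ?case using pow_mat_Suc_left[OF A] by simp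
qed (use A in simp)

lemma diff_matrix_carrier [simp]:
  "X \<in> carrier_mat k k \<Longrightarrow> diff_matrix p X \<in> carrier_mat (k * k) (k * k)"
  by (simp add: diff_matrix_def Let_def carrier_matD)

lemma diff_matrix_vectorize:
  assumes X: "X \<in> carrier_mat k k" and Z: "Z \<in> carrier_mat k k"
  shows "diff_matrix p X *\<^sub>v vectorize Z = vectorize (diff_op p X Z)"
proof (rule eq_vecI)
  fix t assume "t < dim_vec (vectorize (diff_op p X Z))"
  then have t: "t < k * k" using X by (simp add: vectorize_def carrier_matD)
  note tt = div_mod_less_square[OF t]
  let ?K = "\<lambda>m i. kronecker (transpose_mat X ^\<^sub>m i) (X ^\<^sub>m (m - 1 - i))"
  have "(diff_matrix p X *\<^sub>v vectorize Z) $ t = (\<Sum>u<k * k. diff_matrix p X $$ (t, u) * vectorize Z $ u)"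
    by (rule mult_vec_index[OF diff_matrix_carrier[OF X] vectorize_carrier[OF Z] t])
  also have "\<dots> = (\<Sum>u<k * k. (\<Sum>m = 1..degree p. coeff p m * (\<Sum>i = 0..m - 1. ?K m i $$ (t, u))) * vectorize Z $ u)"
    using t X by (intro sum.cong refl) (simp add: diff_matrix_def Let_def carrier_matD)
  also have "\<dots> = (\<Sum>m = 1..degree p. coeff p m * (\<Sum>i = 0..m - 1. \<Sum>u<k * k. ?K m i $$ (t, u) * vectorize Z $ u))"
    unfolding sum_distrib_right sum_distrib_left
    by (subst sum.swap, rule sum.cong[OF refl], subst sum.swap) (simp add: mult_ac)
  also have "\<dots> = diff_op p X Z $$ (t mod k, t div k)"
    using X tt by (simp add: diff_op_index transpose_pow[OF X]
        kronecker_vectorize[OF pow_carrier_mat[OF X] pow_carrier_mat[OF X] Z t])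
  finally show "(diff_matrix p X *\<^sub>v vectorize Z) $ t = vectorize (diff_op p X Z) $ t"
    using t X by (simp add: vectorize_index[of _ k])
qed (use X carrier_matD(1)[OF diff_matrix_carrier[OF X, of p]] in \<open>simp add: vectorize_def carrier_matD\<close>)

lemma not_cond_D_iff:
  assumes X: "X \<in> carrier_mat k k"
  shows "\<not> cond_D p X \<longleftrightarrow> (\<exists>Z\<in>carrier_mat k k. Z \<noteq> 0\<^sub>m k k \<and> diff_op p X Z = 0\<^sub>m k k)"
proof -
  have vec0: "vectorize (0\<^sub>m k k) = 0\<^sub>v (k * k)"
    by (rule eq_vecI) (auto simp: vectorize_def dest: div_mod_less_square)
  have z: "vectorize Y = 0\<^sub>v (k * k) \<longleftrightarrow> Y = 0\<^sub>m k k" if "Y \<in> carrier_mat k k" for Y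
    using vectorize_inject[OF that zero_carrier_mat] vec0 by simp
  have "\<not> cond_D p X \<longleftrightarrow> (\<exists>v. v \<in> carrier_vec (k * k) \<and> v \<noteq> 0\<^sub>v (k * k) \<and> diff_matrix p X *\<^sub>v v = 0\<^sub>v (k * k))"
    unfolding cond_D_def using det_0_iff_vec_prod_zero[OF diff_matrix_carrier[OF X]] by simp
  also have "\<dots> \<longleftrightarrow> (\<exists>Z\<in>carrier_mat k k. vectorize Z \<noteq> 0\<^sub>v (k * k) \<and> diff_matrix p X *\<^sub>v vectorize Z = 0\<^sub>v (k * k))"
    using vectorize_unvectorize[of _ k] by (metis unvectorize_carrier vectorize_carrier)
  also have "\<dots> \<longleftrightarrow> (\<exists>Z\<in>carrier_mat k k. Z \<noteq> 0\<^sub>m k k \<and> diff_op p X Z = 0\<^sub>m k k)"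
    using z X by (simp add: diff_matrix_vectorize[OF X] cong: bex_cong)
  finally show ?thesis .
qed

lemma pow_mat_eigen_left:
  fixes X :: "complex mat"
  assumes "X \<in> carrier_mat k k" "Z \<in> carrier_mat k k" "X * Z = a \<cdot>\<^sub>m Z"
  shows "X ^\<^sub>m m * Z = a ^ m \<cdot>\<^sub>m Z"
proof (induction m)
  case (Suc m)
  have "X ^\<^sub>m Suc m * Z = X ^\<^sub>m m * (a \<cdot>\<^sub>m Z)"
    using assms by (simp add: square_mult_assoc[of _ k])
  also have "\<dots> = a \<cdot>\<^sub>m (a ^ m \<cdot>\<^sub>m Z)"
    using assms Suc by (simp add: mult_smult_distrib[of _ k k _ k])
  finally show ?case using assms(2) by (auto simp: mult_ac)
qed (use assms in auto)

lemma pow_mat_eigen_right: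
  fixes X :: "complex mat"
  assumes "X \<in> carrier_mat k k" "Z \<in> carrier_mat k k" "Z * X = a \<cdot>\<^sub>m Z"
  shows "Z * X ^\<^sub>m m = a ^ m \<cdot>\<^sub>m Z"
proof (induction m)
  case (Suc m)
  have "Z * X ^\<^sub>m Suc m = Z * X ^\<^sub>m m * X"
    using assms by (simp add: square_mult_assoc[of _ k])
  also have "\<dots> = a ^ m \<cdot>\<^sub>m (a \<cdot>\<^sub>m Z)"
    unfolding Suc using assms by (simp add: mult_smult_assoc_mat[of _ k k _ k])
  finally show ?case using assms(2) by (auto simp: mult_ac)
qed (use assms in auto)

lemma diff_op_eigen:
  assumes X: "X \<in> carrier_mat k k" and Z: "Z \<in> carrier_mat k k"
    and l: "X * Z = a \<cdot>\<^sub>m Z" and r: "Z * X = b \<cdot>\<^sub>m Z"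
  shows "diff_op p X Z = (\<Sum>m = 1..degree p. coeff p m * (\<Sum>i = 0..m - 1. b ^ i * a ^ (m - 1 - i))) \<cdot>\<^sub>m Z"
proof -
  have "X ^\<^sub>m u * Z * X ^\<^sub>m v = (b ^ v * a ^ u) \<cdot>\<^sub>m Z" for u v
    unfolding pow_mat_eigen_left[OF X Z l] using X Z
    by (auto simp: mult_smult_assoc_mat[of _ k k _ k] pow_mat_eigen_right[OF X Z r] mult_ac)
  then show ?thesis using X Z
    by (intro eq_matI) (auto simp: diff_op_index sum_distrib_right sum_distrib_left mult_ac)
qed

lemma diff_op_mult_left:
  assumes X: "X \<in> carrier_mat k k" and Z: "Z \<in> carrier_mat k k" and U: "U \<in> carrier_mat k k" "X * U = U * X"
  shows "diff_op p X (U * Z) = U * diff_op p X Z"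
proof -
  have "X ^\<^sub>m u * (U * Z) * X ^\<^sub>m v = U * (X ^\<^sub>m u * Z * X ^\<^sub>m v)" for u v
  proof -
    have "X ^\<^sub>m u * (U * Z) * X ^\<^sub>m v = X ^\<^sub>m u * U * Z * X ^\<^sub>m v"
      using X Z U(1) by (simp add: square_mult_assoc[of _ k])
    also have "\<dots> = U * (X ^\<^sub>m u * Z * X ^\<^sub>m v)"
      unfolding pow_mat_commute_gen[OF X U] using X Z U(1) by (simp add: square_mult_assoc[of _ k])
    finally show ?thesis .
  qed
  then show ?thesis using X Z U(1)
    by (simp add: diff_op_def Let_def carrier_matD mult_mat_sum[of _ k k _ _ k] mult_smult_distrib[of _ k k _ k])
qed

lemma diff_op_mult_right:
  assumes X: "X \<in> carrier_mat k k" and Z: "Z \<in> carrier_mat k k" and U: "U \<in> carrier_mat k k" "X * U = U * X"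
  shows "diff_op p X (Z * U) = diff_op p X Z * U"
proof -
  have "X ^\<^sub>m u * (Z * U) * X ^\<^sub>m v = X ^\<^sub>m u * Z * X ^\<^sub>m v * U" for u v
    using X Z U(1) by (simp add: square_mult_assoc[of _ k] pow_mat_commute_gen[OF X U])
  then show ?thesis using X Z U(1)
    by (simp add: diff_op_def Let_def carrier_matD mat_sum_mult[of _ k k _ _ k] mult_smult_assoc_mat[of _ k k _ k])
qed

text \<open>
  A polynomial annihilating \<open>X\<close> is a product of linear factors.  Applied one after the other to
  \<open>Z\<close>, these factors finally give zero; the last nonzero matrix is an eigenvector of left
  multiplication by \<open>X\<close>.
\<close>

lemma ex_left_eigen:
  fixes X :: "complex mat"
  assumes X: "X \<in> carrier_mat k k" and S: "S \<subseteq> carrier_mat k k"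
    and closed: "\<And>Z a. Z \<in> S \<Longrightarrow> (X - a \<cdot>\<^sub>m 1\<^sub>m k) * Z \<in> S"
    and Z: "Z \<in> S" "Z \<noteq> 0\<^sub>m k k"
  shows "\<exists>W\<in>S. \<exists>a. W \<noteq> 0\<^sub>m k k \<and> X * W = a \<cdot>\<^sub>m W"
proof -
  have main: "\<exists>W\<in>S. \<exists>a. W \<noteq> 0\<^sub>m k k \<and> X * W = a \<cdot>\<^sub>m W"
    if "degree q = n" "q \<noteq> 0" "Z \<in> S" "Z \<noteq> 0\<^sub>m k k" "poly_mat q X * Z = 0\<^sub>m k k" for n q Z
    using that
  proof (induction n arbitrary: q Z)
    case 0
    then obtain c where c: "q = [:c:]" "c \<noteq> 0" by (auto elim: degree_eq_zeroE)
    have Zc: "Z \<in> carrier_mat k k" using 0 S by auto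
    have "c \<cdot>\<^sub>m Z = 0\<^sub>m k k"
      using 0 c Zc X by (simp add: poly_mat_const[OF X] mult_smult_assoc_mat[of _ k k _ k])
    then have "Z = 0\<^sub>m k k" using c Zc by (auto simp: mat_eq_iff)
    then show ?case using 0 by simp
  next
    case (Suc n)
    have Zc: "Z \<in> carrier_mat k k" using Suc.prems S by auto
    have "\<not> constant (poly q)" using Suc.prems by (simp add: constant_degree)
    then obtain a where a: "poly q a = 0" using fundamental_theorem_of_algebra by blast
    then obtain u where u: "q = [:-a, 1:] * u" by (auto simp: poly_eq_0_iff_dvd elim: dvdE)
    have u0: "u \<noteq> 0" using u Suc.prems by auto
    have "degree q = degree [:-a, 1:] + degree u" unfolding u by (rule degree_mult_eq) (use u0 in auto)
    then have du: "degree u = n" using Suc.prems(1) by simp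
    have "[:-a, 1:] = [:0, 1:] - [:a:]" by simp
    then have lin: "poly_mat [:-a, 1:] X = X - a \<cdot>\<^sub>m 1\<^sub>m k"
      by (simp only: poly_mat_diff[OF X] poly_mat_X[OF X] poly_mat_const[OF X])
    define W where "W = (X - a \<cdot>\<^sub>m 1\<^sub>m k) * Z"
    have WS: "W \<in> S" unfolding W_def using Suc.prems closed by blast
    show ?case
    proof (cases "W = 0\<^sub>m k k")
      case True
      have "W = X * Z - a \<cdot>\<^sub>m Z"
        unfolding W_def using X Zc
        by (simp add: minus_mult_distrib_mat[of _ k k _ _ k] mult_smult_assoc_mat[of _ k k _ k])
      then have "X * Z = a \<cdot>\<^sub>m Z" using True X Zc
        by (simp add: mat_eq_iff carrier_matD)
      then show ?thesis using Suc.prems by blast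
    next
      case False
      have "poly_mat u X * W = poly_mat (u * [:-a, 1:]) X * Z"
        unfolding W_def poly_mat_mult[OF X] lin using X Zc poly_mat_carrier[OF X]
        by (intro square_mult_assoc[symmetric, of _ k]) auto
      also have "\<dots> = 0\<^sub>m k k" using Suc.prems(5) u by (simp add: mult.commute)
      finally show ?thesis using Suc.IH[OF du u0 WS False] by blast
    qed
  qed
  obtain q where q: "q \<noteq> 0" "poly_mat q X = 0\<^sub>m k k" using ex_annihilating_poly[OF X] by blast
  show ?thesis
    using main[OF refl q(1) Z] q(2) Z S by (auto simp: left_mult_zero_mat[of _ k])
qed

lemma eigen_mat_imp_eigenvalue:
  fixes X :: "complex mat"
  assumes X: "X \<in> carrier_mat k k" and W: "W \<in> carrier_mat k k" "W \<noteq> 0\<^sub>m k k" "X * W = a \<cdot>\<^sub>m W"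
  shows "eigenvalue X a"
proof -
  obtain i j where ij: "i < k" "j < k" "W $$ (i, j) \<noteq> 0" using W by (auto simp: mat_eq_iff)
  have "X *\<^sub>v col W j = col (X * W) j" using col_mult2[OF X W(1) ij(2)] by simp
  also have "\<dots> = a \<cdot>\<^sub>v col W j" unfolding W(3) using W(1) ij by simp
  finally have "X *\<^sub>v col W j = a \<cdot>\<^sub>v col W j" .
  moreover have "col W j \<noteq> 0\<^sub>v k" using ij W(1) by (metis carrier_matD index_col index_zero_vec(1))
  ultimately show ?thesis using X W(1) ij unfolding eigenvalue_def eigenvector_def
    by (intro exI[of _ "col W j"]) auto
qed

lemma eigenvalue_transpose_iff:
  fixes X :: "complex mat"
  assumes X: "X \<in> carrier_mat k k"
  shows "eigenvalue X a \<longleftrightarrow> eigenvalue (transpose_mat X) a"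
  using X eigenvalue_root_char_poly[OF X, of a] eigenvalue_root_char_poly[of "transpose_mat X" k a] by simp

text \<open>
  Left and right multiplication by \<open>X\<close> commute with the operator whose matrix occurs in (D).
  Hence its kernel, if nonzero, contains a common eigenvector \<open>Z\<close> of both, \<open>X Z = a Z\<close> and
  \<open>Z X = b Z\<close>, on which the operator is the scalar in (D') for the eigenvalues \<open>b\<close> and \<open>a\<close>.
  Conversely such a \<open>Z\<close> is the product of a right eigenvector and a left eigenvector.
\<close>

theorem cond_D_iff_cond_D':
  assumes X: "X \<in> carrier_mat k k"
  shows "cond_D p X \<longleftrightarrow> cond_D' p X"
proof -
  let ?s = "\<lambda>\<mu>\<^sub>1 \<mu>\<^sub>2. \<Sum>m = 1..degree p. coeff p m * (\<Sum>i = 0..m - 1. \<mu>\<^sub>1 ^ i * \<mu>\<^sub>2 ^ (m - 1 - i))"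
  have "\<exists>\<mu>\<^sub>1\<in>spectrum X. \<exists>\<mu>\<^sub>2\<in>spectrum X. ?s \<mu>\<^sub>1 \<mu>\<^sub>2 = 0"
    if Z: "Z \<in> carrier_mat k k" "Z \<noteq> 0\<^sub>m k k" "diff_op p X Z = 0\<^sub>m k k" for Z
  proof -
    define K where "K = {Z \<in> carrier_mat k k. diff_op p X Z = 0\<^sub>m k k}"
    have comm: "X * (X - a \<cdot>\<^sub>m 1\<^sub>m k) = (X - a \<cdot>\<^sub>m 1\<^sub>m k) * X" for a
      using X by (simp add: minus_mult_distrib_mat[of _ k k _ _ k] mult_minus_distrib_mat[of _ k k _ k]
          mult_smult_assoc_mat[of _ k k _ k] mult_smult_distrib[of _ k k _ k])
    have c: "X - a \<cdot>\<^sub>m 1\<^sub>m k \<in> carrier_mat k k" for a using X by auto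
    have closed: "(X - a \<cdot>\<^sub>m 1\<^sub>m k) * Z \<in> K" "Z * (X - a \<cdot>\<^sub>m 1\<^sub>m k) \<in> K" if "Z \<in> K" for Z a
      using that X c[of a] diff_op_mult_left[OF X _ c comm] diff_op_mult_right[OF X _ c comm]
      by (auto simp: K_def left_mult_zero_mat[of _ k] right_mult_zero_mat[of _ k k])
    obtain W a where W: "W \<in> K" "W \<noteq> 0\<^sub>m k k" "X * W = a \<cdot>\<^sub>m W"
      using ex_left_eigen[OF X _ closed(1), of Z] Z unfolding K_def by blast
    define S where "S = {Y. transpose_mat Y \<in> K \<and> X * transpose_mat Y = a \<cdot>\<^sub>m transpose_mat Y}"
    have Sc: "S \<subseteq> carrier_mat k k" by (auto simp: S_def K_def)
    have "(transpose_mat X - b \<cdot>\<^sub>m 1\<^sub>m k) * Y \<in> S" if Y: "Y \<in> S" for Y b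
    proof -
      have Yc: "Y \<in> carrier_mat k k" using Y Sc by auto
      have "transpose_mat (transpose_mat X - b \<cdot>\<^sub>m 1\<^sub>m k) = X - b \<cdot>\<^sub>m 1\<^sub>m k"
        using X by (intro eq_matI) auto
      then have eq: "transpose_mat ((transpose_mat X - b \<cdot>\<^sub>m 1\<^sub>m k) * Y) = transpose_mat Y * (X - b \<cdot>\<^sub>m 1\<^sub>m k)"
        using transpose_mult[of "transpose_mat X - b \<cdot>\<^sub>m 1\<^sub>m k" k k Y k] X Yc by (simp add: minus_carrier_mat)
      have "X * (transpose_mat Y * (X - b \<cdot>\<^sub>m 1\<^sub>m k)) = X * transpose_mat Y * (X - b \<cdot>\<^sub>m 1\<^sub>m k)"
        using X Yc c by (simp add: square_mult_assoc[of _ k])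
      also have "\<dots> = a \<cdot>\<^sub>m (transpose_mat Y * (X - b \<cdot>\<^sub>m 1\<^sub>m k))"
        using Y Yc c by (simp add: S_def mult_smult_assoc_mat[of _ k k _ k])
      finally show ?thesis using Y closed(2) unfolding S_def mem_Collect_eq eq by blast
    qed
    moreover have "transpose_mat W \<in> S" "transpose_mat W \<noteq> 0\<^sub>m k k"
      using W by (auto simp: S_def) (metis transpose_transpose zero_transpose_mat)
    ultimately obtain V b where V: "V \<in> S" "V \<noteq> 0\<^sub>m k k" "transpose_mat X * V = b \<cdot>\<^sub>m V"
      using ex_left_eigen[of "transpose_mat X" k S "transpose_mat W"] X Sc by auto
    have Vc: "V \<in> carrier_mat k k" using V Sc by auto
    have "eigenvalue (transpose_mat X) b" using eigen_mat_imp_eigenvalue[of _ k V b] X V Vc by simp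
    then have b: "b \<in> spectrum X" using eigenvalue_transpose_iff[OF X] by (simp add: spectrum_def)
    have a: "a \<in> spectrum X" using eigen_mat_imp_eigenvalue[OF X _ W(2,3)] W(1) by (simp add: spectrum_def K_def)
    define Y where "Y = transpose_mat V"
    have Yc: "Y \<in> carrier_mat k k" and Y0: "Y \<noteq> 0\<^sub>m k k" using Vc V(2) unfolding Y_def
      by (auto) (metis transpose_transpose zero_transpose_mat)
    have "transpose_mat (transpose_mat X * V) = transpose_mat (b \<cdot>\<^sub>m V)" using V(3) by simp
    then have "Y * X = b \<cdot>\<^sub>m Y"
      using X Vc by (simp add: transpose_mult[of _ k k _ k] Y_def) (auto intro!: eq_matI)
    moreover have "X * Y = a \<cdot>\<^sub>m Y" "diff_op p X Y = 0\<^sub>m k k" using V(1) by (auto simp: S_def Y_def K_def)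
    ultimately have "?s b a \<cdot>\<^sub>m Y = 0\<^sub>m k k" using diff_op_eigen[OF X Yc, of a b p] by simp
    then have "?s b a = 0" using Y0 Yc by (auto simp: mat_eq_iff)
    then show ?thesis using a b by blast
  qed
  moreover have "\<exists>Z\<in>carrier_mat k k. Z \<noteq> 0\<^sub>m k k \<and> diff_op p X Z = 0\<^sub>m k k"
    if s: "\<mu>\<^sub>1 \<in> spectrum X" "\<mu>\<^sub>2 \<in> spectrum X" "?s \<mu>\<^sub>1 \<mu>\<^sub>2 = 0" for \<mu>\<^sub>1 \<mu>\<^sub>2
  proof -
    obtain v where v: "v \<in> carrier_vec k" "v \<noteq> 0\<^sub>v k" "X *\<^sub>v v = \<mu>\<^sub>2 \<cdot>\<^sub>v v"
      using s(2) X by (auto simp: spectrum_def eigenvalue_def eigenvector_def)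
    obtain w where w: "w \<in> carrier_vec k" "w \<noteq> 0\<^sub>v k" "transpose_mat X *\<^sub>v w = \<mu>\<^sub>1 \<cdot>\<^sub>v w"
      using s(1) X eigenvalue_transpose_iff[OF X] by (auto simp: spectrum_def eigenvalue_def eigenvector_def)
    define Z where "Z = mat k k (\<lambda>(i, j). v $ i * w $ j)"
    have Z: "Z \<in> carrier_mat k k" by (simp add: Z_def)
    have l: "X * Z = \<mu>\<^sub>2 \<cdot>\<^sub>m Z"
    proof (rule eq_matI)
      fix i j assume "i < dim_row (\<mu>\<^sub>2 \<cdot>\<^sub>m Z)" "j < dim_col (\<mu>\<^sub>2 \<cdot>\<^sub>m Z)"
      then have ij: "i < k" "j < k" using Z by auto
      have "(X * Z) $$ (i, j) = (X *\<^sub>v v) $ i * w $ j"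
        unfolding mult_index[OF X Z ij] mult_vec_index[OF X v(1) ij(1)]
        using ij by (simp add: Z_def sum_distrib_right sum_distrib_left mult_ac)
      then show "(X * Z) $$ (i, j) = (\<mu>\<^sub>2 \<cdot>\<^sub>m Z) $$ (i, j)"
        unfolding v(3) using ij v(1) by (simp add: Z_def)
    qed (use X Z in auto)
    have r: "Z * X = \<mu>\<^sub>1 \<cdot>\<^sub>m Z"
    proof (rule eq_matI)
      fix i j assume "i < dim_row (\<mu>\<^sub>1 \<cdot>\<^sub>m Z)" "j < dim_col (\<mu>\<^sub>1 \<cdot>\<^sub>m Z)"
      then have ij: "i < k" "j < k" using Z by auto
      have "(Z * X) $$ (i, j) = v $ i * (transpose_mat X *\<^sub>v w) $ j"
        unfolding mult_index[OF Z X ij] using ij X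
        by (subst mult_vec_index[of _ k k]) (auto simp: w(1) Z_def sum_distrib_left mult_ac)
      then show "(Z * X) $$ (i, j) = (\<mu>\<^sub>1 \<cdot>\<^sub>m Z) $$ (i, j)"
        unfolding w(3) using ij w(1) by (simp add: Z_def)
    qed (use X Z in auto)
    have "diff_op p X Z = 0 \<cdot>\<^sub>m Z" unfolding diff_op_eigen[OF X Z l r] s(3) ..
    then have "diff_op p X Z = 0\<^sub>m k k" using Z by auto
    moreover obtain i j where "i < k" "v $ i \<noteq> 0" "j < k" "w $ j \<noteq> 0"
      using v w by (metis eq_vecI carrier_vecD index_zero_vec)
    then have "Z $$ (i, j) \<noteq> 0\<^sub>m k k $$ (i, j)" by (simp add: Z_def)
    then have "Z \<noteq> 0\<^sub>m k k" by auto
    ultimately show ?thesis using Z by blast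
  qed
  ultimately have "\<not> cond_D p X \<longleftrightarrow> \<not> cond_D' p X"
    unfolding not_cond_D_iff[OF X] cond_D'_def by blast
  then show ?thesis by blast
qed

section \<open>Powers of power series with matrix coefficients\<close>

text \<open>
  Power series need a coefficient type that is a ring, and the square matrices of a given size do
  not form a type.  The additive maps of infinite sequences do form a ring under composition; a
  \<open>k \<times> k\<close> matrix acts as such a map on the first \<open>k\<close> components and gives zero in the others.
  This embedding respects sums and products, but takes the identity matrix to a proper idempotent.
\<close>

typedef endo = "{f :: (nat \<Rightarrow> complex) \<Rightarrow> nat \<Rightarrow> complex. \<forall>x y. f (\<lambda>i. x i + y i) = (\<lambda>i. f x i + f y i)}"
  by (rule exI[of _ "\<lambda>x. x"]) simp

setup_lifting type_definition_endo

instantiation endo :: ring_1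
begin
lift_definition zero_endo :: endo is "\<lambda>_ _. 0" by simp
lift_definition one_endo :: endo is "\<lambda>x. x" by simp
lift_definition plus_endo :: "endo \<Rightarrow> endo \<Rightarrow> endo" is "\<lambda>f g x i. f x i + g x i" by (simp add: algebra_simps)
lift_definition minus_endo :: "endo \<Rightarrow> endo \<Rightarrow> endo" is "\<lambda>f g x i. f x i - g x i" by (simp add: algebra_simps)
lift_definition uminus_endo :: "endo \<Rightarrow> endo" is "\<lambda>f x i. - f x i" by simp
lift_definition times_endo :: "endo \<Rightarrow> endo \<Rightarrow> endo" is "\<lambda>f g x. f (g x)" by simp
instance
proof
  show "(0::endo) \<noteq> 1"
    by transfer (metis zero_neq_one)
qed (transfer; simp add: algebra_simps)+
end

lift_definition mat_op :: "nat \<Rightarrow> complex mat \<Rightarrow> endo" is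
  "\<lambda>k A x i. if i < k then \<Sum>j<k. A $$ (i, j) * x j else 0"
  by (auto simp: distrib_left sum.distrib)

lemma mat_op_mult:
  assumes A: "A \<in> carrier_mat k k" and B: "B \<in> carrier_mat k k"
  shows "mat_op k (A * B) = mat_op k A * mat_op k B"
proof -
  have "(\<Sum>j<k. (A * B) $$ (i, j) * x j) = (\<Sum>l<k. A $$ (i, l) * (\<Sum>j<k. B $$ (l, j) * x j))"
    if "i < k" for i and x :: "nat \<Rightarrow> complex"
  proof -
    have "(\<Sum>j<k. (A * B) $$ (i, j) * x j) = (\<Sum>j<k. \<Sum>l<k. A $$ (i, l) * (B $$ (l, j) * x j))"
      using that by (intro sum.cong refl) (simp add: mult_index[OF A B] sum_distrib_right sum_distrib_left mult_ac)
    then show ?thesis by (subst (asm) sum.swap) (simp add: sum_distrib_left)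
  qed
  then show ?thesis
    by (simp add: Rep_endo_inject [symmetric] fun_eq_iff mat_op.rep_eq times_endo.rep_eq)
qed

lemma mat_op_add:
  assumes "A \<in> carrier_mat k k" "B \<in> carrier_mat k k"
  shows "mat_op k (A + B) = mat_op k A + mat_op k B"
  using assms
  by (simp add: Rep_endo_inject [symmetric] fun_eq_iff mat_op.rep_eq plus_endo.rep_eq distrib_right sum.distrib)

lemma mat_op_0: "mat_op k (0\<^sub>m k k) = 0"
  by (simp add: Rep_endo_inject [symmetric] fun_eq_iff mat_op.rep_eq zero_endo.rep_eq)

lemma mat_op_inject:
  assumes "A \<in> carrier_mat k k" "B \<in> carrier_mat k k"
  shows "mat_op k A = mat_op k B \<longleftrightarrow> A = B"
proof
  assume "mat_op k A = mat_op k B"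
  then have rep: "Rep_endo (mat_op k A) x i = Rep_endo (mat_op k B) x i" for x i by simp
  have eq: "(\<Sum>j<k. A $$ (i, j) * x j) = (\<Sum>j<k. B $$ (i, j) * x j)" if "i < k" for x i
    using rep[of x i] that by (simp add: mat_op.rep_eq)
  show "A = B"
  proof (rule eq_matI)
    fix i j assume "i < dim_row B" "j < dim_col B"
    then have "i < k" "j < k" using assms by auto
    then show "A $$ (i, j) = B $$ (i, j)"
      using eq[of i "\<lambda>l. if l = j then 1 else 0"] by (simp add: if_distrib[of "\<lambda>x. _ * x"] cong: if_cong)
  qed (use assms in auto)
qed simp

lemma mat_op_sum:
  assumes "\<And>x. x \<in> S \<Longrightarrow> f x \<in> carrier_mat k k"
  shows "mat_op k (mat_sum k k f S) = (\<Sum>x\<in>S. mat_op k (f x))"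
  using assms
proof (induction S rule: infinite_finite_induct)
  case (insert x S)
  have "mat_sum k k f (insert x S) = f x + mat_sum k k f S"
    using insert by (intro eq_matI) auto
  then show ?case using insert by (simp add: mat_op_add)
next
  case (infinite S)
  then have "mat_sum k k f S = 0\<^sub>m k k" by (intro eq_matI) auto
  then show ?case using infinite by (simp add: mat_op_0)
next
  case empty
  have "mat_sum k k f {} = 0\<^sub>m k k" by (intro eq_matI) auto
  then show ?case by (simp add: mat_op_0)
qed

lemma mat_op_mult_pow:
  assumes "A \<in> carrier_mat k k" "X \<in> carrier_mat k k"
  shows "mat_op k (A * X ^\<^sub>m m) = mat_op k A * mat_op k X ^ m"
proof (induction m)
  case (Suc m)
  have "mat_op k (A * X ^\<^sub>m Suc m) = mat_op k (A * X ^\<^sub>m m * X)"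
    using assms by (simp add: square_mult_assoc[of _ k])
  also have "\<dots> = mat_op k A * mat_op k X ^ m * mat_op k X"
    using assms Suc mat_op_mult[of "A * X ^\<^sub>m m" k X] by simp
  finally show ?case by (simp add: power_Suc2 mult.assoc del: power_Suc)
qed (use assms in simp)

text \<open>
  \<open>x ^ m - c ^ m\<close> is the sum over the position of the last factor in which \<open>x\<close> differs from \<open>c\<close>, or,
  in the mirror image of the identity, of the first such factor.
\<close>

lemma power_telescope_right:
  fixes x c :: "'a::ring_1"
  shows "x ^ m = c ^ m + (\<Sum>i<m. x ^ (m - 1 - i) * (x - c) * c ^ i)"
proof (induction m)
  case (Suc m)
  have "(\<Sum>i<m. x ^ (Suc m - 1 - i) * (x - c) * c ^ i) = x * (\<Sum>i<m. x ^ (m - 1 - i) * (x - c) * c ^ i)"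
    unfolding sum_distrib_left
  proof (intro sum.cong refl)
    fix i assume "i \<in> {..<m}"
    then have "Suc m - 1 - i = Suc (m - 1 - i)" by auto
    then show "x ^ (Suc m - 1 - i) * (x - c) * c ^ i = x * (x ^ (m - 1 - i) * (x - c) * c ^ i)"
      by (simp only: power_Suc mult.assoc)
  qed
  then have "c ^ Suc m + (\<Sum>i<Suc m. x ^ (Suc m - 1 - i) * (x - c) * c ^ i) =
      c ^ Suc m + x * (\<Sum>i<m. x ^ (m - 1 - i) * (x - c) * c ^ i) + (x - c) * c ^ m"
    by (simp add: add.assoc)
  also have "\<dots> = x * (c ^ m + (\<Sum>i<m. x ^ (m - 1 - i) * (x - c) * c ^ i))"
    by (simp add: algebra_simps)
  finally show ?case using Suc by simp
qed simp

lemma power_telescope_left: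
  fixes x c :: "'a::ring_1"
  shows "x ^ m = c ^ m + (\<Sum>i<m. c ^ (m - 1 - i) * (x - c) * x ^ i)"
proof -
  have "c ^ m = x ^ m + (\<Sum>i<m. c ^ (m - 1 - i) * (c - x) * x ^ i)"
    by (rule power_telescope_right)
  also have "(\<Sum>i<m. c ^ (m - 1 - i) * (c - x) * x ^ i) = - (\<Sum>i<m. c ^ (m - 1 - i) * (x - c) * x ^ i)"
    unfolding sum_negf[symmetric] by (intro sum.cong refl) (simp add: algebra_simps)
  finally show ?thesis by simp
qed

text \<open>
  The power is split at the last factor \<open>x - c\<close>, and the power of \<open>x\<close> before it at the first one.
  This leaves arbitrary factors \<open>x\<close> only between the two.
\<close>

lemma power_second_order_expansion:
  fixes x c :: "'a::ring_1"
  shows "x ^ m = c ^ m + (\<Sum>i<m. c ^ (m - 1 - i) * (x - c) * c ^ i) +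
    (\<Sum>i<m. \<Sum>\<nu><m - 1 - i. c ^ (m - i - 2 - \<nu>) * ((x - c) * x ^ \<nu> * (x - c)) * c ^ i)"
proof -
  have "x ^ m = c ^ m + (\<Sum>i<m. x ^ (m - 1 - i) * (x - c) * c ^ i)"
    by (rule power_telescope_right)
  also have "(\<Sum>i<m. x ^ (m - 1 - i) * (x - c) * c ^ i) =
    (\<Sum>i<m. c ^ (m - 1 - i) * (x - c) * c ^ i +
      (\<Sum>\<nu><m - 1 - i. c ^ (m - i - 2 - \<nu>) * ((x - c) * x ^ \<nu> * (x - c)) * c ^ i))"
  proof (intro sum.cong refl)
    fix i assume i: "i \<in> {..<m}"
    have "x ^ (m - 1 - i) * (x - c) * c ^ i =
      (c ^ (m - 1 - i) + (\<Sum>\<nu><m - 1 - i. c ^ (m - 1 - i - 1 - \<nu>) * (x - c) * x ^ \<nu>)) * (x - c) * c ^ i"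
      by (subst power_telescope_left[of x _ c]) simp
    also have "\<dots> = c ^ (m - 1 - i) * (x - c) * c ^ i +
      (\<Sum>\<nu><m - 1 - i. c ^ (m - 1 - i - 1 - \<nu>) * (x - c) * x ^ \<nu> * (x - c) * c ^ i)"
      by (simp only: distrib_right sum_distrib_right)
    also have "(\<Sum>\<nu><m - 1 - i. c ^ (m - 1 - i - 1 - \<nu>) * (x - c) * x ^ \<nu> * (x - c) * c ^ i) =
      (\<Sum>\<nu><m - 1 - i. c ^ (m - i - 2 - \<nu>) * ((x - c) * x ^ \<nu> * (x - c)) * c ^ i)"
      by (intro sum.cong refl) (simp add: mult.assoc numeral_2_eq_2 diff_commute)
    finally show "x ^ (m - 1 - i) * (x - c) * c ^ i = c ^ (m - 1 - i) * (x - c) * c ^ i +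
      (\<Sum>\<nu><m - 1 - i. c ^ (m - i - 2 - \<nu>) * ((x - c) * x ^ \<nu> * (x - c)) * c ^ i)" .
  qed
  finally show ?thesis by (simp add: sum.distrib add.assoc)
qed

text \<open>Constant factors on the outside can be taken out of a coefficient.\<close>

lemma fps_power_coeff:
  fixes x :: "'a::ring_1 fps"
  assumes s: "s > 0"
  defines "c \<equiv> fps_nth x 0" and "u \<equiv> x - fps_const (fps_nth x 0)"
  shows "fps_nth (x ^ m) s = (\<Sum>i<m. c ^ (m - 1 - i) * fps_nth x s * c ^ i) +
    (\<Sum>i<m. \<Sum>\<nu><m - 1 - i. c ^ (m - i - 2 - \<nu>) * fps_nth (u * x ^ \<nu> * u) s * c ^ i)"
proof -
  have pw: "fps_const c ^ j = fps_const (c ^ j)" for j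
    by (induction j) auto
  have us: "fps_nth u s = fps_nth x s" using s by (simp add: u_def)
  have "x ^ m = fps_const (c ^ m) + (\<Sum>i<m. fps_const (c ^ (m - 1 - i)) * u * fps_const (c ^ i)) +
    (\<Sum>i<m. \<Sum>\<nu><m - 1 - i. fps_const (c ^ (m - i - 2 - \<nu>)) * (u * x ^ \<nu> * u) * fps_const (c ^ i))"
    using power_second_order_expansion[of x m "fps_const c"] unfolding pw by (simp add: u_def c_def)
  then show ?thesis using s by (simp add: fps_sum_nth us)
qed

lemma fps_middle_coeff:
  fixes u y :: "'a::ring_1 fps"
  assumes "fps_nth u 0 = 0"
  shows "fps_nth (u * y * u) s =
    (\<Sum>b<s - 1. \<Sum>a<s - 1. if a \<le> b then fps_nth u (Suc a) * fps_nth y (b - a) * fps_nth u (s - 1 - b) else 0)"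
proof (cases s)
  case 0
  then show ?thesis using assms by (simp add: fps_mult_nth)
next
  case (Suc t)
  have uy: "fps_nth (u * y) (Suc b) = (\<Sum>a\<le>b. fps_nth u (Suc a) * fps_nth y (b - a))" for b
    using assms by (simp add: fps_mult_nth atLeast0AtMost sum.atMost_Suc_shift del: sum.atMost_Suc)
  have "fps_nth (u * y * u) (Suc t) = (\<Sum>e\<le>Suc t. fps_nth (u * y) e * fps_nth u (Suc t - e))"
    by (simp add: fps_mult_nth[of "u * y" u] atLeast0AtMost del: sum.atMost_Suc)
  also have "\<dots> = (\<Sum>b\<le>t. fps_nth (u * y) (Suc b) * fps_nth u (t - b))"
    using assms by (subst sum.atMost_Suc_shift) (simp add: fps_mult_nth)
  also have "\<dots> = (\<Sum>b<t. fps_nth (u * y) (Suc b) * fps_nth u (t - b))"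
    using assms by (simp flip: lessThan_Suc_atMost)
  also have "\<dots> = (\<Sum>b<t. \<Sum>a<t. if a \<le> b then fps_nth u (Suc a) * fps_nth y (b - a) * fps_nth u (t - b) else 0)"
  proof (intro sum.cong refl)
    fix b assume b: "b \<in> {..<t}"
    have "fps_nth (u * y) (Suc b) * fps_nth u (t - b) =
        (\<Sum>a\<in>{..b}. fps_nth u (Suc a) * fps_nth y (b - a) * fps_nth u (t - b))"
      unfolding uy sum_distrib_right ..
    also have "\<dots> = (\<Sum>a<t. if a \<in> {..b} then fps_nth u (Suc a) * fps_nth y (b - a) * fps_nth u (t - b) else 0)"
      using b by (intro sum.mono_neutral_cong_left) auto
    finally show "fps_nth (u * y) (Suc b) * fps_nth u (t - b) =
        (\<Sum>a<t. if a \<le> b then fps_nth u (Suc a) * fps_nth y (b - a) * fps_nth u (t - b) else 0)" by simp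
  qed
  finally show ?thesis unfolding Suc diff_Suc_1 .
qed

section \<open>Block Toeplitz matrices\<close>

lemma block_mat_carrier [simp]: "block_mat d e k l F \<in> carrier_mat (d * k) (e * l)"
  and dim_block_mat [simp]: "dim_row (block_mat d e k l F) = d * k" "dim_col (block_mat d e k l F) = e * l"
  by (simp_all add: block_mat_def)

lemma block_mat_index:
  assumes "a < d" "i < k" "b < e" "j < l"
  shows "block_mat d e k l F $$ (a * k + i, b * l + j) = F a b $$ (i, j)"
  using assms by (simp add: block_mat_def block_index_less)

lemma block_mat_eqI:
  assumes M: "M \<in> carrier_mat (d * k) (e * l)"
    and eq: "\<And>a i b j. a < d \<Longrightarrow> i < k \<Longrightarrow> b < e \<Longrightarrow> j < l \<Longrightarrow>
      M $$ (a * k + i, b * l + j) = F a b $$ (i, j)"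
  shows "M = block_mat d e k l F"
proof (rule eq_matI)
  fix s t assume "s < dim_row (block_mat d e k l F)" "t < dim_col (block_mat d e k l F)"
  then have s: "s < d * k" and t: "t < e * l" by auto
  show "M $$ (s, t) = block_mat d e k l F $$ (s, t)"
    using eq[of "s div k" "s mod k" "t div l" "t mod l"] div_mod_less_square[OF s] div_mod_less_square[OF t] s t
    by (simp add: block_mat_def)
qed (use M in auto)

lemma block_mat_cong:
  assumes "\<And>a b. a < d \<Longrightarrow> b < e \<Longrightarrow> F a b = G a b"
  shows "block_mat d e k l F = block_mat d e k l G"
  using assms by (intro block_mat_eqI) (auto simp: block_mat_index)

lemma block_mat_mult:
  assumes F: "\<And>a b. a < d \<Longrightarrow> b < e \<Longrightarrow> F a b \<in> carrier_mat k l"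
    and G: "\<And>b c. b < e \<Longrightarrow> c < f \<Longrightarrow> G b c \<in> carrier_mat l h"
  shows "block_mat d e k l F * block_mat e f l h G =
    block_mat d f k h (\<lambda>a c. mat_sum k h (\<lambda>b. F a b * G b c) {..<e})"
proof (rule block_mat_eqI)
  fix a i c j assume *: "a < d" "i < k" "c < f" "j < h"
  have "(block_mat d e k l F * block_mat e f l h G) $$ (a * k + i, c * h + j) =
      (\<Sum>u<e * l. block_mat d e k l F $$ (a * k + i, u) * block_mat e f l h G $$ (u, c * h + j))"
    using * by (intro mult_index[OF block_mat_carrier block_mat_carrier]) (auto intro: block_index_less)
  also have "\<dots> = (\<Sum>b<e. \<Sum>t<l. F a b $$ (i, t) * G b c $$ (t, j))"
    unfolding sum_blocks using * by (simp add: block_mat_index)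
  also have "\<dots> = (\<Sum>b<e. (F a b * G b c) $$ (i, j))"
    using * F G by (intro sum.cong refl mult_index[symmetric]) auto
  finally show "(block_mat d e k l F * block_mat e f l h G) $$ (a * k + i, c * h + j) =
      mat_sum k h (\<lambda>b. F a b * G b c) {..<e} $$ (i, j)"
    using * by simp
qed (rule mult_carrier_mat[OF block_mat_carrier block_mat_carrier])

lemma block_toeplitz_carrier [simp]: "block_toeplitz k d X \<in> carrier_mat (d * k) (d * k)"
  by (simp add: block_toeplitz_def)

lemma block_toeplitz_cong:
  assumes "\<And>s. 1 \<le> s \<Longrightarrow> s \<le> d \<Longrightarrow> X s = Y s"
  shows "block_toeplitz k d X = block_toeplitz k d Y"
  unfolding block_toeplitz_def using assms by (intro block_mat_cong) auto

lemma block_toeplitz_index0: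
  assumes "b < d" "i < k" "j < k"
  shows "block_toeplitz k d X $$ (i, b * k + j) = X (Suc b) $$ (i, j)"
  using block_mat_index[of 0 d i k b d j k] assms by (simp add: block_toeplitz_def)

lemma block_toeplitz_inject:
  assumes X: "\<And>s. 1 \<le> s \<Longrightarrow> s \<le> d \<Longrightarrow> X s \<in> carrier_mat k k"
    and Y: "\<And>s. 1 \<le> s \<Longrightarrow> s \<le> d \<Longrightarrow> Y s \<in> carrier_mat k k"
  shows "block_toeplitz k d X = block_toeplitz k d Y \<longleftrightarrow> (\<forall>s. 1 \<le> s \<and> s \<le> d \<longrightarrow> X s = Y s)"
proof (intro iffI allI impI)
  fix s assume eq: "block_toeplitz k d X = block_toeplitz k d Y" and s: "1 \<le> s \<and> s \<le> d"
  show "X s = Y s"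
  proof (rule eq_matI)
    fix i j assume "i < dim_row (Y s)" "j < dim_col (Y s)"
    then have "i < k" "j < k" using Y s by auto
    moreover have "s - 1 < d" "Suc (s - 1) = s" using s by auto
    ultimately show "X s $$ (i, j) = Y s $$ (i, j)"
      using block_toeplitz_index0[of "s - 1" d i k j X] block_toeplitz_index0[of "s - 1" d i k j Y] eq s by simp
  qed (use X[of s] Y[of s] s in auto)
qed (auto intro: block_toeplitz_cong)

text \<open>Multiplication of formal power series with matrix coefficients, indexed from 1.\<close>

definition conv :: "nat \<Rightarrow> (nat \<Rightarrow> complex mat) \<Rightarrow> (nat \<Rightarrow> complex mat) \<Rightarrow> nat \<Rightarrow> complex mat" where
  "conv k X Y s = mat_sum k k (\<lambda>t. X t * Y (s + 1 - t)) {1..s}"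

lemma conv_carrier [simp]: "conv k X Y s \<in> carrier_mat k k"
  by (simp add: conv_def)

lemma block_toeplitz_mult:
  assumes X: "\<And>s. 1 \<le> s \<Longrightarrow> s \<le> d \<Longrightarrow> X s \<in> carrier_mat k k"
    and Y: "\<And>s. 1 \<le> s \<Longrightarrow> s \<le> d \<Longrightarrow> Y s \<in> carrier_mat k k"
  shows "block_toeplitz k d X * block_toeplitz k d Y = block_toeplitz k d (conv k X Y)"
proof -
  have "mat_sum k k (\<lambda>b. (if a \<le> b then X (b - a + 1) else 0\<^sub>m k k) * (if b \<le> c then Y (c - b + 1) else 0\<^sub>m k k)) {..<d}
      = (if a \<le> c then conv k X Y (c - a + 1) else 0\<^sub>m k k)" (is "?L = ?R") if a: "a < d" and c: "c < d" for a c
  proof (rule eq_matI)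
    fix i j assume "i < dim_row ?R" "j < dim_col ?R"
    then have ij: "i < k" "j < k" using carrier_matD[OF conv_carrier] by (auto split: if_splits)
    let ?f = "\<lambda>b. ((if a \<le> b then X (b - a + 1) else 0\<^sub>m k k) * (if b \<le> c then Y (c - b + 1) else 0\<^sub>m k k)) $$ (i, j)"
    have "?L $$ (i, j) = (\<Sum>b<d. ?f b)" using ij by simp
    also have "\<dots> = (\<Sum>b\<in>{a..c}. (X (b - a + 1) * Y (c - b + 1)) $$ (i, j))"
    proof (rule sum.mono_neutral_cong_right)
      show "\<forall>b\<in>{..<d} - {a..c}. ?f b = 0"
      proof
        fix b assume b: "b \<in> {..<d} - {a..c}"
        have "X (b - a + 1) \<in> carrier_mat k k" "Y (c - b + 1) \<in> carrier_mat k k"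
          using X Y a b c by auto
        then show "?f b = 0" using b ij
          by (auto simp: left_mult_zero_mat[of _ k k] right_mult_zero_mat[of _ k k k])
      qed
    qed (use c in auto)
    also have "\<dots> = ?R $$ (i, j)"
    proof (cases "a \<le> c")
      case True
      have "(\<Sum>b\<in>{a..c}. (X (b - a + 1) * Y (c - b + 1)) $$ (i, j)) =
        (\<Sum>t\<in>{1..c - a + 1}. (X t * Y (c - a + 1 + 1 - t)) $$ (i, j))"
        by (rule sum.reindex_bij_witness[where i = "\<lambda>t. t - 1 + a" and j = "\<lambda>b. b - a + 1"])
          (use True in \<open>auto simp: Suc_diff_le\<close>)
      then show ?thesis using True ij by (simp add: conv_def)
    qed (use ij in auto)
    finally show "?L $$ (i, j) = ?R $$ (i, j)" .
  qed (auto simp: conv_def)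
  then show ?thesis
    unfolding block_toeplitz_def using X Y
    by (subst block_mat_mult) (auto intro!: block_mat_cong)
qed

text \<open>The coefficients of the powers of the series; the first one has index 1, as in \<^const>\<open>block_toeplitz\<close>.\<close>

primrec toeplitz_pow :: "nat \<Rightarrow> (nat \<Rightarrow> complex mat) \<Rightarrow> nat \<Rightarrow> nat \<Rightarrow> complex mat" where
  "toeplitz_pow k X 0 = (\<lambda>s. if s = 1 then 1\<^sub>m k else 0\<^sub>m k k)"
| "toeplitz_pow k X (Suc m) = conv k (toeplitz_pow k X m) X"

lemma toeplitz_pow_carrier [simp]: "toeplitz_pow k X m s \<in> carrier_mat k k"
  by (cases m) auto

lemma block_toeplitz_one: "block_toeplitz k d (\<lambda>s. if s = 1 then 1\<^sub>m k else 0\<^sub>m k k) = 1\<^sub>m (d * k)"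
  unfolding block_toeplitz_def
proof (rule block_mat_eqI[symmetric])
  fix a i b j assume *: "a < d" "i < k" "b < d" "j < k"
  have "a * k + i = b * k + j \<longleftrightarrow> a = b \<and> i = j"
  proof
    assume eq: "a * k + i = b * k + j"
    have "a = (a * k + i) div k" "b = (b * k + j) div k" using * by auto
    then show "a = b \<and> i = j" using eq by auto
  qed auto
  then show "1\<^sub>m (d * k) $$ (a * k + i, b * k + j) =
    (if a \<le> b then if b - a + 1 = 1 then 1\<^sub>m k else 0\<^sub>m k k else 0\<^sub>m k k) $$ (i, j)"
    using * by (auto simp: block_index_less)
qed simp

lemma block_toeplitz_pow:
  assumes X: "\<And>s. 1 \<le> s \<Longrightarrow> s \<le> d \<Longrightarrow> X s \<in> carrier_mat k k"
  shows "block_toeplitz k d X ^\<^sub>m m = block_toeplitz k d (toeplitz_pow k X m)"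
proof (induction m)
  case 0
  then show ?case using block_toeplitz_one carrier_matD[OF block_toeplitz_carrier] by simp
next
  case (Suc m)
  then show ?case using block_toeplitz_mult[OF _ X, where X = "toeplitz_pow k X m"] by simp
qed

text \<open>
  Multiplication by \<open>A\<close> on the left absorbs the difference between the identity matrix of size
  \<open>k\<close>, which occurs in the power 0, and the identity of the ring.
\<close>

lemma mat_op_toeplitz_pow:
  assumes A: "A \<in> carrier_mat k k" and X: "\<And>t. 1 \<le> t \<Longrightarrow> t \<le> s \<Longrightarrow> X t \<in> carrier_mat k k" and s: "s \<ge> 1"
  shows "mat_op k (A * toeplitz_pow k X m s) =
    mat_op k A * fps_nth (Abs_fps (\<lambda>t. mat_op k (X (Suc t))) ^ m) (s - 1)"
  using X s
proof (induction m arbitrary: s)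
  case 0
  then show ?case using A by (auto simp: mat_op_0 right_mult_zero_mat[of _ k k k])
next
  case (Suc m)
  let ?x = "Abs_fps (\<lambda>t. mat_op k (X (Suc t)))"
  let ?T = "toeplitz_pow k X m"
  have c: "?T t * X (s + 1 - t) \<in> carrier_mat k k" if "t \<in> {1..s}" for t
    using that Suc.prems by auto
  have "mat_op k (A * conv k ?T X s) = mat_op k (mat_sum k k (\<lambda>t. A * (?T t * X (s + 1 - t))) {1..s})"
    unfolding conv_def using c by (subst mult_mat_sum[OF A]) auto
  also have "\<dots> = (\<Sum>t\<in>{1..s}. mat_op k (A * (?T t * X (s + 1 - t))))"
    using A c by (intro mat_op_sum) (simp add: square_mult_carrier[of _ k])
  also have "\<dots> = (\<Sum>t\<in>{1..s}. mat_op k A * (fps_nth (?x ^ m) (t - 1) * fps_nth ?x (s - t)))"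
  proof (intro sum.cong refl)
    fix t assume t: "t \<in> {1..s}"
    then have Xc: "X (s + 1 - t) \<in> carrier_mat k k" using Suc.prems by auto
    have "mat_op k (A * (?T t * X (s + 1 - t))) = mat_op k (A * ?T t * X (s + 1 - t))"
      using square_mult_assoc[OF A _ Xc] by simp
    also have "\<dots> = mat_op k (A * ?T t) * mat_op k (X (s + 1 - t))"
      using mat_op_mult[OF square_mult_carrier[OF A] Xc] by simp
    also have "mat_op k (A * ?T t) = mat_op k A * fps_nth (?x ^ m) (t - 1)"
      using Suc.prems t by (intro Suc.IH) auto
    finally show "mat_op k (A * (?T t * X (s + 1 - t))) = mat_op k A * (fps_nth (?x ^ m) (t - 1) * fps_nth ?x (s - t))"
      using t by (simp add: mult.assoc Suc_diff_le)
  qed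
  also have "\<dots> = mat_op k A * (\<Sum>t\<in>{0..s - 1}. fps_nth (?x ^ m) t * fps_nth ?x (s - 1 - t))"
    unfolding sum_distrib_left
    by (rule sum.reindex_bij_witness[where i = Suc and j = "\<lambda>t. t - 1"]) (use Suc.prems in auto)
  also have "(\<Sum>t\<in>{0..s - 1}. fps_nth (?x ^ m) t * fps_nth ?x (s - 1 - t)) = fps_nth (?x ^ Suc m) (s - 1)"
    unfolding power_Suc2 fps_mult_nth ..
  finally show ?case by simp
qed

lemma toeplitz_pow_1:
  assumes "X 1 \<in> carrier_mat k k"
  shows "toeplitz_pow k X m 1 = X 1 ^\<^sub>m m"
proof (induction m)
  case (Suc m)
  have "toeplitz_pow k X (Suc m) 1 = toeplitz_pow k X m 1 * X 1"
    using assms carrier_matD[OF toeplitz_pow_carrier, of k X m 1] by (intro eq_matI) (auto simp: conv_def)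
  then show ?case using Suc by simp
qed (use assms in auto)

text \<open>
  Here \<open>X (a + 2)\<close> and \<open>X (s - 1 - b)\<close> are the first and the last letter of a word that differ from
  \<open>X 1\<close>, and the power in the middle collects the words of length \<open>\<nu>\<close> between them.
\<close>

lemma row_toeplitz_column:
  assumes X: "\<And>t. 1 \<le> t \<Longrightarrow> t < s \<Longrightarrow> X t \<in> carrier_mat k k"
  shows "block_mat 1 (s - 2) k k (\<lambda>a b. X (b + 2)) * block_toeplitz k (s - 2) X ^\<^sub>m \<nu> *
      block_mat (s - 2) 1 k k (\<lambda>a b. X (s - 1 - a)) =
    mat_sum k k (\<lambda>b. mat_sum k k (\<lambda>a. if a \<le> b then X (a + 2) * toeplitz_pow k X \<nu> (b - a + 1) * X (s - 1 - b)
      else 0\<^sub>m k k) {..<s - 2}) {..<s - 2}"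
proof -
  let ?T = "toeplitz_pow k X \<nu>"
  let ?F = "\<lambda>a b. if a \<le> b then ?T (b - a + 1) else 0\<^sub>m k k"
  have Tp: "block_toeplitz k (s - 2) X ^\<^sub>m \<nu> = block_mat (s - 2) (s - 2) k k ?F"
    using X by (subst block_toeplitz_pow) (auto simp: block_toeplitz_def)
  have c: "X (b + 2) \<in> carrier_mat k k" "X (s - 1 - b) \<in> carrier_mat k k" if "b < s - 2" for b
    using X that by auto
  have "block_mat 1 (s - 2) k k (\<lambda>a b. X (b + 2)) * block_mat (s - 2) (s - 2) k k ?F *
      block_mat (s - 2) 1 k k (\<lambda>a b. X (s - 1 - a)) =
    block_mat 1 1 k k (\<lambda>_ _. mat_sum k k (\<lambda>b. mat_sum k k (\<lambda>a. X (a + 2) * ?F a b) {..<s - 2} * X (s - 1 - b)) {..<s - 2})"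
    using c by (subst block_mat_mult; (subst block_mat_mult)?) auto
  also have "\<dots> = mat_sum k k (\<lambda>b. mat_sum k k (\<lambda>a. X (a + 2) * ?F a b) {..<s - 2} * X (s - 1 - b)) {..<s - 2}"
    using block_mat_index[of 0 1 _ k 0 1 _ k] by (intro eq_matI) (auto simp del: mat_sum_index)
  also have "\<dots> = mat_sum k k (\<lambda>b. mat_sum k k (\<lambda>a. if a \<le> b then X (a + 2) * ?T (b - a + 1) * X (s - 1 - b)
      else 0\<^sub>m k k) {..<s - 2}) {..<s - 2}"
  proof (rule mat_sum_cong)
    fix b assume b: "b \<in> {..<s - 2}"
    have "mat_sum k k (\<lambda>a. X (a + 2) * ?F a b) {..<s - 2} * X (s - 1 - b) =
        mat_sum k k (\<lambda>a. X (a + 2) * ?F a b * X (s - 1 - b)) {..<s - 2}"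
      using c b by (intro mat_sum_mult) (auto intro!: square_mult_carrier)
    also have "\<dots> = mat_sum k k (\<lambda>a. if a \<le> b then X (a + 2) * ?T (b - a + 1) * X (s - 1 - b)
      else 0\<^sub>m k k) {..<s - 2}"
    proof (rule mat_sum_cong)
      fix a assume a: "a \<in> {..<s - 2}"
      show "X (a + 2) * ?F a b * X (s - 1 - b) = (if a \<le> b then X (a + 2) * ?T (b - a + 1) * X (s - 1 - b) else 0\<^sub>m k k)"
        using c[of a] c[of b] a b by (simp add: right_mult_zero_mat[of _ k k k] left_mult_zero_mat[of _ k k k])
    qed
    finally show "mat_sum k k (\<lambda>a. X (a + 2) * ?F a b) {..<s - 2} * X (s - 1 - b) =
      mat_sum k k (\<lambda>a. if a \<le> b then X (a + 2) * ?T (b - a + 1) * X (s - 1 - b) else 0\<^sub>m k k) {..<s - 2}" .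
  qed
  finally show ?thesis unfolding Tp .
qed

text \<open>
  The expansion of a power of a series, carried back to matrices.  A factor \<open>1\<^sub>m k\<close> on the left does
  not change a matrix and provides the \<open>A\<close> of \<open>mat_op_toeplitz_pow\<close>.
\<close>

lemma toeplitz_pow_expansion:
  assumes X: "\<And>t. 1 \<le> t \<Longrightarrow> t \<le> s \<Longrightarrow> X t \<in> carrier_mat k k" and s: "s \<ge> 2"
  defines "M \<equiv> \<lambda>\<nu>. block_mat 1 (s - 2) k k (\<lambda>a b. X (b + 2)) * block_toeplitz k (s - 2) X ^\<^sub>m \<nu> *
      block_mat (s - 2) 1 k k (\<lambda>a b. X (s - 1 - a))"
  shows "toeplitz_pow k X m s =
    mat_sum k k (\<lambda>i. X 1 ^\<^sub>m (m - 1 - i) * X s * X 1 ^\<^sub>m i) {..<m} +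
    mat_sum k k (\<lambda>i. mat_sum k k (\<lambda>\<nu>. X 1 ^\<^sub>m (m - i - 2 - \<nu>) * M \<nu> * X 1 ^\<^sub>m i) {..<m - 1 - i}) {..<m}"
    (is "_ = ?A + ?B")
proof -
  define x where "x = Abs_fps (\<lambda>t. mat_op k (X (Suc t)))"
  define u where "u = x - fps_const (fps_nth x 0)"
  let ?P = "mat_op k (1\<^sub>m k)"
  have X1: "X 1 \<in> carrier_mat k k" and Xs: "X s \<in> carrier_mat k k" using X s by auto
  have M_eq: "M \<nu> = mat_sum k k (\<lambda>b. mat_sum k k (\<lambda>a. if a \<le> b then X (a + 2) * toeplitz_pow k X \<nu> (b - a + 1) * X (s - 1 - b)
      else 0\<^sub>m k k) {..<s - 2}) {..<s - 2}" for \<nu>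
    unfolding M_def using X by (intro row_toeplitz_column) auto
  have Mc: "M \<nu> \<in> carrier_mat k k" for \<nu> unfolding M_eq by simp
  have x0: "fps_nth x 0 = mat_op k (X 1)" by (simp add: x_def)
  have u_nth: "fps_nth u 0 = 0" "fps_nth u (Suc t) = mat_op k (X (t + 2))" for t
    by (simp_all add: u_def x_def)
  have M_op: "mat_op k (M \<nu>) = fps_nth (u * x ^ \<nu> * u) (s - 1)" for \<nu>
  proof -
    have "mat_op k (M \<nu>) = (\<Sum>b<s - 2. \<Sum>a<s - 2. mat_op k (if a \<le> b
        then X (a + 2) * toeplitz_pow k X \<nu> (b - a + 1) * X (s - 1 - b) else 0\<^sub>m k k))"
      unfolding M_eq using X
      by (subst mat_op_sum, simp, intro sum.cong refl, subst mat_op_sum) (auto intro!: square_mult_carrier)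
    also have "\<dots> = (\<Sum>b<s - 2. \<Sum>a<s - 2. if a \<le> b
        then fps_nth u (Suc a) * fps_nth (x ^ \<nu>) (b - a) * fps_nth u (s - 2 - b) else 0)"
    proof (intro sum.cong refl)
      fix a b assume ab: "b \<in> {..<s - 2}" "a \<in> {..<s - 2}"
      have c: "X (a + 2) \<in> carrier_mat k k" "X (s - 1 - b) \<in> carrier_mat k k" using X ab by auto
      have "Suc (s - 3 - b) = s - 2 - b" "s - 3 - b + 2 = s - 1 - b" using ab by auto
      then have ub: "fps_nth u (s - 2 - b) = mat_op k (X (s - 1 - b))" using u_nth(2)[of "s - 3 - b"] by simp
      have "mat_op k (X (a + 2) * toeplitz_pow k X \<nu> (b - a + 1) * X (s - 1 - b)) =
          mat_op k (X (a + 2)) * fps_nth (x ^ \<nu>) (b - a) * mat_op k (X (s - 1 - b))"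
        using mat_op_mult[OF square_mult_carrier[OF c(1) toeplitz_pow_carrier] c(2)]
          mat_op_toeplitz_pow[OF c(1), of "b - a + 1" X \<nu>] X ab by (simp add: x_def)
      then show "mat_op k (if a \<le> b then X (a + 2) * toeplitz_pow k X \<nu> (b - a + 1) * X (s - 1 - b) else 0\<^sub>m k k) =
        (if a \<le> b then fps_nth u (Suc a) * fps_nth (x ^ \<nu>) (b - a) * fps_nth u (s - 2 - b) else 0)"
        using ub u_nth(2)[of a] by (simp add: mat_op_0)
    qed
    also have "\<dots> = fps_nth (u * x ^ \<nu> * u) (s - 1)"
    proof -
      have e: "s - 1 - 1 = s - 2" by simp
      show ?thesis unfolding fps_middle_coeff[OF u_nth(1), of "x ^ \<nu>" "s - 1"] e ..
    qed
    finally show ?thesis .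
  qed
  have sandwich: "mat_op k (X 1 ^\<^sub>m e * N * X 1 ^\<^sub>m i) = ?P * (fps_nth x 0 ^ e * mat_op k N * fps_nth x 0 ^ i)"
    if N: "N \<in> carrier_mat k k" for e i N
  proof -
    have "mat_op k (X 1 ^\<^sub>m e * N * X 1 ^\<^sub>m i) = mat_op k (1\<^sub>m k * X 1 ^\<^sub>m e * N) * mat_op k (X 1) ^ i"
      using mat_op_mult_pow[OF _ X1, of "X 1 ^\<^sub>m e * N" i] X1 N by simp
    also have "mat_op k (1\<^sub>m k * X 1 ^\<^sub>m e * N) = ?P * mat_op k (X 1) ^ e * mat_op k N"
      using mat_op_mult[OF square_mult_carrier[OF one_carrier_mat pow_carrier_mat[OF X1]] N]
        mat_op_mult_pow[OF one_carrier_mat X1] by simp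
    finally show ?thesis by (simp add: x0 mult.assoc)
  qed
  have "mat_op k (toeplitz_pow k X m s) = mat_op k (1\<^sub>m k * toeplitz_pow k X m s)"
    by (simp only: left_mult_one_mat[OF toeplitz_pow_carrier])
  also have "\<dots> = ?P * fps_nth (x ^ m) (s - 1)"
    unfolding x_def using X s by (intro mat_op_toeplitz_pow) auto
  also have "\<dots> = (\<Sum>i<m. ?P * (fps_nth x 0 ^ (m - 1 - i) * mat_op k (X s) * fps_nth x 0 ^ i)) +
    (\<Sum>i<m. \<Sum>\<nu><m - 1 - i. ?P * (fps_nth x 0 ^ (m - i - 2 - \<nu>) * mat_op k (M \<nu>) * fps_nth x 0 ^ i))"
  proof -
    have xs: "fps_nth x (s - 1) = mat_op k (X s)" using s by (simp add: x_def)
    have "fps_nth (x ^ m) (s - 1) = (\<Sum>i<m. fps_nth x 0 ^ (m - 1 - i) * mat_op k (X s) * fps_nth x 0 ^ i) +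
      (\<Sum>i<m. \<Sum>\<nu><m - 1 - i. fps_nth x 0 ^ (m - i - 2 - \<nu>) * mat_op k (M \<nu>) * fps_nth x 0 ^ i)"
      using fps_power_coeff[of "s - 1" x m] s unfolding u_def[symmetric] M_op xs by simp
    then show ?thesis by (simp only: distrib_left sum_distrib_left)
  qed
  also have "\<dots> = mat_op k (?A + ?B)"
    using X1 Xs Mc by (simp add: mat_op_add mat_op_sum sandwich square_mult_carrier[of _ k] del: One_nat_def)
  finally show ?thesis
    using mat_op_inject[OF toeplitz_pow_carrier, of "?A + ?B"] by simp
qed

lemma poly_mat_block_toeplitz:
  assumes X: "\<And>s. 1 \<le> s \<Longrightarrow> s \<le> d \<Longrightarrow> X s \<in> carrier_mat k k"
  shows "poly_mat q (block_toeplitz k d X) =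
    block_toeplitz k d (\<lambda>s. mat_sum k k (\<lambda>m. coeff q m \<cdot>\<^sub>m toeplitz_pow k X m s) {0..degree q})"
  unfolding block_toeplitz_def[of k d "\<lambda>s. mat_sum k k (\<lambda>m. coeff q m \<cdot>\<^sub>m toeplitz_pow k X m s) {0..degree q}"]
proof (rule block_mat_eqI)
  fix a i b j assume *: "a < d" "i < k" "b < d" "j < k"
  have "poly_mat q (block_toeplitz k d X) $$ (a * k + i, b * k + j) =
    (\<Sum>m\<le>degree q. coeff q m * block_toeplitz k d (toeplitz_pow k X m) $$ (a * k + i, b * k + j))"
    using * by (subst poly_mat_index[OF block_toeplitz_carrier _ _ order.refl])
      (auto simp: block_index_less block_toeplitz_pow[OF X])
  also have "\<dots> = (\<Sum>m\<le>degree q. coeff q m * (if a \<le> b then toeplitz_pow k X m (b - a + 1) $$ (i, j) else 0))"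
    using * by (intro sum.cong refl) (simp add: block_toeplitz_def block_mat_index)
  also have "\<dots> = (if a \<le> b then mat_sum k k (\<lambda>m. coeff q m \<cdot>\<^sub>m toeplitz_pow k X m (b - a + 1)) {0..degree q}
      else 0\<^sub>m k k) $$ (i, j)"
    using * carrier_matD[OF toeplitz_pow_carrier] by (auto simp: atMost_atLeast0)
  finally show "poly_mat q (block_toeplitz k d X) $$ (a * k + i, b * k + j) =
     (if a \<le> b then mat_sum k k (\<lambda>m. coeff q m \<cdot>\<^sub>m toeplitz_pow k X m (b - a + 1)) {0..degree q}
      else 0\<^sub>m k k) $$ (i, j)" .
qed (rule poly_mat_carrier[OF block_toeplitz_carrier])

lemma poly_toeplitz_coeff_1:
  assumes X1: "X 1 \<in> carrier_mat k k"
  shows "mat_sum k k (\<lambda>m. coeff p m \<cdot>\<^sub>m toeplitz_pow k X m 1) {0..degree p} = poly_mat p (X 1)"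
  using X1 toeplitz_pow_1[of X k, OF X1] by (simp add: poly_mat_def carrier_matD)

text \<open>
  The words of length \<open>m < 2\<close> contribute nothing to \<^const>\<open>Es_rhs\<close>, which accounts for the
  different summation ranges.
\<close>

lemma poly_toeplitz_coeff:
  assumes X: "\<And>t. 1 \<le> t \<Longrightarrow> t \<le> s \<Longrightarrow> X t \<in> carrier_mat k k" and s: "s \<ge> 2"
  shows "mat_sum k k (\<lambda>m. coeff p m \<cdot>\<^sub>m toeplitz_pow k X m s) {0..degree p} =
    diff_op p (X 1) (X s) + Es_rhs k p X s"
proof (rule eq_matI)
  let ?R = "block_mat 1 (s - 2) k k (\<lambda>a b. X (b + 2))"
  let ?T = "block_toeplitz k (s - 2) X"
  let ?L = "block_mat (s - 2) 1 k k (\<lambda>a b. X (s - 1 - a))"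
  have X1: "X 1 \<in> carrier_mat k k" using X s by auto
  fix i j assume "i < dim_row (diff_op p (X 1) (X s) + Es_rhs k p X s)" "j < dim_col (diff_op p (X 1) (X s) + Es_rhs k p X s)"
  then have ij: "i < k" "j < k" by (auto simp: Es_rhs_def Let_def)
  let ?f = "\<lambda>m l. (X 1 ^\<^sub>m (m - 1 - l) * X s * X 1 ^\<^sub>m l) $$ (i, j)"
  let ?g = "\<lambda>m l \<nu>. (X 1 ^\<^sub>m (m - l - 2 - \<nu>) * ?R * ?T ^\<^sub>m \<nu> * ?L * X 1 ^\<^sub>m l) $$ (i, j)"
  have reassoc: "X 1 ^\<^sub>m e * (?R * ?T ^\<^sub>m \<nu> * ?L) * X 1 ^\<^sub>m l = X 1 ^\<^sub>m e * ?R * ?T ^\<^sub>m \<nu> * ?L * X 1 ^\<^sub>m l" for e \<nu> l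
  proof -
    let ?E = "X 1 ^\<^sub>m e" and ?N = "?T ^\<^sub>m \<nu>" and ?h = "(s - 2) * k"
    have c: "?E \<in> carrier_mat k k" "?R \<in> carrier_mat k ?h" "?N \<in> carrier_mat ?h ?h" "?L \<in> carrier_mat ?h k"
      using X1 block_mat_carrier[of 1 "s - 2" k k] block_mat_carrier[of "s - 2" 1 k k] pow_carrier_mat[OF block_toeplitz_carrier]
      by auto
    have "?E * (?R * ?N * ?L) = ?E * (?R * ?N) * ?L"
      using assoc_mult_mat[OF c(1) mult_carrier_mat[OF c(2,3)] c(4)] by simp
    also have "?E * (?R * ?N) = ?E * ?R * ?N"
      using assoc_mult_mat[OF c(1,2,3)] by simp
    finally show ?thesis by simp
  qed
  have pw: "toeplitz_pow k X m s $$ (i, j) = (\<Sum>l<m. ?f m l) + (\<Sum>l<m. \<Sum>\<nu><m - 1 - l. ?g m l \<nu>)" for m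
    using toeplitz_pow_expansion[of s X k m, OF X s, unfolded reassoc] ij by simp
  have Lf: "(\<Sum>l<m. ?f m l) = (\<Sum>l = 0..m - 1. ?f m l)" if "m \<ge> 1" for m
    using that by (intro sum.cong) auto
  have Lg: "(\<Sum>l<m. \<Sum>\<nu><m - 1 - l. ?g m l \<nu>) = (\<Sum>l = 0..m - 2. \<Sum>\<nu> = 0..m - l - 2. ?g m l \<nu>)" if m: "m \<ge> 2" for m
  proof -
    have "(\<Sum>l<m. \<Sum>\<nu><m - 1 - l. ?g m l \<nu>) = (\<Sum>l\<in>{0..m - 2}. \<Sum>\<nu><m - 1 - l. ?g m l \<nu>)"
      using m by (intro sum.mono_neutral_right) auto
    also have "\<dots> = (\<Sum>l = 0..m - 2. \<Sum>\<nu> = 0..m - l - 2. ?g m l \<nu>)"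
      using m by (intro sum.cong refl) auto
    finally show ?thesis .
  qed
  have "mat_sum k k (\<lambda>m. coeff p m \<cdot>\<^sub>m toeplitz_pow k X m s) {0..degree p} $$ (i, j) =
    (\<Sum>m = 0..degree p. coeff p m * (\<Sum>l<m. ?f m l)) + (\<Sum>m = 0..degree p. coeff p m * (\<Sum>l<m. \<Sum>\<nu><m - 1 - l. ?g m l \<nu>))"
    using ij carrier_matD[OF toeplitz_pow_carrier] by (simp add: pw distrib_left sum.distrib)
  also have "(\<Sum>m = 0..degree p. coeff p m * (\<Sum>l<m. ?f m l)) = (\<Sum>m = 1..degree p. coeff p m * (\<Sum>l = 0..m - 1. ?f m l))"
  proof -
    have "(\<Sum>m = 0..degree p. coeff p m * (\<Sum>l<m. ?f m l)) = (\<Sum>m = 1..degree p. coeff p m * (\<Sum>l<m. ?f m l))"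
      by (intro sum.mono_neutral_right) (auto simp: Suc_le_eq)
    then show ?thesis using Lf by simp
  qed
  also have "\<dots> = diff_op p (X 1) (X s) $$ (i, j)"
    using diff_op_index[OF X1 ij] by simp
  also have "(\<Sum>m = 0..degree p. coeff p m * (\<Sum>l<m. \<Sum>\<nu><m - 1 - l. ?g m l \<nu>)) =
    (\<Sum>m = 2..degree p. coeff p m * (\<Sum>l = 0..m - 2. \<Sum>\<nu> = 0..m - l - 2. ?g m l \<nu>))"
  proof -
    have "(\<Sum>m = 0..degree p. coeff p m * (\<Sum>l<m. \<Sum>\<nu><m - 1 - l. ?g m l \<nu>)) =
        (\<Sum>m = 2..degree p. coeff p m * (\<Sum>l<m. \<Sum>\<nu><m - 1 - l. ?g m l \<nu>))"
    proof (rule sum.mono_neutral_right)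
      show "\<forall>m\<in>{0..degree p} - {2..degree p}. coeff p m * (\<Sum>l<m. \<Sum>\<nu><m - 1 - l. ?g m l \<nu>) = 0"
      proof
        fix m assume "m \<in> {0..degree p} - {2..degree p}"
        then have "m - 1 - l = 0" for l by auto
        then show "coeff p m * (\<Sum>l<m. \<Sum>\<nu><m - 1 - l. ?g m l \<nu>) = 0" by simp
      qed
    qed auto
    then show ?thesis using Lg by simp
  qed
  also have "\<dots> = Es_rhs k p X s $$ (i, j)"
    using ij by (simp add: Es_rhs_def Let_def)
  finally show "mat_sum k k (\<lambda>m. coeff p m \<cdot>\<^sub>m toeplitz_pow k X m s) {0..degree p} $$ (i, j) =
    (diff_op p (X 1) (X s) + Es_rhs k p X s) $$ (i, j)"
    using ij by (simp add: Es_rhs_def Let_def)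
qed (auto simp: Es_rhs_def Let_def)

section \<open>Polynomials in a companion-Jordan block\<close>

lemma companion_jordan_eq_toeplitz:
  "companion_jordan g d = block_toeplitz (degree g) d
    (\<lambda>s. if s = 1 then companion g else if s = 2 then 1\<^sub>m (degree g) else 0\<^sub>m (degree g) (degree g))"
  unfolding companion_jordan_def block_toeplitz_def Let_def by (intro block_mat_cong) auto

lemma companion_jordan_carrier [simp]:
  "companion_jordan g d \<in> carrier_mat (d * degree g) (d * degree g)"
  unfolding companion_jordan_eq_toeplitz by simp

lemma block_toeplitz_add:
  assumes X: "\<And>s. 1 \<le> s \<Longrightarrow> s \<le> d \<Longrightarrow> X s \<in> carrier_mat k k"
    and Y: "\<And>s. 1 \<le> s \<Longrightarrow> s \<le> d \<Longrightarrow> Y s \<in> carrier_mat k k"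
  shows "block_toeplitz k d X + block_toeplitz k d Y = block_toeplitz k d (\<lambda>s. X s + Y s)"
  unfolding block_toeplitz_def
proof (rule block_mat_eqI)
  fix a i b j assume *: "a < d" "i < k" "b < d" "j < k"
  let ?s = "b - a + 1"
  have "X ?s \<in> carrier_mat k k" "Y ?s \<in> carrier_mat k k" using X Y * by auto
  then show "(block_mat d d k k (\<lambda>a b. if a \<le> b then X (b - a + 1) else 0\<^sub>m k k) +
      block_mat d d k k (\<lambda>a b. if a \<le> b then Y (b - a + 1) else 0\<^sub>m k k)) $$ (a * k + i, b * k + j) =
    (if a \<le> b then X (b - a + 1) + Y (b - a + 1) else 0\<^sub>m k k) $$ (i, j)"
    using * by (auto simp: block_mat_index block_index_less)
qed simp

lemma block_toeplitz_smult:
  assumes X: "\<And>s. 1 \<le> s \<Longrightarrow> s \<le> d \<Longrightarrow> X s \<in> carrier_mat k k"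
  shows "c \<cdot>\<^sub>m block_toeplitz k d X = block_toeplitz k d (\<lambda>s. c \<cdot>\<^sub>m X s)"
  unfolding block_toeplitz_def
proof (rule block_mat_eqI)
  fix a i b j assume *: "a < d" "i < k" "b < d" "j < k"
  let ?s = "b - a + 1"
  have "X ?s \<in> carrier_mat k k" using X * by auto
  then show "(c \<cdot>\<^sub>m block_mat d d k k (\<lambda>a b. if a \<le> b then X (b - a + 1) else 0\<^sub>m k k)) $$ (a * k + i, b * k + j) =
    (if a \<le> b then c \<cdot>\<^sub>m X (b - a + 1) else 0\<^sub>m k k) $$ (i, j)"
    using * by (auto simp: block_mat_index block_index_less)
qed simp

lemma one_smult_mat: "1 \<cdot>\<^sub>m (A :: complex mat) = A"
  by auto

lemma higher_pderiv_pCons: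
  fixes q :: "complex poly"
  shows "(pderiv ^^ Suc n) (pCons a q) = pCons 0 ((pderiv ^^ Suc n) q) + Polynomial.smult (of_nat (Suc n)) ((pderiv ^^ n) q)"
proof (induction n)
  case 0
  show ?case by (simp add: pderiv_pCons add.commute)
next
  case (Suc n)
  have "(pderiv ^^ Suc (Suc n)) (pCons a q) = pderiv ((pderiv ^^ Suc n) (pCons a q))" by simp
  also have "\<dots> = (pderiv ^^ Suc n) q + pCons 0 ((pderiv ^^ Suc (Suc n)) q) +
      Polynomial.smult (of_nat (Suc n)) ((pderiv ^^ Suc n) q)"
    unfolding Suc by (simp add: pderiv_add pderiv_pCons pderiv_smult del: of_nat_Suc)
  also have "\<dots> = pCons 0 ((pderiv ^^ Suc (Suc n)) q) + Polynomial.smult (of_nat (Suc (Suc n))) ((pderiv ^^ Suc n) q)"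
    by (simp only: of_nat_Suc[of "Suc n"] smult_add_left smult_1_left ac_simps)
  finally show ?case .
qed

text \<open>Taylor's formula: the block shift commutes with the diagonal part and is nilpotent.\<close>

lemma poly_mat_companion_jordan:
  "poly_mat q (companion_jordan g d) = block_toeplitz (degree g) d
    (\<lambda>s. inverse (fact (s - 1)) \<cdot>\<^sub>m poly_mat ((pderiv ^^ (s - 1)) q) (companion g))"
proof (induction q)
  case 0
  have "(pderiv ^^ m) 0 = (0 :: complex poly)" for m by (induction m) auto
  then have "block_toeplitz (degree g) d (\<lambda>s. inverse (fact (s - 1)) \<cdot>\<^sub>m poly_mat ((pderiv ^^ (s - 1)) 0) (companion g)) =
      0\<^sub>m (d * degree g) (d * degree g)"
    unfolding block_toeplitz_def
    by (intro block_mat_eqI[symmetric]) (auto simp: poly_mat_0[OF companion_carrier] block_index_less)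
  then show ?case using poly_mat_0[OF companion_jordan_carrier] by simp
next
  case (pCons a q)
  let ?k = "degree g" and ?C = "companion g"
  let ?D = "\<lambda>q s. inverse (fact (s - 1)) \<cdot>\<^sub>m poly_mat ((pderiv ^^ (s - 1)) q) ?C"
  let ?J = "\<lambda>s. if s = 1 then ?C else if s = 2 then 1\<^sub>m ?k else 0\<^sub>m ?k ?k"
  let ?I = "\<lambda>s. if s = 1 then 1\<^sub>m ?k else 0\<^sub>m ?k ?k"
  have Dc: "?D q s \<in> carrier_mat ?k ?k" for q s by simp
  have "poly_mat (pCons a q) (companion_jordan g d) =
      a \<cdot>\<^sub>m block_toeplitz ?k d ?I + block_toeplitz ?k d ?J * block_toeplitz ?k d (?D q)"
    unfolding poly_mat_pCons[OF companion_jordan_carrier] pCons(2) block_toeplitz_one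
    unfolding companion_jordan_eq_toeplitz ..
  also have "block_toeplitz ?k d ?J * block_toeplitz ?k d (?D q) = block_toeplitz ?k d (conv ?k ?J (?D q))"
    by (rule block_toeplitz_mult) auto
  also have "a \<cdot>\<^sub>m block_toeplitz ?k d ?I + \<dots> = block_toeplitz ?k d (\<lambda>s. a \<cdot>\<^sub>m ?I s + conv ?k ?J (?D q) s)"
    by (subst block_toeplitz_smult, simp, subst block_toeplitz_add) auto
  also have "\<dots> = block_toeplitz ?k d (?D (pCons a q))"
  proof (rule block_toeplitz_cong)
    fix s :: nat assume s: "1 \<le> s" "s \<le> d"
    show "a \<cdot>\<^sub>m ?I s + conv ?k ?J (?D q) s = ?D (pCons a q) s"
    proof (cases "s = 1")
      case True
      have "conv ?k ?J (?D q) 1 = ?C * ?D q 1"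
        unfolding conv_def by (intro eq_matI) auto
      also have "\<dots> = ?C * poly_mat q ?C" by (simp add: one_smult_mat)
      finally have "a \<cdot>\<^sub>m ?I s + conv ?k ?J (?D q) s = poly_mat (pCons a q) ?C"
        using True by (simp add: poly_mat_pCons[OF companion_carrier])
      also have "\<dots> = ?D (pCons a q) s" using True by (simp add: one_smult_mat)
      finally show ?thesis .
    next
      case False
      then obtain m where m: "s = Suc (Suc m)" using s by (metis One_nat_def Suc_pred' not_less_eq_eq old.nat.exhaust zero_less_Suc not_one_le_zero)
      have "conv ?k ?J (?D q) s = ?C * ?D q s + ?D q (s - 1)"
      proof (rule eq_matI)
        fix i j assume "i < dim_row (?C * ?D q s + ?D q (s - 1))" "j < dim_col (?C * ?D q s + ?D q (s - 1))"
        then have ij: "i < ?k" "j < ?k" by auto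
        have "conv ?k ?J (?D q) s $$ (i, j) = (\<Sum>t\<in>{1..s}. (?J t * ?D q (s + 1 - t)) $$ (i, j))"
          using ij by (simp add: conv_def)
        also have "\<dots> = (\<Sum>t\<in>{1, 2}. (?J t * ?D q (s + 1 - t)) $$ (i, j))"
        proof (rule sum.mono_neutral_right)
          show "\<forall>t\<in>{1..s} - {1, 2}. (?J t * ?D q (s + 1 - t)) $$ (i, j) = 0"
            using ij by (auto simp: left_mult_zero_mat[of _ ?k ?k])
        qed (use m in auto)
        also have "\<dots> = (?C * ?D q s) $$ (i, j) + (1\<^sub>m ?k * ?D q (s - 1)) $$ (i, j)"
          using m by simp
        also have "\<dots> = (?C * ?D q s + ?D q (s - 1)) $$ (i, j)"
          using ij m by (simp add: left_mult_one_mat[of _ ?k ?k])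
        finally show "conv ?k ?J (?D q) s $$ (i, j) = (?C * ?D q s + ?D q (s - 1)) $$ (i, j)" .
      qed (simp_all add: conv_def)
      then have "a \<cdot>\<^sub>m ?I s + conv ?k ?J (?D q) s = ?C * ?D q s + ?D q (s - 1)"
        using m by (intro eq_matI) (auto simp: conv_def)
      also have "\<dots> = inverse (fact (s - 1)) \<cdot>\<^sub>m (?C * poly_mat ((pderiv ^^ (s - 1)) q) ?C +
          of_nat (s - 1) \<cdot>\<^sub>m poly_mat ((pderiv ^^ (s - 2)) q) ?C)"
      proof (rule eq_matI)
        let ?U = "poly_mat ((pderiv ^^ (s - 1)) q) ?C" and ?V = "poly_mat ((pderiv ^^ (s - 2)) q) ?C"
        let ?W = "inverse (fact (s - 1)) \<cdot>\<^sub>m (?C * ?U + of_nat (s - 1) \<cdot>\<^sub>m ?V)"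
        fix i j assume "i < dim_row ?W" "j < dim_col ?W"
        then have ij: "i < ?k" "j < ?k" by auto
        have 1: "?C * ?D q s = inverse (fact (s - 1)) \<cdot>\<^sub>m (?C * ?U)"
          by (rule mult_smult_distrib[of _ ?k ?k _ ?k]) auto
        have 2: "inverse (fact m) = inverse (fact (Suc m)) * (of_nat (Suc m) :: complex)"
          by (simp add: field_simps del: of_nat_Suc)
        show "(?C * ?D q s + ?D q (s - 1)) $$ (i, j) = ?W $$ (i, j)"
          unfolding 1 using ij m 2 by (simp add: distrib_left mult.assoc del: of_nat_Suc fact_Suc)
      qed auto
      also have "\<dots> = ?D (pCons a q) s"
      proof -
        have "poly_mat ((pderiv ^^ (s - 1)) (pCons a q)) ?C =
          poly_mat (pCons 0 ((pderiv ^^ (s - 1)) q)) ?C + of_nat (s - 1) \<cdot>\<^sub>m poly_mat ((pderiv ^^ (s - 2)) q) ?C"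
          using higher_pderiv_pCons[of m a q] m
          by (simp add: poly_mat_add[OF companion_carrier] poly_mat_smult[OF companion_carrier] del: of_nat_Suc funpow.simps)
        also have "poly_mat (pCons 0 ((pderiv ^^ (s - 1)) q)) ?C = ?C * poly_mat ((pderiv ^^ (s - 1)) q) ?C"
          unfolding poly_mat_pCons[OF companion_carrier] by (intro eq_matI) auto
        finally show ?thesis by simp
      qed
      finally show ?thesis .
    qed
  qed
  finally show ?case .
qed

text \<open>
  By induction \<open>g ^ d\<close> divides both \<open>q = g ^ d u\<close> and its derivative, whose only term not visibly
  divisible by it is \<open>d g ^ (d - 1) g' u\<close>.  So \<open>g\<close> divides \<open>g' u\<close>, hence \<open>u\<close>.
\<close>

lemma power_dvd_of_dvd_pderivs:
  fixes g q :: "complex poly"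
  assumes "coprime g (pderiv g)" "\<And>i. i < d \<Longrightarrow> g dvd (pderiv ^^ i) q"
  shows "g ^ d dvd q"
  using assms(2)
proof (induction d arbitrary: q)
  case (Suc d)
  show ?case
  proof (cases "d = 0")
    case True
    then show ?thesis using Suc.prems[of 0] by simp
  next
    case False
    have "g ^ d dvd q" using Suc by simp
    then obtain u where u: "q = g ^ d * u" by (auto elim: dvdE)
    have "g ^ d dvd pderiv q"
    proof (rule Suc.IH)
      fix i assume "i < d"
      then show "g dvd (pderiv ^^ i) (pderiv q)" using Suc.prems[of "Suc i"] by (simp add: funpow_swap1)
    qed
    moreover have "pderiv q = g ^ d * pderiv u + g ^ (d - 1) * Polynomial.smult (of_nat d) (pderiv g * u)"
      unfolding u by (simp add: pderiv_mult pderiv_power algebra_simps)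
    ultimately have "g ^ (d - 1) * g dvd g ^ (d - 1) * Polynomial.smult (of_nat d) (pderiv g * u)"
      using False by (metis dvd_add_right_iff dvd_triv_left power_minus_mult not_gr_zero)
    then have "g ^ (d - 1) = 0 \<or> g dvd Polynomial.smult (of_nat d) (pderiv g * u)"
      by (simp only: dvd_mult_cancel_left)
    then have "g = 0 \<or> g dvd Polynomial.smult (of_nat d) (pderiv g * u)" by auto
    then have "g dvd u \<or> g = 0"
      using False assms(1) by (auto simp: dvd_smult_iff coprime_dvd_mult_right_iff[OF assms(1)])
    moreover have "g \<noteq> 0 \<or> u = 0 \<or> d > 0" using False by simp
    ultimately show ?thesis using u False by (auto simp: mult.commute power_0_left)
  qed
qed simp

text \<open>
  By Taylor's formula the first row of \<open>q(C)\<close> consists of the first rows of the derivatives of \<open>q\<close> at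
  the companion matrix, up to nonzero factors.
\<close>

lemma companion_jordan_row0_eq_0_imp_dvd:
  assumes g: "monic g" "degree g > 0" "coprime g (pderiv g)"
    and row0: "\<And>t. t < d * degree g \<Longrightarrow> poly_mat q (companion_jordan g d) $$ (0, t) = 0"
  shows "g ^ d dvd q"
proof (rule power_dvd_of_dvd_pderivs[OF g(3)])
  fix b assume b: "b < d"
  show "g dvd (pderiv ^^ b) q"
  proof (rule poly_mat_companion_row0_eq_0_imp_dvd[OF g(1,2)])
    fix j assume j: "j < degree g"
    have "0 = poly_mat q (companion_jordan g d) $$ (0, b * degree g + j)"
      using row0[OF block_index_less[OF b j]] by simp
    also have "\<dots> = inverse (fact b) * poly_mat ((pderiv ^^ b) q) (companion g) $$ (0, j)"
      unfolding poly_mat_companion_jordan using b j g by (subst block_toeplitz_index0) auto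
    finally show "poly_mat ((pderiv ^^ b) q) (companion g) $$ (0, j) = 0" by simp
  qed
qed

section \<open>Block diagonal matrices\<close>

abbreviation bdiag :: "nat \<Rightarrow> (nat \<Rightarrow> complex mat) \<Rightarrow> complex mat" where
  "bdiag r F \<equiv> diag_block_mat (map F [0..<r])"

definition offset :: "(nat \<Rightarrow> nat) \<Rightarrow> nat \<Rightarrow> nat" where
  "offset h j = (\<Sum>i<j. h i)"

lemma offset_Suc [simp]: "offset h (Suc j) = offset h j + h j"
  by (simp add: offset_def)

lemma offset_less:
  assumes "j < r" "a < h j" shows "offset h j + a < offset h r"
proof -
  have "offset h (Suc j) \<le> offset h r" unfolding offset_def using assms by (intro sum_mono2) auto
  then show ?thesis using assms by simp
qed

lemma offset_decomp:
  assumes "t < offset h r" shows "\<exists>j<r. \<exists>a<h j. t = offset h j + a"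
  using assms
proof (induction r)
  case (Suc r)
  show ?case
  proof (cases "t < offset h r")
    case True
    then show ?thesis using Suc.IH less_Suc_eq by blast
  next
    case False
    then show ?thesis using Suc.prems by (intro exI[of _ r] conjI exI[of _ "t - offset h r"]) auto
  qed
qed (simp add: offset_def)

lemma bdiag_carrier:
  assumes "\<And>j. j < r \<Longrightarrow> F j \<in> carrier_mat (h j) (h j)"
  shows "bdiag r F \<in> carrier_mat (offset h r) (offset h r)"
  using assms
proof (induction r)
  case (Suc r)
  then have "bdiag r F \<in> carrier_mat (offset h r) (offset h r)" "F r \<in> carrier_mat (h r) (h r)" by auto
  then show ?case by (auto simp: diag_block_mat_last Let_def)
qed (auto simp: offset_def)

lemma bdiag_index:
  assumes "\<And>j. j < r \<Longrightarrow> F j \<in> carrier_mat (h j) (h j)"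
    and "i < r" "j < r" "a < h i" "b < h j"
  shows "bdiag r F $$ (offset h i + a, offset h j + b) = (if i = j then F i $$ (a, b) else 0)"
  using assms
proof (induction r)
  case (Suc r)
  have c: "bdiag r F \<in> carrier_mat (offset h r) (offset h r)" "F r \<in> carrier_mat (h r) (h r)"
    using Suc.prems(1) by (auto intro: bdiag_carrier)
  note dims = carrier_matD[OF c(1)] carrier_matD[OF c(2)]
  have S: "bdiag (Suc r) F = four_block_mat (bdiag r F) (0\<^sub>m (offset h r) (h r)) (0\<^sub>m (h r) (offset h r)) (F r)"
    using c by (simp add: diag_block_mat_last Let_def)
  have lt: "offset h l + x < offset h r" if "l < r" "x < h l" for l x using that by (rule offset_less)
  consider "i < r" "j < r" | "i = r" "j < r" | "i < r" "j = r" | "i = r" "j = r"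
    using Suc.prems by linarith
  then show ?case
  proof cases
    case 1
    then have "offset h i + a < offset h r" "offset h j + b < offset h r" using lt Suc.prems by auto
    then show ?thesis unfolding S using 1 Suc dims by (subst index_mat_four_block) auto
  next
    case 2
    then have "offset h j + b < offset h r" using lt Suc.prems by auto
    then show ?thesis unfolding S using 2 Suc.prems dims by (subst index_mat_four_block) auto
  next
    case 3
    then have "offset h i + a < offset h r" using lt Suc.prems by auto
    then show ?thesis unfolding S using 3 Suc.prems dims by (subst index_mat_four_block) auto
  next
    case 4
    then show ?thesis unfolding S using Suc.prems dims by (subst index_mat_four_block) auto
  qed
qed simp

lemma bdiag_eqI:
  assumes M: "M \<in> carrier_mat (offset h r) (offset h r)"
    and F: "\<And>j. j < r \<Longrightarrow> F j \<in> carrier_mat (h j) (h j)"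
    and eq: "\<And>i a j b. i < r \<Longrightarrow> a < h i \<Longrightarrow> j < r \<Longrightarrow> b < h j \<Longrightarrow>
      M $$ (offset h i + a, offset h j + b) = (if i = j then F i $$ (a, b) else 0)"
  shows "M = bdiag r F"
proof (rule eq_matI)
  note c = bdiag_carrier[OF F]
  fix s t assume "s < dim_row (bdiag r F)" "t < dim_col (bdiag r F)"
  then have st: "s < offset h r" "t < offset h r" using carrier_matD[OF c] by auto
  obtain i a where i: "i < r" "a < h i" "s = offset h i + a" using offset_decomp[OF st(1)] by blast
  obtain j b where j: "j < r" "b < h j" "t = offset h j + b" using offset_decomp[OF st(2)] by blast
  show "M $$ (s, t) = bdiag r F $$ (s, t)" unfolding i(3) j(3) using eq i j bdiag_index[of r F h, OF F] by simp
qed (use M carrier_matD[OF bdiag_carrier[of r F h, OF F]] in auto)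

lemma bdiag_inject:
  assumes F: "\<And>j. j < r \<Longrightarrow> F j \<in> carrier_mat (h j) (h j)"
    and G: "\<And>j. j < r \<Longrightarrow> G j \<in> carrier_mat (h j) (h j)"
    and eq: "bdiag r F = bdiag r G" and j: "j < r"
  shows "F j = G j"
proof (rule eq_matI)
  fix a b assume "a < dim_row (G j)" "b < dim_col (G j)"
  then have "a < h j" "b < h j" using G[OF j] by auto
  then show "F j $$ (a, b) = G j $$ (a, b)"
    using bdiag_index[of r F h j j a b, OF F] bdiag_index[of r G h j j a b, OF G] eq j by simp
qed (use F[OF j] G[OF j] in auto)

lemma poly_mat_bdiag:
  assumes F: "\<And>j. j < r \<Longrightarrow> F j \<in> carrier_mat (h j) (h j)"
  shows "poly_mat q (bdiag r F) = bdiag r (\<lambda>j. poly_mat q (F j))"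
proof (rule bdiag_eqI[where h = h])
  note c = bdiag_carrier[of r F h, OF F]
  have pw: "bdiag r F ^\<^sub>m m = bdiag r (\<lambda>j. F j ^\<^sub>m m)" for m
  proof -
    have "Ball (set (map F [0..<r])) square_mat" using F by fastforce
    then show ?thesis by (simp add: diag_block_pow_mat comp_def)
  qed
  fix i a j b assume *: "i < r" "a < h i" "j < r" "b < h j"
  have "poly_mat q (bdiag r F) $$ (offset h i + a, offset h j + b) =
      (\<Sum>m\<le>degree q. coeff q m * bdiag r (\<lambda>j. F j ^\<^sub>m m) $$ (offset h i + a, offset h j + b))"
    using * by (subst poly_mat_index[OF c _ _ order.refl]) (auto simp: pw offset_less)
  also have "\<dots> = (\<Sum>m\<le>degree q. coeff q m * (if i = j then (F i ^\<^sub>m m) $$ (a, b) else 0))"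
    using * F by (subst bdiag_index[where h = h]) (auto intro: pow_carrier_mat)
  also have "\<dots> = (if i = j then poly_mat q (F i) $$ (a, b) else 0)"
    using * poly_mat_index[OF F[of i] _ _ order.refl] by auto
  finally show "poly_mat q (bdiag r F) $$ (offset h i + a, offset h j + b) =
    (if i = j then poly_mat q (F i) $$ (a, b) else 0)" .
qed (use F bdiag_carrier[of r F h, OF F] in auto)

section \<open>The commutant of a sum of companion-Jordan blocks\<close>

lemma prod_coprime_dvd:
  fixes f :: "nat \<Rightarrow> complex poly"
  assumes "\<And>j. j < r \<Longrightarrow> f j dvd q" "\<And>i j. i < r \<Longrightarrow> j < r \<Longrightarrow> i \<noteq> j \<Longrightarrow> coprime (f i) (f j)"
  shows "(\<Prod>j<r. f j) dvd q"
  using assms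
proof (induction r)
  case (Suc r)
  have "coprime (\<Prod>j<r. f j) (f r)" by (rule prod_coprime_left) (use Suc.prems in auto)
  then show ?case using Suc by (simp add: divides_mult)
qed simp

lemma number_field_UNIV: "number_field UNIV"
proof (rule number_field.intro)
  show "subfield UNIV (class_ring :: complex ring)"
    using field.carrier_is_subfield[OF class_field] by (simp add: class_ring_simps)
qed

locale companion_blocks =
  fixes g :: "nat \<Rightarrow> complex poly" and d :: "nat \<Rightarrow> nat" and r :: nat
  assumes monic: "\<And>j. j < r \<Longrightarrow> monic (g j)"
    and degree_pos: "\<And>j. j < r \<Longrightarrow> degree (g j) > 0"
    and separable: "\<And>j. j < r \<Longrightarrow> coprime (g j) (pderiv (g j))"
    and coprime: "\<And>i j. i < r \<Longrightarrow> j < r \<Longrightarrow> i \<noteq> j \<Longrightarrow> coprime (g i) (g j)"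
    and d_pos: "\<And>j. j < r \<Longrightarrow> d j \<ge> 1"
begin

abbreviation "h j \<equiv> d j * degree (g j)"
abbreviation "size_B \<equiv> offset h r"
abbreviation "B \<equiv> bdiag r (\<lambda>j. companion_jordan (g j) (d j))"

lemma B_carrier: "B \<in> carrier_mat size_B size_B"
  by (rule bdiag_carrier) simp

lemma degree_prod_blocks: "degree (\<Prod>j<r. g j ^ d j) = size_B"
proof -
  have nz: "g j \<noteq> 0" if "j < r" for j using degree_pos[OF that] by force
  have "degree (\<Prod>j<r. g j ^ d j) = (\<Sum>j<r. degree (g j ^ d j))"
    by (rule degree_prod_eq_sum_degree) (use nz in auto)
  also have "\<dots> = size_B" unfolding offset_def
    by (intro sum.cong refl) (use nz in \<open>simp add: degree_power_eq\<close>)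
  finally show ?thesis .
qed

text \<open>
  The entries of \<open>w M\<close> for the row vector \<open>w\<close> that has a 1 at the first index of each block and is
  zero elsewhere.
\<close>

definition row_sum :: "complex mat \<Rightarrow> nat \<Rightarrow> complex" where
  "row_sum M t = (\<Sum>j<r. M $$ (offset h j, t))"

lemma offset_lt: "j < r \<Longrightarrow> offset h j < size_B"
  using offset_less[of j r 0 h] degree_pos d_pos[of j] by simp

lemma row_sum_mult:
  assumes "M \<in> carrier_mat size_B size_B" "N \<in> carrier_mat size_B size_B" "t < size_B"
  shows "row_sum (M * N) t = (\<Sum>u<size_B. row_sum M u * N $$ (u, t))"
proof -
  have "row_sum (M * N) t = (\<Sum>j<r. \<Sum>u<size_B. M $$ (offset h j, u) * N $$ (u, t))"
    unfolding row_sum_def using assms offset_lt by (intro sum.cong refl mult_index) auto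
  then show ?thesis by (subst (asm) sum.swap) (simp add: row_sum_def sum_distrib_right)
qed

lemma row_sum_poly_eq_0_imp_dvd:
  assumes "\<And>t. t < size_B \<Longrightarrow> row_sum (poly_mat q B) t = 0"
  shows "(\<Prod>j<r. g j ^ d j) dvd q"
proof (rule prod_coprime_dvd)
  fix j assume j: "j < r"
  show "g j ^ d j dvd q"
  proof (rule companion_jordan_row0_eq_0_imp_dvd[OF monic[OF j] degree_pos[OF j] separable[OF j]])
    fix t assume t: "t < h j"
    have "0 = row_sum (poly_mat q B) (offset h j + t)" using assms offset_less[OF j, of t h] t by simp
    also have "\<dots> = (\<Sum>i<r. if i = j then poly_mat q (companion_jordan (g i) (d i)) $$ (0, t) else 0)"
      unfolding row_sum_def
    proof (intro sum.cong refl)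
      fix i assume i: "i \<in> {..<r}"
      have pB: "poly_mat q B = bdiag r (\<lambda>l. poly_mat q (companion_jordan (g l) (d l)))"
        by (rule poly_mat_bdiag[where h = h]) simp
      have "0 < h i" using i degree_pos d_pos[of i] by simp
      then show "poly_mat q B $$ (offset h i, offset h j + t) =
        (if i = j then poly_mat q (companion_jordan (g i) (d i)) $$ (0, t) else 0)"
        using bdiag_index[of r "\<lambda>l. poly_mat q (companion_jordan (g l) (d l))" h i j 0 t] i j t
        unfolding pB by (simp add: poly_mat_carrier[OF companion_jordan_carrier])
    qed
    also have "\<dots> = poly_mat q (companion_jordan (g j) (d j)) $$ (0, t)" using j by simp
    finally show "poly_mat q (companion_jordan (g j) (d j)) $$ (0, t) = 0" by simp
  qed
qed (use coprime in auto)

text \<open>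
  As \<open>w\<close> is annihilated only by multiples of a polynomial whose degree is the size of \<open>B\<close>, the
  vectors \<open>w B ^ i\<close> with \<open>i\<close> below that degree form a basis.  So \<open>w X = w q(B)\<close> for some \<open>q\<close>, and then \<open>X\<close> and \<open>q(B)\<close> agree on all
  \<open>w B ^ i\<close> since both commute with \<open>B\<close>.
\<close>

theorem commutant_eq_polys:
  assumes X: "X \<in> carrier_mat size_B size_B" and XB: "X * B = B * X"
  shows "\<exists>q. X = poly_mat q B"
proof -
  interpret U: number_field UNIV by (rule number_field_UNIV)
  \<comment> \<open>the columns of \<open>K\<close> are the vectors \<open>w B ^ i\<close>\<close>
  define K where "K = mat size_B size_B (\<lambda>(t, i). row_sum (B ^\<^sub>m i) t)"
  have K: "K \<in> carrier_mat size_B size_B" by (simp add: K_def)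
  define P where "P v = (\<Sum>i<size_B. monom (v $ i) i)" for v :: "complex vec"
  have coeff_P: "coeff (P v) i = (if i < size_B then v $ i else 0)" for v i
    unfolding P_def coeff_sum by simp
  have row_P: "row_sum (poly_mat (P v) B) t = (K *\<^sub>v v) $ t" if v: "v \<in> carrier_vec size_B" and t: "t < size_B" for v t
  proof -
    have dP: "degree (P v) \<le> size_B - 1" by (rule degree_le) (use coeff_P in auto)
    have "row_sum (poly_mat (P v) B) t = (\<Sum>j<r. \<Sum>i\<le>size_B - 1. coeff (P v) i * (B ^\<^sub>m i) $$ (offset h j, t))"
      unfolding row_sum_def using t offset_lt by (intro sum.cong refl poly_mat_index[OF B_carrier _ _ dP]) auto
    also have "\<dots> = (\<Sum>i\<le>size_B - 1. coeff (P v) i * row_sum (B ^\<^sub>m i) t)"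
      unfolding row_sum_def sum_distrib_left by (rule sum.swap)
    also have "\<dots> = (\<Sum>i<size_B. K $$ (t, i) * v $ i)"
    proof (rule sum.cong)
      show "{..size_B - 1} = {..<size_B}" using t by auto
    qed (use t in \<open>auto simp: coeff_P K_def\<close>)
    also have "\<dots> = (K *\<^sub>v v) $ t" by (rule mult_vec_index[OF K v t, symmetric])
    finally show ?thesis .
  qed
  have det: "det K \<noteq> 0"
  proof
    assume "det K = 0"
    then obtain v where v: "v \<in> carrier_vec size_B" "v \<noteq> 0\<^sub>v size_B" "K *\<^sub>v v = 0\<^sub>v size_B"
      using det_0_iff_vec_prod_zero[OF K] by blast
    have "(\<Prod>j<r. g j ^ d j) dvd P v"
      by (rule row_sum_poly_eq_0_imp_dvd) (use row_P[OF v(1)] v(3) in simp)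
    moreover have "degree (P v) < size_B"
    proof -
      have "size_B > 0" using v by (cases "size_B = 0") auto
      moreover have "degree (P v) \<le> size_B - 1" by (rule degree_le) (use coeff_P in auto)
      ultimately show ?thesis by simp
    qed
    ultimately have "P v = 0" using dvd_imp_degree_le[of _ "P v"] degree_prod_blocks by fastforce
    then have "v $ i = 0" if "i < size_B" for i using coeff_P[of v i] that by simp
    then have "v = 0\<^sub>v size_B" using v(1) by (intro eq_vecI) auto
    then show False using v(2) by simp
  qed
  obtain v where v: "v \<in> carrier_vec size_B" "K *\<^sub>v v = vec size_B (row_sum X)"
    using U.linear_system_over[of K size_B "vec size_B (row_sum X)"] K det by (auto simp: mats_over_iff)
  let ?M = "poly_mat (P v) B"
  have M: "?M \<in> carrier_mat size_B size_B" by (rule poly_mat_carrier[OF B_carrier])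
  have same: "row_sum ?M t = row_sum X t" if "t < size_B" for t
    using row_P[OF v(1) that] v(2) that by simp
  have MB: "?M * B = B * ?M" by (rule poly_mat_commute[OF B_carrier B_carrier refl])
  \<comment> \<open>\<open>w B ^ i q(B) = w q(B) B ^ i = w X B ^ i = w B ^ i X\<close>\<close>
  have agree: "(\<Sum>u<size_B. row_sum (B ^\<^sub>m i) u * (?M $$ (u, t) - X $$ (u, t))) = 0" if t: "t < size_B" for i t
  proof -
    have Bi: "B ^\<^sub>m i \<in> carrier_mat size_B size_B" by (rule pow_carrier_mat[OF B_carrier])
    have "(\<Sum>u<size_B. row_sum (B ^\<^sub>m i) u * ?M $$ (u, t)) = row_sum (B ^\<^sub>m i * ?M) t"
      by (rule row_sum_mult[OF Bi M t, symmetric])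
    also have "B ^\<^sub>m i * ?M = ?M * B ^\<^sub>m i"
      by (rule pow_mat_commute_gen[OF B_carrier M MB[symmetric]])
    also have "row_sum (?M * B ^\<^sub>m i) t = row_sum (X * B ^\<^sub>m i) t"
      unfolding row_sum_mult[OF M Bi t] row_sum_mult[OF X Bi t] using same by simp
    also have "X * B ^\<^sub>m i = B ^\<^sub>m i * X"
      by (rule pow_mat_commute_gen[OF B_carrier X XB[symmetric], symmetric])
    also have "row_sum (B ^\<^sub>m i * X) t = (\<Sum>u<size_B. row_sum (B ^\<^sub>m i) u * X $$ (u, t))"
      by (rule row_sum_mult[OF Bi X t])
    finally show ?thesis by (simp add: right_diff_distrib sum_subtractf)
  qed
  have "X = ?M"
  proof (rule eq_matI)
    fix u t assume "u < dim_row ?M" "t < dim_col ?M"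
    then have ut: "u < size_B" "t < size_B" using M by auto
    define w where "w = vec size_B (\<lambda>u. ?M $$ (u, t) - X $$ (u, t))"
    have w: "w \<in> carrier_vec size_B" by (simp add: w_def)
    have Kt: "transpose_mat K \<in> carrier_mat size_B size_B" using K by simp
    have "transpose_mat K *\<^sub>v w = 0\<^sub>v size_B"
    proof (rule eq_vecI)
      fix i assume "i < dim_vec (0\<^sub>v size_B :: complex vec)"
      then have i: "i < size_B" by simp
      have "(transpose_mat K *\<^sub>v w) $ i = (\<Sum>u<size_B. transpose_mat K $$ (i, u) * w $ u)"
        by (rule mult_vec_index[OF Kt w i])
      also have "\<dots> = (\<Sum>u<size_B. row_sum (B ^\<^sub>m i) u * (?M $$ (u, t) - X $$ (u, t)))"
        using i by (intro sum.cong refl) (simp add: K_def w_def)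
      finally show "(transpose_mat K *\<^sub>v w) $ i = 0\<^sub>v size_B $ i" using agree[OF ut(2)] i by simp
    qed (use K in simp)
    then have "w = 0\<^sub>v size_B" using det_0_iff_vec_prod_zero[OF Kt] det det_transpose[OF K] w by metis
    then have "w $ u = 0" using ut by simp
    then show "X $$ (u, t) = ?M $$ (u, t)" using ut by (simp add: w_def)
  qed (use X M in auto)
  then show ?thesis by blast
qed

end

section \<open>Toeplitz solutions and the successive linear equations\<close>

lemma mat_sum_zero: "(\<And>x. x \<in> S \<Longrightarrow> f x = 0\<^sub>m a b) \<Longrightarrow> mat_sum a b f S = 0\<^sub>m a b"
  by (intro eq_matI) auto

lemma Es_rhs_carrier [simp]: "Es_rhs k p X s \<in> carrier_mat k k"
  by (simp add: Es_rhs_def Let_def)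

text \<open>A block row and a block column of length 0 have the zero matrix as their product.\<close>

lemma Es_rhs_2:
  assumes "X 1 \<in> carrier_mat k k" shows "Es_rhs k p X 2 = 0\<^sub>m k k"
proof -
  let ?R = "block_mat 1 0 k k (\<lambda>a b. X (b + 2))" and ?L = "block_mat 0 1 k k (\<lambda>a b. X (1 - a))"
  have z: "M * ?L = 0\<^sub>m k k" if "M \<in> carrier_mat k 0" for M
    using that block_mat_carrier[of 0 1 k k "\<lambda>a b. X (1 - a)"]
    by (intro eq_matI) (auto simp: scalar_prod_def)
  have "X 1 ^\<^sub>m e * ?R * block_toeplitz k 0 X ^\<^sub>m \<nu> * ?L * X 1 ^\<^sub>m i = 0\<^sub>m k k" for e \<nu> i
  proof -
    have "X 1 ^\<^sub>m e * ?R \<in> carrier_mat k 0"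
      by (rule mult_carrier_mat[OF pow_carrier_mat[OF assms]]) (use block_mat_carrier[of 1 0 k k] in simp)
    then have "X 1 ^\<^sub>m e * ?R * block_toeplitz k 0 X ^\<^sub>m \<nu> \<in> carrier_mat k 0"
      by (rule mult_carrier_mat) (use pow_carrier_mat[OF block_toeplitz_carrier[of k 0 X]] in simp)
    from z[OF this] show ?thesis by (simp only: left_mult_zero_mat[OF pow_carrier_mat[OF assms]])
  qed
  then show ?thesis
    by (auto simp: Es_rhs_def Let_def simp del: One_nat_def intro!: mat_sum_zero)
      (subst mat_sum_zero, simp_all add: mat_sum_zero)
qed

lemma Es_rhs_cong:
  assumes "\<And>t. 1 \<le> t \<Longrightarrow> t < s \<Longrightarrow> X t = Y t" and s: "s \<ge> 3"
  shows "Es_rhs k p X s = Es_rhs k p Y s"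
proof -
  have "X 1 = Y 1" using assms by auto
  moreover have "block_mat 1 (s - 2) k k (\<lambda>a b. X (b + 2)) = block_mat 1 (s - 2) k k (\<lambda>a b. Y (b + 2))"
    using assms by (intro block_mat_cong) auto
  moreover have "block_mat (s - 2) 1 k k (\<lambda>a b. X (s - 1 - a)) = block_mat (s - 2) 1 k k (\<lambda>a b. Y (s - 1 - a))"
    using assms by (intro block_mat_cong) auto
  moreover have "block_toeplitz k (s - 2) X = block_toeplitz k (s - 2) Y"
    using assms by (intro block_toeplitz_cong) auto
  ultimately show ?thesis unfolding Es_rhs_def by simp
qed

lemma toeplitz_solution_iff:
  assumes X: "\<And>s. 1 \<le> s \<Longrightarrow> s \<le> d \<Longrightarrow> X s \<in> carrier_mat (degree g) (degree g)" and d: "d \<ge> 1"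
  shows "poly_mat p (block_toeplitz (degree g) d X) = companion_jordan g d \<longleftrightarrow>
    poly_mat p (X 1) = companion g \<and>
    (2 \<le> d \<longrightarrow> diff_op p (X 1) (X 2) = 1\<^sub>m (degree g)) \<and>
    (\<forall>s\<in>{3..d}. diff_op p (X 1) (X s) + Es_rhs (degree g) p X s = 0\<^sub>m (degree g) (degree g))"
proof -
  let ?k = "degree g"
  let ?F = "\<lambda>s. mat_sum ?k ?k (\<lambda>m. coeff p m \<cdot>\<^sub>m toeplitz_pow ?k X m s) {0..degree p}"
  let ?J = "\<lambda>s. if s = 1 then companion g else if s = 2 then 1\<^sub>m ?k else 0\<^sub>m ?k ?k"
  have X1: "X 1 \<in> carrier_mat ?k ?k" using X d by simp
  have F1: "?F 1 = poly_mat p (X 1)" by (rule poly_toeplitz_coeff_1[of X, OF X1])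
  have F: "?F s = diff_op p (X 1) (X s) + Es_rhs ?k p X s" if "2 \<le> s" "s \<le> d" for s
    using X that by (intro poly_toeplitz_coeff) auto
  have F2: "?F 2 = diff_op p (X 1) (X 2)" if "2 \<le> d"
    using F[of 2] that diff_op_carrier[OF X1] by (simp add: Es_rhs_2[of X, OF X1])
  have "poly_mat p (block_toeplitz ?k d X) = companion_jordan g d \<longleftrightarrow> block_toeplitz ?k d ?F = block_toeplitz ?k d ?J"
    unfolding companion_jordan_eq_toeplitz by (simp add: poly_mat_block_toeplitz X)
  also have "\<dots> \<longleftrightarrow> (\<forall>s. 1 \<le> s \<and> s \<le> d \<longrightarrow> ?F s = ?J s)"
    by (rule block_toeplitz_inject) auto
  also have "\<dots> \<longleftrightarrow> ?F 1 = companion g \<and> (2 \<le> d \<longrightarrow> ?F 2 = 1\<^sub>m ?k) \<and> (\<forall>s\<in>{3..d}. ?F s = 0\<^sub>m ?k ?k)"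
    (is "?lhs \<longleftrightarrow> ?rhs")
  proof
    assume l: ?lhs
    have "?F 1 = companion g" using l[rule_format, of 1] d by simp
    moreover have "?F 2 = 1\<^sub>m ?k" if "2 \<le> d" using l[rule_format, of 2] that by simp
    moreover have "?F s = 0\<^sub>m ?k ?k" if "s \<in> {3..d}" for s using l[rule_format, of s] that by simp
    ultimately show ?rhs by blast
  next
    assume r: ?rhs
    show ?lhs
    proof (intro allI impI)
      fix s assume s: "1 \<le> s \<and> s \<le> d"
      consider "s = 1" | "s = 2" | "s \<in> {3..d}" using s by fastforce
      then show "?F s = ?J s" using r s by cases auto
    qed
  qed
  finally show ?thesis using F1 F2 F by auto
qed

lemma conv_2:
  assumes "X 1 \<in> carrier_mat k k" "X 2 \<in> carrier_mat k k" "Y 1 \<in> carrier_mat k k" "Y 2 \<in> carrier_mat k k"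
  shows "conv k X Y 2 = X 1 * Y 2 + X 2 * Y 1"
  using assms by (intro eq_matI) (auto simp: conv_def numeral_2_eq_2)

text \<open>
  The block Toeplitz matrix \<open>Y\<close> with blocks \<open>X\<close> and \<open>Z\<close> commutes with \<open>p(Y)\<close>, whose blocks are
  \<open>p(X)\<close> and the derivative of \<open>p\<close> at \<open>X\<close> in direction \<open>Z\<close>.  Compare the upper right blocks of
  the two products.
\<close>

lemma diff_op_commutator:
  assumes X: "X \<in> carrier_mat k k" and Z: "Z \<in> carrier_mat k k"
  shows "X * diff_op p X Z + Z * poly_mat p X = poly_mat p X * Z + diff_op p X Z * X"
proof -
  define V where "V s = (if s = 1 then X else Z)" for s :: nat
  define F where "F s = mat_sum k k (\<lambda>m. coeff p m \<cdot>\<^sub>m toeplitz_pow k V m s) {0..degree p}" for s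
  have V: "V s \<in> carrier_mat k k" for s using X Z by (simp add: V_def)
  have Fc: "F s \<in> carrier_mat k k" for s by (simp add: F_def)
  have F1: "F 1 = poly_mat p X" unfolding F_def using poly_toeplitz_coeff_1[of V k p, OF V] by (simp add: V_def)
  have F2: "F 2 = diff_op p X Z"
    unfolding F_def using poly_toeplitz_coeff[of 2 V k p, OF V] diff_op_carrier[OF X]
    by (simp add: Es_rhs_2[of V, OF V] V_def)
  let ?Y = "block_toeplitz k 2 V"
  have pY: "poly_mat p ?Y = block_toeplitz k 2 F"
    unfolding F_def by (rule poly_mat_block_toeplitz) (rule V)
  have "?Y * poly_mat p ?Y = poly_mat p ?Y * ?Y"
    by (rule poly_mat_commute[OF block_toeplitz_carrier block_toeplitz_carrier refl, symmetric])
  then have "block_toeplitz k 2 (conv k V F) = block_toeplitz k 2 (conv k F V)"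
    unfolding pY by (simp only: block_toeplitz_mult V Fc)
  then have "conv k V F 2 = conv k F V 2" by (subst (asm) block_toeplitz_inject) auto
  then show ?thesis
    unfolding conv_2[OF V V Fc Fc] conv_2[OF Fc Fc V V] F1 F2 by (simp add: V_def)
qed

text \<open>
  If \<open>p(X) = C\<close> is a companion matrix, then \<open>Z\<close> with derivative \<open>I\<close> and \<open>W\<close> with derivative \<open>0\<close>
  commute with \<open>C\<close> by the preceding identity.  So both, like \<open>X\<close>, are polynomials in \<open>C\<close> and
  commute with each other, and the derivative in direction \<open>Z W = W Z\<close> is \<open>I W\<close> as well as \<open>0 Z\<close>.
\<close>

lemma E2_solvable_imp_cond_D:
  assumes X: "X \<in> carrier_mat (degree g) (degree g)" and pX: "poly_mat p X = companion g"
    and Z: "Z \<in> carrier_mat (degree g) (degree g)" "diff_op p X Z = 1\<^sub>m (degree g)"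
  shows "cond_D p X"
proof (rule ccontr)
  let ?k = "degree g" and ?C = "companion g"
  assume "\<not> cond_D p X"
  then obtain W where W: "W \<in> carrier_mat ?k ?k" "W \<noteq> 0\<^sub>m ?k ?k" "diff_op p X W = 0\<^sub>m ?k ?k"
    using not_cond_D_iff[OF X] by blast
  have "X * 1\<^sub>m ?k + Z * ?C = ?C * Z + 1\<^sub>m ?k * X"
    using diff_op_commutator[OF X Z(1), of p] unfolding Z(2) pX .
  then have "Z * ?C = ?C * Z" using X Z(1) by (auto simp: mat_eq_iff)
  then have Zq: "Z = poly_mat (row0_poly Z) ?C" by (rule companion_commute_imp_poly[OF Z(1)])
  have "X * 0\<^sub>m ?k ?k + W * ?C = ?C * W + 0\<^sub>m ?k ?k * X"
    using diff_op_commutator[OF X W(1), of p] unfolding W(3) pX .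
  then have "W * ?C = ?C * W" using X W(1) square_mult_carrier[OF _ companion_carrier, of W g]
    by (simp add: right_mult_zero_mat[of _ ?k ?k])
  then have Wq: "W = poly_mat (row0_poly W) ?C" by (rule companion_commute_imp_poly[OF W(1)])
  have Xq: "X = poly_mat (row0_poly X) ?C"
    by (rule companion_commute_imp_poly[OF X poly_sol_commute[OF X pX]])
  have comm: "poly_mat u ?C * poly_mat v ?C = poly_mat v ?C * poly_mat u ?C" for u v
    using poly_mat_mult[OF companion_carrier, of u v g] poly_mat_mult[OF companion_carrier, of v u g]
    by (simp add: mult.commute)
  have "W = diff_op p X Z * W" using W(1) Z(2) by simp
  also have "\<dots> = diff_op p X (Z * W)"
    by (rule diff_op_mult_right[OF X Z(1) W(1), symmetric]) (subst (1 2) Xq, subst (1 2) Wq, rule comm)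
  also have "Z * W = W * Z" by (subst (1 2) Wq, subst (1 2) Zq, rule comm)
  also have "diff_op p X (W * Z) = diff_op p X W * Z"
    by (rule diff_op_mult_right[OF X W(1) Z(1)]) (subst (1 2) Xq, subst (1 2) Zq, rule comm)
  also have "\<dots> = 0\<^sub>m ?k ?k" using W(3) Z(1) by simp
  finally show False using W(2) by simp
qed

section \<open>Solving the successive equations over the subfield\<close>

context number_field
begin

lemma kronecker_over:
  assumes "A \<in> mats_over H k" "B \<in> mats_over H k"
  shows "kronecker A B \<in> mats_over H (k * k)"
  using assms by (auto simp: mats_over_iff kronecker_def block_mat_def div_mod_less_square intro!: mult_mem)

lemma diff_matrix_over:
  assumes p: "p \<in> polys_over H" and X: "X \<in> mats_over H k"
  shows "diff_matrix p X \<in> mats_over H (k * k)"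
proof -
  have Xt: "transpose_mat X \<in> mats_over H k" using X by (auto simp: mats_over_iff)
  show ?thesis
    using p X Xt mats_over_carrier[OF X] unfolding diff_matrix_def Let_def
    by (auto intro!: mats_over_mat_sum mats_over_smult kronecker_over mats_over_pow simp: polys_over_def)
qed

lemma elements_block_mat:
  assumes "\<And>a b. a < d \<Longrightarrow> b < e \<Longrightarrow> F a b \<in> carrier_mat k l \<and> elements_mat (F a b) \<subseteq> H"
  shows "elements_mat (block_mat d e k l F) \<subseteq> H"
  unfolding elements_mat_subset_iff
proof (intro allI impI)
  fix s t assume "s < dim_row (block_mat d e k l F)" "t < dim_col (block_mat d e k l F)"
  then have st: "s < d * k" "t < e * l" by auto
  note s = div_mod_less_square[OF st(1)] and t = div_mod_less_square[OF st(2)]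
  have "F (s div k) (t div l) $$ (s mod k, t mod l) \<in> H"
    using assms[OF s(1) t(1)] s t by (auto simp: elements_mat_subset_iff)
  then show "block_mat d e k l F $$ (s, t) \<in> H" using st by (simp add: block_mat_def)
qed

lemma block_toeplitz_over:
  assumes "\<And>s. 1 \<le> s \<Longrightarrow> s \<le> d \<Longrightarrow> X s \<in> mats_over H k"
  shows "block_toeplitz k d X \<in> mats_over H (d * k)"
proof -
  have "elements_mat (block_toeplitz k d X) \<subseteq> H"
    unfolding block_toeplitz_def using assms
    by (intro elements_block_mat) (auto simp: mats_over_def elements_mat_subset_iff)
  then show ?thesis by (simp add: mats_over_def)
qed

lemma Es_rhs_over:
  assumes p: "p \<in> polys_over H" and X: "\<And>t. 1 \<le> t \<Longrightarrow> t < s \<Longrightarrow> X t \<in> mats_over H k" and s: "s \<ge> 2"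
  shows "Es_rhs k p X s \<in> mats_over H k"
proof -
  let ?R = "block_mat 1 (s - 2) k k (\<lambda>a b. X (b + 2))"
  let ?L = "block_mat (s - 2) 1 k k (\<lambda>a b. X (s - 1 - a))"
  let ?h = "(s - 2) * k"
  have R: "?R \<in> carrier_mat k ?h" "elements_mat ?R \<subseteq> H"
    using block_mat_carrier[of 1 "s - 2" k k] X
    by (simp, intro elements_block_mat) (simp add: mats_over_def)
  have L: "?L \<in> carrier_mat ?h k" "elements_mat ?L \<subseteq> H"
    using block_mat_carrier[of "s - 2" 1 k k] X
    by (simp, intro elements_block_mat) (simp add: mats_over_def)
  have T: "block_toeplitz k (s - 2) X \<in> mats_over H ?h"
    by (rule block_toeplitz_over) (use X in auto)
  have X1: "X 1 \<in> mats_over H k" using X s by auto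
  have "X 1 ^\<^sub>m e * ?R * block_toeplitz k (s - 2) X ^\<^sub>m \<nu> * ?L * X 1 ^\<^sub>m i \<in> mats_over H k" for e \<nu> i
  proof -
    have E: "X 1 ^\<^sub>m e \<in> carrier_mat k k" "elements_mat (X 1 ^\<^sub>m e) \<subseteq> H" for e
      using mats_over_pow[OF X1, of e] by (auto simp: mats_over_def)
    have N: "block_toeplitz k (s - 2) X ^\<^sub>m \<nu> \<in> carrier_mat ?h ?h" "elements_mat (block_toeplitz k (s - 2) X ^\<^sub>m \<nu>) \<subseteq> H"
      using mats_over_pow[OF T, of \<nu>] by (auto simp: mats_over_def)
    note 1 = mult_carrier_mat[OF E(1)[of e] R(1)] elements_mult[OF E(1)[of e] R(1) E(2) R(2)]
    note 2 = mult_carrier_mat[OF 1(1) N(1)] elements_mult[OF 1(1) N(1) 1(2) N(2)]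
    note 3 = mult_carrier_mat[OF 2(1) L(1)] elements_mult[OF 2(1) L(1) 2(2) L(2)]
    show ?thesis
      using mult_carrier_mat[OF 3(1) E(1)] elements_mult[OF 3(1) E(1) 3(2) E(2)]
      unfolding mats_over_def by blast
  qed
  then show ?thesis using p unfolding Es_rhs_def Let_def
    by (intro mats_over_mat_sum mats_over_smult) (auto simp: polys_over_def)
qed

lemma diff_op_eq_ex1_over:
  assumes p: "p \<in> polys_over H" and X: "X \<in> mats_over H k" and D: "cond_D p X" and R: "R \<in> mats_over H k"
  shows "\<exists>Z. {Z \<in> mats_over H k. diff_op p X Z = R} = {Z}"
proof -
  note Xc = mats_over_carrier[OF X] and Rc = mats_over_carrier[OF R]
  have Rv: "vectorize R $ t \<in> H" if "t < k * k" for t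
    using R that div_mod_less_square[OF that] by (auto simp: vectorize_index[OF Rc that] mats_over_iff)
  obtain x where x: "x \<in> carrier_vec (k * k)" "\<And>t. t < k * k \<Longrightarrow> x $ t \<in> H" "diff_matrix p X *\<^sub>v x = vectorize R"
    and uniq: "\<And>y. y \<in> carrier_vec (k * k) \<Longrightarrow> diff_matrix p X *\<^sub>v y = vectorize R \<Longrightarrow> y = x"
    using linear_system_over[OF diff_matrix_over[OF p X] _ vectorize_carrier[OF Rc] Rv] D
    unfolding cond_D_def by blast
  define Z where "Z = unvectorize k x"
  have Zc: "Z \<in> carrier_mat k k" and vZ: "vectorize Z = x"
    using vectorize_unvectorize[OF x(1)] by (auto simp: Z_def)
  have ZH: "Z \<in> mats_over H k" using x(2) by (auto simp: mats_over_iff Z_def unvectorize_def block_index_less)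
  have iff: "diff_op p X Y = R \<longleftrightarrow> diff_matrix p X *\<^sub>v vectorize Y = vectorize R" if Y: "Y \<in> carrier_mat k k" for Y
    unfolding diff_matrix_vectorize[OF Xc Y] vectorize_inject[OF diff_op_carrier[OF Xc] Rc] ..
  have "Y = Z" if "Y \<in> mats_over H k" "diff_op p X Y = R" for Y
  proof -
    have Yc: "Y \<in> carrier_mat k k" using that by (rule_tac mats_over_carrier)
    have "vectorize Y = x" using uniq[OF vectorize_carrier[OF Yc]] iff[OF Yc] that by simp
    then show ?thesis using vZ vectorize_inject[OF Yc Zc] by simp
  qed
  moreover have "diff_op p X Z = R" using iff[OF Zc] vZ x(3) by simp
  ultimately show ?thesis using ZH by blast
qed

lemma E2_sols_iff:
  assumes "X1 \<in> carrier_mat k k"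
  shows "E2_sols H k p X1 = {Z \<in> mats_over H k. diff_op p X1 Z = 1\<^sub>m k}"
  using assms by (simp add: E2_sols_def diff_op_def Let_def carrier_matD)

lemma Es_sols_iff:
  assumes "X 1 \<in> carrier_mat k k"
  shows "Es_sols H k p X s = {Z \<in> mats_over H k. diff_op p (X 1) Z = - Es_rhs k p X s}"
proof -
  let ?R = "Es_rhs k p X s"
  have Rc: "- ?R \<in> carrier_mat k k" by simp
  have neg: "- vectorize ?R = vectorize (- ?R)"
  proof (rule eq_vecI)
    fix t assume "t < dim_vec (vectorize (- ?R))"
    then have t: "t < k * k" using carrier_vecD[OF vectorize_carrier[OF Rc]] by simp
    have "(- vectorize ?R) $ t = - (vectorize ?R $ t)"
      by (rule index_uminus_vec) (simp only: carrier_vecD[OF vectorize_carrier[OF Es_rhs_carrier]] t)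
    then show "(- vectorize ?R) $ t = vectorize (- ?R) $ t"
      using div_mod_less_square[OF t] carrier_matD[OF Es_rhs_carrier[of k p X s]]
      by (simp add: vectorize_index[OF Rc t] vectorize_index[OF Es_rhs_carrier t])
  qed (simp add: vectorize_def)
  have "diff_matrix p (X 1) *\<^sub>v vectorize Z = - vectorize ?R \<longleftrightarrow> diff_op p (X 1) Z = - ?R"
    if "Z \<in> mats_over H k" for Z
    unfolding neg diff_matrix_vectorize[OF assms mats_over_carrier[OF that]] vectorize_inject[OF diff_op_carrier[OF assms] Rc] ..
  then show ?thesis unfolding Es_sols_def by blast
qed

lemma successive_sols_iff:
  assumes d: "d \<ge> 1"
  shows "successive_sols H p g d X \<longleftrightarrow> (\<forall>s\<in>{1..d}. X s \<in> mats_over H (degree g)) \<and>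
    poly_mat p (block_toeplitz (degree g) d X) = companion_jordan g d"
proof -
  let ?k = "degree g"
  have eq_neg: "M = - N \<longleftrightarrow> M + N = 0\<^sub>m ?k ?k" if "M \<in> carrier_mat ?k ?k" "N \<in> carrier_mat ?k ?k" for M N :: "complex mat"
    using that by (auto simp: mat_eq_iff eq_neg_iff_add_eq_0)
  have es: "X s \<in> Es_sols H ?k p X s \<longleftrightarrow>
      X s \<in> mats_over H ?k \<and> diff_op p (X 1) (X s) + Es_rhs ?k p X s = 0\<^sub>m ?k ?k"
    if "X 1 \<in> carrier_mat ?k ?k" for s
    using that eq_neg[OF diff_op_carrier[OF that] Es_rhs_carrier] by (simp add: Es_sols_iff[of X ?k, OF that])
  show ?thesis (is "_ \<longleftrightarrow> ?over \<and> ?eq")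
  proof
    assume l: "successive_sols H p g d X"
    have X1: "X 1 \<in> mats_over H ?k" using l by (simp add: successive_sols_def poly_sols_def)
    note X1c = mats_over_carrier[OF X1]
    have over: ?over
    proof
      fix s assume "s \<in> {1..d}"
      then consider "s = 1" | "s = 2" "2 \<le> d" | "s \<in> {3..d}" by fastforce
      then show "X s \<in> mats_over H ?k"
        using l X1 by cases (auto simp: successive_sols_def E2_sols_def Es_sols_def)
    qed
    moreover have ?eq
      using l over d es[OF X1c] unfolding successive_sols_def E2_sols_iff[OF X1c] poly_sols_def
      by (subst toeplitz_solution_iff) (auto dest: mats_over_carrier)
    ultimately show "?over \<and> ?eq" ..
  next
    assume r: "?over \<and> ?eq"
    then have X1: "X 1 \<in> mats_over H ?k" using d by simp
    note X1c = mats_over_carrier[OF X1]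
    have "poly_mat p (X 1) = companion g \<and> (2 \<le> d \<longrightarrow> diff_op p (X 1) (X 2) = 1\<^sub>m ?k) \<and>
      (\<forall>s\<in>{3..d}. diff_op p (X 1) (X s) + Es_rhs ?k p X s = 0\<^sub>m ?k ?k)"
      using r d by (subst toeplitz_solution_iff[symmetric]) (auto dest: mats_over_carrier)
    then show "successive_sols H p g d X"
      using r X1 es[OF X1c] unfolding successive_sols_def E2_sols_iff[OF X1c] poly_sols_def by auto
  qed
qed

lemma unique_successive_imp_successive:
  "unique_successive_sols H p g d X \<Longrightarrow> successive_sols H p g d X"
  by (auto simp: unique_successive_sols_def successive_sols_def)

lemma Es_sols_cong:
  assumes "\<And>t. 1 \<le> t \<Longrightarrow> t < s \<Longrightarrow> X t = Y t" "s \<ge> 3"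
  shows "Es_sols H k p X s = Es_sols H k p Y s"
  using assms Es_rhs_cong[OF assms] unfolding Es_sols_def by simp

lemma unique_successive_sols_determined:
  assumes X: "unique_successive_sols H p g d X" and Y: "successive_sols H p g d Y" and eq: "X 1 = Y 1"
    and s: "1 \<le> s" "s \<le> d"
  shows "X s = Y s"
  using s
proof (induction s rule: less_induct)
  case (less s)
  consider "s = 1" | "s = 2" | "s \<ge> 3" using less.prems by linarith
  then show ?case
  proof cases
    case 2
    then show ?thesis using X Y eq less.prems by (simp add: unique_successive_sols_def successive_sols_def)
  next
    case 3
    then have "Es_sols H (degree g) p X s = Es_sols H (degree g) p Y s"
      using less by (intro Es_sols_cong) auto
    moreover have "Es_sols H (degree g) p X s = {X s}" "Y s \<in> Es_sols H (degree g) p Y s"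
      using X Y 3 less.prems by (simp_all add: unique_successive_sols_def successive_sols_def)
    ultimately show ?thesis by (metis singletonD)
  qed (use eq in simp)
qed

text \<open>
  The blocks are chosen one after the other; a new block does not change the equations of the
  earlier ones, because (E\<open>\<^sub>s\<close>) involves only \<open>X 1, ..., X (s - 1)\<close> besides the unknown.
\<close>

lemma ex_unique_successive_sols:
  assumes p: "p \<in> polys_over H" and X1: "X1 \<in> poly_sols H (degree g) p (companion g)"
    and D: "d > 1 \<Longrightarrow> cond_D p X1"
  shows "\<exists>X. X 1 = X1 \<and> unique_successive_sols H p g d X"
  using D
proof (induction d)
  case (Suc e)
  let ?k = "degree g"
  have X1H: "X1 \<in> mats_over H ?k" using X1 by (simp add: poly_sols_def)
  obtain X where X: "X 1 = X1" "unique_successive_sols H p g e X"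
    using Suc by (cases "e = 0") auto
  have Xc: "X 1 \<in> carrier_mat ?k ?k" using mats_over_carrier[OF X1H] X(1) by simp
  show ?case
  proof (cases "e = 0")
    case True
    then show ?thesis using X by (intro exI[of _ X]) (auto simp: unique_successive_sols_def)
  next
    case False
    then have D: "cond_D p (X 1)" using Suc.prems X(1) by simp
    define E where "E = (if e = 1 then E2_sols H ?k p (X 1) else Es_sols H ?k p X (Suc e))"
    have "\<exists>Z. E = {Z}"
    proof (cases "e = 1")
      case True
      then show ?thesis unfolding E_def E2_sols_iff[OF Xc]
        using diff_op_eq_ex1_over[OF p _ D mats_over_one] X1H X(1) by simp
    next
      case e1: False
      have "successive_sols H p g e X" by (rule unique_successive_imp_successive[OF X(2)])
      then have "X t \<in> mats_over H ?k" if "1 \<le> t" "t < Suc e" for t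
        using that False by (simp add: successive_sols_iff)
      then have "Es_rhs ?k p X (Suc e) \<in> mats_over H ?k"
        using p False by (intro Es_rhs_over) auto
      then have "- Es_rhs ?k p X (Suc e) \<in> mats_over H ?k"
        by (auto simp: mats_over_iff carrier_matD[OF Es_rhs_carrier] intro: uminus_mem)
      then show ?thesis unfolding E_def Es_sols_iff[of X, OF Xc]
        using diff_op_eq_ex1_over[OF p _ D] X1H X(1) e1 by simp
    qed
    then obtain Z where Z: "E = {Z}" by blast
    define Y where "Y = X(Suc e := Z)"
    have agree: "Y t = X t" if "t \<le> e" for t using that by (simp add: Y_def)
    have Y1: "Y 1 = X 1" using False by (intro agree) simp
    have es: "Es_sols H ?k p Y s = Es_sols H ?k p X s" if "s \<in> {3..Suc e}" for s
      using that agree by (intro Es_sols_cong) auto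
    have new: "Y (Suc e) = Z" by (simp add: Y_def)
    have "unique_successive_sols H p g (Suc e) Y"
      unfolding unique_successive_sols_def
    proof (intro conjI ballI impI)
      show "Y 1 \<in> poly_sols H ?k p (companion g)" using X1 X(1) Y1 by simp
      show "E2_sols H ?k p (Y 1) = {Y 2}"
      proof (cases "e = 1")
        case True
        then show ?thesis using Z new Y1 by (simp add: E_def numeral_2_eq_2)
      next
        case e1: False
        then show ?thesis using X(2) False agree[of 2] Y1 by (simp add: unique_successive_sols_def)
      qed
      fix s assume s: "s \<in> {3..Suc e}"
      show "Es_sols H ?k p Y s = {Y s}"
      proof (cases "s = Suc e")
        case True
        then show ?thesis using Z new s unfolding es[OF s] by (simp add: E_def split: if_splits)
      next
        case se: False
        then show ?thesis using X(2) s agree[of s] unfolding es[OF s] by (simp add: unique_successive_sols_def)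
      qed
    qed
    then show ?thesis using Y1 X(1) by (intro exI[of _ Y]) simp
  qed
qed (use X1 in \<open>auto simp: unique_successive_sols_def intro!: exI[of _ "\<lambda>_. X1"]\<close>)

end

lemma ecard_Times:
  assumes "A \<noteq> {}" "B \<noteq> {}"
  shows "ecard (A \<times> B) = ecard A * ecard B"
proof (cases "finite A \<and> finite B")
  case True
  then show ?thesis by (simp add: ecard_def card_cartesian_product)
next
  case False
  then have inf: "infinite (A \<times> B)" using assms by (auto dest: finite_cartesian_productD1 finite_cartesian_productD2)
  have "ecard A \<noteq> 0" "ecard B \<noteq> 0" using assms by (auto simp: ecard_def zero_enat_def)
  then show ?thesis using False inf by (auto simp: ecard_def zero_enat_def imult_is_infinity)
qed

lemma ecard_PiE:
  fixes r :: nat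
  assumes "\<And>j. j < r \<Longrightarrow> S j \<noteq> {}"
  shows "ecard (PiE {..<r} S) = (\<Prod>j<r. ecard (S j))"
  using assms
proof (induction r)
  case 0
  then show ?case by (simp add: ecard_def one_enat_def)
next
  case (Suc r)
  have "bij_betw (\<lambda>(y, f). f(r := y)) (S r \<times> PiE {..<r} S) (PiE (insert r {..<r}) S)"
    by (rule bij_betw_imageI) (auto simp: inj_combinator PiE_insert_eq)
  then have "ecard (PiE (insert r {..<r}) S) = ecard (S r \<times> PiE {..<r} S)"
    using ecard_bij_betw by metis
  also have "\<dots> = ecard (S r) * (\<Prod>j<r. ecard (S j))"
    using Suc by (subst ecard_Times) (auto simp: PiE_eq_empty_iff)
  finally show ?case by (simp add: lessThan_Suc mult.commute)
qed

section \<open>Solutions of the full matrix equation\<close>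

locale companion_jordan_form = number_field H + companion_blocks g d r
  for H :: "complex set" and g :: "nat \<Rightarrow> complex poly" and d :: "nat \<Rightarrow> nat" and r :: nat +
  fixes A T T' :: "complex mat" and n :: nat
  assumes g_over: "\<And>j. j < r \<Longrightarrow> g j \<in> polys_over H"
    and T: "T \<in> mats_over H n" "T' \<in> carrier_mat n n" "T * T' = 1\<^sub>m n" "T' * T = 1\<^sub>m n"
    and A_eq: "A = T' * B * T" and size: "n = size_B"
begin

lemma T_carrier: "T \<in> carrier_mat n n"
  by (rule mats_over_carrier[OF T(1)])

lemma T'_over: "T' \<in> mats_over H n"
  by (rule inverse_over[OF T(1,2,3)])

lemma B_carrier_n: "B \<in> carrier_mat n n"
  using B_carrier size by simp

lemma conjugate_cancel:
  assumes "M \<in> carrier_mat n n"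
  shows "T * (T' * M * T) * T' = M" "T' * (T * M * T') * T = M"
proof -
  note c = T_carrier T(2) assms
  have "T * (T' * M * T) * T' = (T * T') * M * (T * T')" using c by (simp add: square_mult_assoc[of _ n])
  then show "T * (T' * M * T) * T' = M" using T(3) assms by simp
  have "T' * (T * M * T') * T = (T' * T) * M * (T' * T)" using c by (simp add: square_mult_assoc[of _ n])
  then show "T' * (T * M * T') * T = M" using T(4) assms by simp
qed

lemma conjugate_inject:
  assumes M: "M \<in> carrier_mat n n" and N: "N \<in> carrier_mat n n"
  shows "T' * M * T = T' * N * T \<longleftrightarrow> M = N"
proof
  assume "T' * M * T = T' * N * T"
  then have "T * (T' * M * T) * T' = T * (T' * N * T) * T'" by (rule arg_cong)
  then show "M = N" unfolding conjugate_cancel(1)[OF M] conjugate_cancel(1)[OF N] .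
qed (rule arg_cong)

abbreviation toeplitz_sum :: "(nat \<Rightarrow> nat \<Rightarrow> complex mat) \<Rightarrow> complex mat" where
  "toeplitz_sum Z \<equiv> bdiag r (\<lambda>j. block_toeplitz (degree (g j)) (d j) (Z j))"

lemma toeplitz_sum_carrier: "toeplitz_sum Z \<in> carrier_mat n n"
  unfolding size by (rule bdiag_carrier) simp

lemma poly_mat_assembled:
  "poly_mat p (assembled T T' r g d Z) = T' * poly_mat p (toeplitz_sum Z) * T"
  unfolding assembled_def
  by (rule poly_mat_similar[OF toeplitz_sum_carrier T(2) T_carrier T(4,3)])

lemma poly_mat_assembled_eq_iff:
  "poly_mat p (assembled T T' r g d Z) = A \<longleftrightarrow>
    (\<forall>j<r. poly_mat p (block_toeplitz (degree (g j)) (d j) (Z j)) = companion_jordan (g j) (d j))"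
proof -
  have eq: "poly_mat p (toeplitz_sum Z) = bdiag r (\<lambda>j. poly_mat p (block_toeplitz (degree (g j)) (d j) (Z j)))"
    by (rule poly_mat_bdiag[where h = h]) simp
  have "poly_mat p (assembled T T' r g d Z) = A \<longleftrightarrow> poly_mat p (toeplitz_sum Z) = B"
    unfolding poly_mat_assembled A_eq
    by (rule conjugate_inject[OF poly_mat_carrier[OF toeplitz_sum_carrier] B_carrier_n])
  also have "\<dots> \<longleftrightarrow> (\<forall>j<r. poly_mat p (block_toeplitz (degree (g j)) (d j) (Z j)) = companion_jordan (g j) (d j))"
  proof
    assume "poly_mat p (toeplitz_sum Z) = B"
    then have *: "bdiag r (\<lambda>j. poly_mat p (block_toeplitz (degree (g j)) (d j) (Z j))) = B" by (simp only: eq)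
    show "\<forall>j<r. poly_mat p (block_toeplitz (degree (g j)) (d j) (Z j)) = companion_jordan (g j) (d j)"
    proof (intro allI impI)
      fix j assume "j < r"
      from bdiag_inject[where h = h, OF _ _ * this]
      show "poly_mat p (block_toeplitz (degree (g j)) (d j) (Z j)) = companion_jordan (g j) (d j)"
        using poly_mat_carrier[OF block_toeplitz_carrier] by simp
    qed
  next
    assume *: "\<forall>j<r. poly_mat p (block_toeplitz (degree (g j)) (d j) (Z j)) = companion_jordan (g j) (d j)"
    show "poly_mat p (toeplitz_sum Z) = B"
      unfolding eq by (intro arg_cong[of _ _ diag_block_mat] map_cong refl) (use * in auto)
  qed
  finally show ?thesis .
qed

text \<open>
  A solution \<open>X\<close> of \<open>p(X) = A\<close> commutes with \<open>A\<close>, so it is a polynomial in \<open>A\<close>, and a polynomial in a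
  companion-Jordan block is block Toeplitz.
\<close>

lemma solutions_eq_assembled:
  "poly_sols H n p A = assembled T T' r g d ` {Z. \<forall>j<r. successive_sols H p (g j) (d j) (Z j)}"
proof (intro equalityI subsetI)
  fix X assume X: "X \<in> poly_sols H n p A"
  have XH: "X \<in> mats_over H n" and pX: "poly_mat p X = A" using X by (auto simp: poly_sols_def)
  note Xc = mats_over_carrier[OF XH]
  define Y where "Y = T * X * T'"
  have YH: "Y \<in> mats_over H n" unfolding Y_def by (intro mats_over_mult T(1) T'_over XH)
  note Yc = mats_over_carrier[OF YH]
  have "poly_mat p Y = T * A * T'"
    unfolding Y_def pX[symmetric] by (rule poly_mat_similar[OF Xc T_carrier T(2,3,4)])
  then have pY: "poly_mat p Y = B" unfolding A_eq using conjugate_cancel(1)[OF B_carrier_n] by simp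
  obtain q where q: "Y = poly_mat q B"
    using commutant_eq_polys[of Y] poly_sol_commute[OF Yc pY] Yc size by auto
  define Z where "Z j s = mat_sum (degree (g j)) (degree (g j)) (\<lambda>m. coeff q m \<cdot>\<^sub>m toeplitz_pow (degree (g j))
    (\<lambda>s. if s = 1 then companion (g j) else if s = 2 then 1\<^sub>m (degree (g j)) else 0\<^sub>m (degree (g j)) (degree (g j))) m s) {0..degree q}"
    for j s
  have Zc: "Z j s \<in> carrier_mat (degree (g j)) (degree (g j))" for j s by (simp add: Z_def)
  have qj: "poly_mat q (companion_jordan (g j) (d j)) = block_toeplitz (degree (g j)) (d j) (Z j)" for j
    unfolding companion_jordan_eq_toeplitz Z_def by (rule poly_mat_block_toeplitz) auto
  have "Y = bdiag r (\<lambda>j. poly_mat q (companion_jordan (g j) (d j)))"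
    unfolding q by (rule poly_mat_bdiag[where h = h]) simp
  then have Y: "Y = toeplitz_sum Z" unfolding qj .
  have XA: "X = assembled T T' r g d Z"
    unfolding assembled_def Y[symmetric] Y_def using conjugate_cancel(2)[OF Xc] by simp
  have "successive_sols H p (g j) (d j) (Z j)" if j: "j < r" for j
    unfolding successive_sols_iff[OF d_pos[OF j]]
  proof
    let ?k = "degree (g j)"
    have tc: "\<And>i. i < r \<Longrightarrow> block_toeplitz (degree (g i)) (d i) (Z i) \<in> carrier_mat (h i) (h i)" by simp
    show "\<forall>s\<in>{1..d j}. Z j s \<in> mats_over H ?k"
    proof
      fix s assume s: "s \<in> {1..d j}"
      have "Z j s $$ (a, b) \<in> H" if ab: "a < ?k" "b < ?k" for a b
      proof -
        have sd: "s - 1 < d j" "Suc (s - 1) = s" using s by auto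
        have b': "(s - 1) * ?k + b < h j" by (rule block_index_less[OF sd(1) ab(2)])
        have a': "a < h j" using block_index_less[of 0 "d j" a ?k] ab d_pos[OF j] by simp
        have "Z j s $$ (a, b) = block_toeplitz ?k (d j) (Z j) $$ (a, (s - 1) * ?k + b)"
          using block_toeplitz_index0[OF sd(1) ab, of "Z j"] sd(2) by simp
        also have "\<dots> = Y $$ (offset h j + a, offset h j + ((s - 1) * ?k + b))"
          unfolding Y using bdiag_index[of r _ h j j a "(s - 1) * ?k + b", OF tc j j a' b'] by simp
        also have "\<dots> \<in> H" using YH offset_less[of j r a h, OF j a'] offset_less[of j r "(s - 1) * ?k + b" h, OF j b'] size by (simp add: mats_over_iff)
        finally show ?thesis .
      qed
      then show "Z j s \<in> mats_over H ?k" using Zc by (simp add: mats_over_iff)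
    qed
    show "poly_mat p (block_toeplitz ?k (d j) (Z j)) = companion_jordan (g j) (d j)"
      using poly_mat_assembled_eq_iff[of p Z] pX XA j by simp
  qed
  then show "X \<in> assembled T T' r g d ` {Z. \<forall>j<r. successive_sols H p (g j) (d j) (Z j)}" using XA by blast
next
  fix X assume "X \<in> assembled T T' r g d ` {Z. \<forall>j<r. successive_sols H p (g j) (d j) (Z j)}"
  then obtain Z where X: "X = assembled T T' r g d Z" and Z: "\<And>j. j < r \<Longrightarrow> successive_sols H p (g j) (d j) (Z j)"
    by blast
  have over: "Z j s \<in> mats_over H (degree (g j))" if "j < r" "1 \<le> s" "s \<le> d j" for j s
    using Z[OF that(1)] that(2,3) by (simp add: successive_sols_iff[OF d_pos[OF that(1)]])
  have "toeplitz_sum Z \<in> mats_over H n"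
  proof -
    have tH: "block_toeplitz (degree (g j)) (d j) (Z j) \<in> mats_over H (h j)" if "j < r" for j
      using over that by (intro block_toeplitz_over) auto
    have "toeplitz_sum Z $$ (s, t) \<in> H" if st: "s < n" "t < n" for s t
    proof -
      obtain i a where i: "i < r" "a < h i" "s = offset h i + a" using offset_decomp st(1) size by blast
      obtain j b where j: "j < r" "b < h j" "t = offset h j + b" using offset_decomp st(2) size by blast
      have "toeplitz_sum Z $$ (s, t) = (if i = j then block_toeplitz (degree (g i)) (d i) (Z i) $$ (a, b) else 0)"
        unfolding i(3) j(3) using i j by (intro bdiag_index) auto
      then show ?thesis using tH[OF i(1)] i j by (auto simp: mats_over_iff)
    qed
    then show ?thesis using toeplitz_sum_carrier by (simp add: mats_over_iff)
  qed
  then have "X \<in> mats_over H n"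
    unfolding X assembled_def by (intro mats_over_mult T'_over T(1))
  moreover have "poly_mat p X = A"
    unfolding X poly_mat_assembled_eq_iff using Z d_pos by (auto simp: successive_sols_iff)
  ultimately show "X \<in> poly_sols H n p A" by (simp add: poly_sols_def)
qed

lemma assembled_eq_iff:
  assumes Z: "\<And>j. j < r \<Longrightarrow> successive_sols H p (g j) (d j) (Z j)"
    and W: "\<And>j. j < r \<Longrightarrow> successive_sols H p (g j) (d j) (W j)"
  shows "assembled T T' r g d Z = assembled T T' r g d W \<longleftrightarrow>
    (\<forall>j<r. \<forall>s. 1 \<le> s \<and> s \<le> d j \<longrightarrow> Z j s = W j s)"
proof -
  have c: "V j s \<in> carrier_mat (degree (g j)) (degree (g j))"
    if "\<And>j. j < r \<Longrightarrow> successive_sols H p (g j) (d j) (V j)" "j < r" "1 \<le> s" "s \<le> d j" for V j s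
    using that(1)[OF that(2)] that(3,4) by (auto simp: successive_sols_iff[OF d_pos[OF that(2)]] dest: mats_over_carrier)
  have inj: "block_toeplitz (degree (g j)) (d j) (Z j) = block_toeplitz (degree (g j)) (d j) (W j) \<longleftrightarrow>
      (\<forall>s. 1 \<le> s \<and> s \<le> d j \<longrightarrow> Z j s = W j s)" if "j < r" for j
    using c[OF Z that] c[OF W that] by (intro block_toeplitz_inject) auto
  have "assembled T T' r g d Z = assembled T T' r g d W \<longleftrightarrow> toeplitz_sum Z = toeplitz_sum W"
    unfolding assembled_def by (rule conjugate_inject[OF toeplitz_sum_carrier toeplitz_sum_carrier])
  also have "\<dots> \<longleftrightarrow> (\<forall>j<r. block_toeplitz (degree (g j)) (d j) (Z j) = block_toeplitz (degree (g j)) (d j) (W j))"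
  proof
    assume *: "toeplitz_sum Z = toeplitz_sum W"
    show "\<forall>j<r. block_toeplitz (degree (g j)) (d j) (Z j) = block_toeplitz (degree (g j)) (d j) (W j)"
    proof (intro allI impI)
      fix j assume "j < r"
      from bdiag_inject[where h = h, OF _ _ * this]
      show "block_toeplitz (degree (g j)) (d j) (Z j) = block_toeplitz (degree (g j)) (d j) (W j)" by simp
    qed
  next
    assume *: "\<forall>j<r. block_toeplitz (degree (g j)) (d j) (Z j) = block_toeplitz (degree (g j)) (d j) (W j)"
    show "toeplitz_sum Z = toeplitz_sum W"
      by (intro arg_cong[of _ _ diag_block_mat] map_cong refl) (use * in auto)
  qed
  finally show ?thesis using inj by simp
qed

lemma successive_sols_cond_D:
  assumes j: "j < r" and d: "d j > 1" and Z: "successive_sols H p (g j) (d j) Z"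
  shows "cond_D p (Z 1)"
proof -
  have Z1: "Z 1 \<in> mats_over H (degree (g j))" "poly_mat p (Z 1) = companion (g j)"
    using Z by (auto simp: successive_sols_def poly_sols_def)
  note Z1c = mats_over_carrier[OF Z1(1)]
  have "Z 2 \<in> E2_sols H (degree (g j)) p (Z 1)" using Z d by (simp add: successive_sols_def)
  then have "Z 2 \<in> mats_over H (degree (g j))" and Z2: "diff_op p (Z 1) (Z 2) = 1\<^sub>m (degree (g j))"
    unfolding E2_sols_iff[OF Z1c] by simp_all
  then have "Z 2 \<in> carrier_mat (degree (g j)) (degree (g j))" by (simp add: mats_over_def)
  then show ?thesis using E2_solvable_imp_cond_D[OF Z1c Z1(2) _ Z2] by simp
qed

lemma ex_assembled_solution:
  assumes p: "p \<in> polys_over H"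
    and X1: "\<And>j. j < r \<Longrightarrow> X1 j \<in> poly_sols H (degree (g j)) p (companion (g j))"
      "\<And>j. j < r \<Longrightarrow> d j > 1 \<Longrightarrow> cond_D p (X1 j)"
  shows "\<exists>X. (\<forall>j<r. X j 1 = X1 j \<and> unique_successive_sols H p (g j) (d j) (X j)) \<and>
    assembled T T' r g d X \<in> poly_sols H n p A"
proof -
  have "\<forall>j. \<exists>X. j < r \<longrightarrow> X 1 = X1 j \<and> unique_successive_sols H p (g j) (d j) X"
    using ex_unique_successive_sols[OF p] X1 by blast
  then obtain X where X: "\<And>j. j < r \<Longrightarrow> X j 1 = X1 j \<and> unique_successive_sols H p (g j) (d j) (X j)"
    by metis
  then have "assembled T T' r g d X \<in> poly_sols H n p A"
    unfolding solutions_eq_assembled using unique_successive_imp_successive by blast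
  then show ?thesis using X by blast
qed

text \<open>
  A tuple of solutions \<open>X\<^sub>1\<^sub>,\<^sub>j\<close> for the companion matrices is extended by the unique solutions of the
  successive equations; conversely the tuple is read off the diagonal blocks.
\<close>

lemma ecard_solutions:
  assumes p: "p \<in> polys_over H"
    and ne: "\<And>j. j < r \<Longrightarrow> poly_sols H (degree (g j)) p (companion (g j)) \<noteq> {}"
    and D: "\<And>j X1. j < r \<Longrightarrow> d j > 1 \<Longrightarrow> X1 \<in> poly_sols H (degree (g j)) p (companion (g j)) \<Longrightarrow> cond_D p X1"
  shows "ecard (poly_sols H n p A) = (\<Prod>j<r. ecard (poly_sols H (degree (g j)) p (companion (g j))))"
proof -
  define S where "S j = poly_sols H (degree (g j)) p (companion (g j))" for j
  have "\<forall>j x. \<exists>X. j < r \<longrightarrow> x \<in> S j \<longrightarrow> X 1 = x \<and> unique_successive_sols H p (g j) (d j) X"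
    using ex_unique_successive_sols[OF p] D unfolding S_def by blast
  then obtain W where W: "\<And>j x. j < r \<Longrightarrow> x \<in> S j \<Longrightarrow> W j x 1 = x \<and> unique_successive_sols H p (g j) (d j) (W j x)"
    by metis
  define \<phi> where "\<phi> f = assembled T T' r g d (\<lambda>j. W j (f j))" for f
  have succ: "successive_sols H p (g j) (d j) (W j (f j))" if "f \<in> PiE {..<r} S" "j < r" for f j
    using W[of j "f j"] that by (intro unique_successive_imp_successive) (auto simp: PiE_mem)
  have "bij_betw \<phi> (PiE {..<r} S) (poly_sols H n p A)"
  proof (rule bij_betw_imageI)
    show "inj_on \<phi> (PiE {..<r} S)"
    proof (rule inj_onI)
      fix f f' assume f: "f \<in> PiE {..<r} S" and f': "f' \<in> PiE {..<r} S" and eq: "\<phi> f = \<phi> f'"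
      show "f = f'"
      proof (rule PiE_ext[OF f f'])
        fix j assume j: "j \<in> {..<r}"
        have "W j (f j) 1 = W j (f' j) 1"
          using eq assembled_eq_iff[of p "\<lambda>j. W j (f j)" "\<lambda>j. W j (f' j)"] succ[OF f] succ[OF f'] j d_pos[of j]
          unfolding \<phi>_def by auto
        then show "f j = f' j" using W[of j "f j"] W[of j "f' j"] f f' j by (auto simp: PiE_mem)
      qed
    qed
    show "\<phi> ` PiE {..<r} S = poly_sols H n p A"
    proof (intro equalityI subsetI)
      fix X assume "X \<in> \<phi> ` PiE {..<r} S"
      then show "X \<in> poly_sols H n p A" unfolding solutions_eq_assembled \<phi>_def using succ by blast
    next
      fix X assume "X \<in> poly_sols H n p A"
      then obtain Z where X: "X = assembled T T' r g d Z" and Z: "\<And>j. j < r \<Longrightarrow> successive_sols H p (g j) (d j) (Z j)"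
        unfolding solutions_eq_assembled by blast
      define f where "f = (\<lambda>j\<in>{..<r}. Z j 1)"
      have f: "f \<in> PiE {..<r} S" using Z by (auto simp: f_def S_def successive_sols_def)
      have agree: "W j (f j) s = Z j s" if "j < r" "1 \<le> s" "s \<le> d j" for j s
      proof -
        have fj: "f j = Z j 1" using that by (simp add: f_def)
        have "f j \<in> S j" using f that by (auto simp: PiE_mem)
        note Wj = W[OF that(1) this]
        have "W j (f j) 1 = Z j 1" using Wj fj by simp
        then show ?thesis
          by (rule unique_successive_sols_determined[OF conjunct2[OF Wj] Z[OF that(1)] _ that(2,3)])
      qed
      have "assembled T T' r g d (\<lambda>j. W j (f j)) = assembled T T' r g d Z \<longleftrightarrow>
          (\<forall>j<r. \<forall>s. 1 \<le> s \<and> s \<le> d j \<longrightarrow> W j (f j) s = Z j s)"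
        by (rule assembled_eq_iff[where p = p]) (erule succ[OF f], erule Z)
      moreover have "\<forall>j<r. \<forall>s. 1 \<le> s \<and> s \<le> d j \<longrightarrow> W j (f j) s = Z j s"
        by (intro allI impI agree) auto
      ultimately have "X = \<phi> f" unfolding X \<phi>_def by (rule iffD2[THEN sym])
      then show "X \<in> \<phi> ` PiE {..<r} S" using f by (rule image_eqI)
    qed
  qed
  then have "ecard (poly_sols H n p A) = ecard (PiE {..<r} S)" using ecard_bij_betw by metis
  also have "\<dots> = (\<Prod>j<r. ecard (S j))" by (rule ecard_PiE) (use ne in \<open>simp add: S_def\<close>)
  finally show ?thesis by (simp add: S_def)
qed

end

theorem theorem7p1:
  fixes H :: "complex set" and A T T' :: "complex mat" and p :: "complex poly"
    and g :: "nat \<Rightarrow> complex poly" and d :: "nat \<Rightarrow> nat" and n r :: nat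
  assumes H: "subfield H class_ring"
    and A: "A \<in> mats_over H n" "nonderogatory A"
    and char_poly: "char_poly A = (\<Prod>j<r. g j ^ d j)"
    and d: "\<And>j. j < r \<Longrightarrow> d j \<ge> 1"
    and g: "\<And>j. j < r \<Longrightarrow> g j \<in> polys_over H"
      "\<And>j. j < r \<Longrightarrow> monic (g j)"
      "\<And>j. j < r \<Longrightarrow> irreducible_over H (g j)"
      "\<And>i j. i < r \<Longrightarrow> j < r \<Longrightarrow> i \<noteq> j \<Longrightarrow> coprime (g i) (g j)"
    and T: "T \<in> mats_over H n" "T' \<in> carrier_mat n n" "inverts_mat T T'" "inverts_mat T' T"
    and companion_jordan_form:
      "A = T' * diag_block_mat (map (\<lambda>j. companion_jordan (g j) (d j)) [0..<r]) * T"
    and p: "p \<in> polys_over H"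
  shows
    "\<comment> \<open>conditions (D) and (D') are equivalent\<close>
     (\<forall>j<r. \<forall>X1 \<in> mats_over H (degree (g j)). cond_D p X1 \<longleftrightarrow> cond_D' p X1) \<and>
     \<comment> \<open>(i)\<close>
     (poly_sols H n p A \<noteq> {} \<longrightarrow>
       (\<forall>j<r. \<forall>z. poly (g j) z = 0 \<longrightarrow> (\<exists>\<mu> \<in> adjoin H z. poly p \<mu> = z))) \<and>
     \<comment> \<open>(ii)--(v)\<close>
     ((\<forall>z \<in> spectrum A. \<exists>\<mu> \<in> adjoin H z. poly p \<mu> = z) \<longrightarrow>
     (\<forall>lam m. (\<forall>j<r. poly (g j) (lam j) = 0 \<and>
                      m j = ecard {\<mu> \<in> adjoin H (lam j). poly p \<mu> = lam j}) \<longrightarrow>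
       \<comment> \<open>(ii)\<close>
       (\<forall>j<r. ecard (poly_sols H (degree (g j)) p (companion (g j))) = m j) \<and>
       \<comment> \<open>(iii)\<close>
       ((\<forall>j<r. d j > 1 \<longrightarrow>
            (\<exists>X1 \<in> poly_sols H (degree (g j)) p (companion (g j)). cond_D p X1)) \<longrightarrow>
          (\<exists>X. (\<forall>j<r. unique_successive_sols H p (g j) (d j) (X j) \<and>
                       (d j > 1 \<longrightarrow> cond_D p (X j 1))) \<and>
               assembled T T' r g d X \<in> poly_sols H n p A) \<and>
          (\<forall>X1. (\<forall>j<r. X1 j \<in> poly_sols H (degree (g j)) p (companion (g j)) \<and>
                        (d j > 1 \<longrightarrow> cond_D p (X1 j))) \<longrightarrow>
             (\<exists>X. (\<forall>j<r. X j 1 = X1 j \<and> unique_successive_sols H p (g j) (d j) (X j)) \<and>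
                  assembled T T' r g d X \<in> poly_sols H n p A))) \<and>
       \<comment> \<open>(iv)\<close>
       ((\<forall>j<r. d j > 1 \<longrightarrow>
            (\<forall>X1 \<in> poly_sols H (degree (g j)) p (companion (g j)). cond_D p X1)) \<longrightarrow>
          ecard (poly_sols H n p A) = (\<Prod>j<r. m j)) \<and>
       \<comment> \<open>(v)\<close>
       (\<forall>j<r. \<forall>Z. d j > 1 \<and> successive_sols H p (g j) (d j) Z \<and> \<not> cond_D p (Z 1) \<longrightarrow>
          (\<exists>X. X j = Z \<and> (\<forall>i<r. successive_sols H p (g i) (d i) (X i)) \<and>
               assembled T T' r g d X \<in> poly_sols H n p A) \<and>
          infinite (poly_sols H n p A))))"
proof -
  interpret number_field H by (rule number_field.intro[OF H])
  have gpos: "degree (g j) > 0" if "j < r" for j using g(3)[OF that] by (simp add: irreducible_over_def)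
  have Ac: "A \<in> carrier_mat n n" by (rule mats_over_carrier[OF A(1)])
  interpret companion_blocks g d r
    by unfold_locales (use g(2,4) gpos d irreducible_coprime_pderiv[OF g(3)] in auto)
  have size: "n = size_B"
    using degree_monic_char_poly[OF Ac] degree_prod_blocks char_poly by simp
  have Tc: "T \<in> carrier_mat n n" by (rule mats_over_carrier[OF T(1)])
  interpret companion_jordan_form H g d r A T T' n
    by unfold_locales
      (use g(1) T Tc companion_jordan_form size in \<open>auto simp: inverts_mat_def\<close>)
  have root_eigen: "z \<in> spectrum A" if j: "j < r" and z: "poly (g j) z = 0" for j z
  proof -
    have "poly (char_poly A) z = 0"
      unfolding char_poly poly_prod using j z d[OF j] by (intro prod_zero bexI[of _ j]) auto
    then show ?thesis using eigenvalue_root_char_poly[OF Ac] by (simp add: spectrum_def)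
  qed
  note comp = companion_solutions[OF g(2,3) p]
  have D_iff: "\<forall>j<r. \<forall>X1 \<in> mats_over H (degree (g j)). cond_D p X1 \<longleftrightarrow> cond_D' p X1"
    using cond_D_iff_cond_D' mats_over_carrier by blast
  have part1: "\<exists>\<mu>\<in>adjoin H z. poly p \<mu> = z"
    if ne: "poly_sols H n p A \<noteq> {}" and j: "j < r" and z: "poly (g j) z = 0" for j z
  proof -
    obtain Z where "\<forall>j<r. successive_sols H p (g j) (d j) (Z j)"
      using ne unfolding solutions_eq_assembled by blast
    then have "Z j 1 \<in> poly_sols H (degree (g j)) p (companion (g j))"
      using j by (simp add: successive_sols_def)
    then show ?thesis using comp(2)[OF j j z] by blast
  qed
  show ?thesis
  proof (intro conjI allI impI, goal_cases)
    case (1 j)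
    then show ?case using D_iff by blast
  next
    case (2 j z)
    then show ?case using part1 by blast
  next
    case (3 lam m j)
    then show ?case using comp(1)[of j "lam j"] by simp
  next
    case (4 lam m)
    have "\<forall>j. \<exists>x. j < r \<longrightarrow> x \<in> poly_sols H (degree (g j)) p (companion (g j)) \<and> (d j > 1 \<longrightarrow> cond_D p x)"
    proof
      fix j
      show "\<exists>x. j < r \<longrightarrow> x \<in> poly_sols H (degree (g j)) p (companion (g j)) \<and> (d j > 1 \<longrightarrow> cond_D p x)"
      proof (cases "j < r \<and> \<not> d j > 1")
        case True
        then have "poly (g j) (lam j) = 0" using 4 by blast
        moreover from this True have "lam j \<in> spectrum A" using root_eigen by blast
        ultimately have "poly_sols H (degree (g j)) p (companion (g j)) \<noteq> {}"
          using comp(2)[of j "lam j"] True 4(1) by blast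
        then show ?thesis using True by blast
      qed (use 4 in blast)
    qed
    then obtain X1 where X1: "\<And>j. j < r \<Longrightarrow> X1 j \<in> poly_sols H (degree (g j)) p (companion (g j))"
      "\<And>j. j < r \<Longrightarrow> d j > 1 \<Longrightarrow> cond_D p (X1 j)" by metis
    show ?case using ex_assembled_solution[OF p X1] X1(2) by metis
  next
    case (5 lam m X1)
    then show ?case using ex_assembled_solution[OF p, of X1] by blast
  next
    case (6 lam m)
    have z: "poly (g j) (lam j) = 0" "m j = ecard {\<mu> \<in> adjoin H (lam j). poly p \<mu> = lam j}" if "j < r" for j
      using 6 that by blast+
    have "poly_sols H (degree (g j)) p (companion (g j)) \<noteq> {}" if "j < r" for j
      using comp(2)[OF that that z(1)[OF that]] root_eigen[OF that z(1)[OF that]] 6(1) by blast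
    then have "ecard (poly_sols H n p A) = (\<Prod>j<r. ecard (poly_sols H (degree (g j)) p (companion (g j))))"
      using 6 by (intro ecard_solutions[OF p]) blast+
    also have "\<dots> = (\<Prod>j<r. m j)"
      by (intro prod.cong refl) (use comp(1) z in auto)
    finally show ?case .
  next
    case (7 lam m j Z)
    then show ?case using successive_sols_cond_D by blast
  next
    case (8 lam m j Z)
    then show ?case using successive_sols_cond_D by blast
  qed
qed

end
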